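(* Let $\Omega\subset\mathbb{P}(\mathbb{R}^{d+1})$ be a properly convex domain, let $\Gamma\le\mathrm{Aut}(\Omega)$ be a discrete subgroup that acts co-compactly on $\Omega$, and let $\gamma\in\Gamma$ with $\tau_\Omega(\gamma)>0$. If $\gamma$ has an axis, then the following are equivalent: (1) $\gamma$ is biproximal; (2) none of the axes of $\gamma$ are contained in a half triangle in $\Omega$; (3) $\gamma$ is a rank one isometry.
   Context: A properly convex domain is a nonempty open set $\Omega\subset\mathbb{P}(\mathbb{R}^{d+1})$ such that some affine chart contains $\overline\Omega$ and in it $\Omega$ is a bounded convex set. For $x,y\in\overline\Omega$, $[x,y]\subset\overline\Omega$ is the closed projective line segment joining them, and $(x,y)=[x,y]\setminus\{x,y\}$. The Hilbert metric is $d_\Omega(x,y)=\frac12\log\frac{|b-x||y-a|}{|b-y||x-a|}$, where $a,b\in\partial\Omega$ are the endpoints of the intersection of $\overline\Omega$ with the projective line through $x\ne y$, ordered $a,x,y,b$ (computed in an affine chart containing $\overline{\Omega}$). $\mathrm{Aut}(\Omega)=\{g\in\mathrm{PGL}_{d+1}(\mathbb{R}): g\Omega=\Omega\}$. $\tau_\Omega(\gamma):=\inf_{x\in\Omega}d_\Omega(x,\gamma x)$. Axis of $\gamma$: a non-trivial (open) projective line segment of the form $\mathbb{P}(V)\cap\Omega$ with $V\le\mathbb{R}^{d+1}$ a two-dimensional $\gamma$-invariant linear subspace. For $a,b\in\partial\Omega$ with $(a,b)\subset\Omega$, $(a,b)$ is contained in a half triangle in $\Omega$ if there is $z\in\partial\Omega$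 with $[a,z]\cup[z,b]\subset\partial\Omega$. $\gamma$ is a rank one isometry if $\tau_\Omega(\gamma)>0$, $\gamma$ has an axis, and no axis of $\gamma$ is contained in a half triangle in $\Omega$. Biproximal: order the complex eigenvalues (with multiplicity) of a lift of $\gamma$ to $\mathrm{GL}_{d+1}(\mathbb{R})$ by $|\lambda_1|\ge\dots\ge|\lambda_{d+1}|$; $\gamma$ is biproximal if $|\lambda_1|>|\lambda_2|$ and $|\lambda_d|>|\lambda_{d+1}|$. *)

theory Defs
  imports
    "HOL-Analysis.Analysis"
    "HOL-Algebra.Group"
    "HOL-Computational_Algebra.Polynomial"
    "HOL-Library.Multiset"
begin

section \<open>Projective space\<close>

text \<open>Throughout, the Euclidean space of dimension \<open>d + 1\<close> is \<open>real ^ 'n\<close> with \<open>CARD('n) = d + 1\<close>.\<close>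

definition proj_rel :: "real ^ 'n \<Rightarrow> real ^ 'n \<Rightarrow> bool" where
  "proj_rel v w \<longleftrightarrow> v \<noteq> 0 \<and> w \<noteq> 0 \<and> (\<exists>c. c \<noteq> 0 \<and> w = c *\<^sub>R v)"

lemma part_equivp_proj_rel: "part_equivp (proj_rel :: real ^ 'n::finite \<Rightarrow> _)"
proof (rule part_equivpI)
  show "\<exists>x :: real ^ 'n. proj_rel x x"
    by (rule exI[of _ "axis undefined 1"]) (auto simp: proj_rel_def axis_eq_0_iff intro!: exI[of _ 1])
  show "symp (proj_rel :: real ^ 'n \<Rightarrow> _)"
  proof (rule sympI)
    fix x y :: "real ^ 'n" assume "proj_rel x y"
    then obtain c where "x \<noteq> 0" "y \<noteq> 0" "c \<noteq> 0" "y = c *\<^sub>R x" by (auto simp: proj_rel_def)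
    then show "proj_rel y x" by (auto simp: proj_rel_def intro!: exI[of _ "inverse c"])
  qed
  show "transp (proj_rel :: real ^ 'n \<Rightarrow> _)"
  proof (rule transpI)
    fix x y z :: "real ^ 'n" assume "proj_rel x y" "proj_rel y z"
    then obtain c e where "x \<noteq> 0" "z \<noteq> 0" "c \<noteq> 0" "e \<noteq> 0" "y = c *\<^sub>R x" "z = e *\<^sub>R y"
      by (auto simp: proj_rel_def)
    then show "proj_rel x z" by (auto simp: proj_rel_def intro!: exI[of _ "e * c"])
  qed
qed

quotient_type 'n proj = "real ^ ('n::finite)" / partial: proj_rel
  by (rule part_equivp_proj_rel)

instantiation proj :: (finite) topological_space
begin

definition open_proj :: "'a proj set \<Rightarrow> bool" where
  "open_proj U \<longleftrightarrow> openin (top_of_set (- {0})) {v. v \<noteq> 0 \<and> abs_proj v \<in> U}"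

instance
proof
  show "open (UNIV :: 'a proj set)"
    by (auto simp: open_proj_def Compl_eq openin_subtopology_self intro!: openin_subtopology_refl[THEN iffD2])
next
  fix S T :: "'a proj set" assume "open S" "open T"
  then have "openin (top_of_set (- {0}))
      ({v. v \<noteq> 0 \<and> abs_proj v \<in> S} \<inter> {v. v \<noteq> 0 \<and> abs_proj v \<in> T})"
    by (auto simp: open_proj_def)
  also have "{v. v \<noteq> 0 \<and> abs_proj v \<in> S} \<inter> {v. v \<noteq> 0 \<and> abs_proj v \<in> T}
      = {v. v \<noteq> 0 \<and> abs_proj v \<in> S \<inter> T}" by auto
  finally show "open (S \<inter> T)" by (simp add: open_proj_def)
next
  fix K :: "'a proj set set" assume "\<forall>S\<in>K. open S"
  then have "openin (top_of_set (- {0})) (\<Union>S\<in>K. {v. v \<noteq> 0 \<and> abs_proj v \<in> S})"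
    by (intro openin_Union) (auto simp: open_proj_def)
  also have "(\<Union>S\<in>K. {v. v \<noteq> 0 \<and> abs_proj v \<in> S}) = {v. v \<noteq> 0 \<and> abs_proj v \<in> \<Union>K}" by auto
  finally show "open (\<Union>K)" by (simp add: open_proj_def)
qed

end

definition proj_space :: "(real ^ 'n::finite) set \<Rightarrow> 'n proj set" where
  "proj_space V = {abs_proj v | v. v \<in> V \<and> v \<noteq> 0}"

definition proj_line :: "'n::finite proj \<Rightarrow> 'n proj \<Rightarrow> 'n proj set" where
  "proj_line x y = proj_space (span {rep_proj x, rep_proj y})"


section \<open>The projective linear group\<close>

definition pgl_rel :: "real ^ 'n ^ 'n \<Rightarrow> real ^ 'n ^ 'n \<Rightarrow> bool" where
  "pgl_rel A B \<longleftrightarrow> invertible A \<and> invertible B \<and> (\<exists>c. c \<noteq> 0 \<and> B = c *\<^sub>R A)"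

lemma part_equivp_pgl_rel: "part_equivp (pgl_rel :: real ^ 'n ^ 'n::finite \<Rightarrow> _)"
proof (rule part_equivpI)
  show "\<exists>x :: real ^ 'n ^ 'n. pgl_rel x x"
    by (rule exI[of _ "mat 1"]) (auto simp: pgl_rel_def invertible_def intro!: exI[of _ 1] exI[of _ "mat 1"])
  show "symp (pgl_rel :: real ^ 'n ^ 'n \<Rightarrow> _)"
  proof (rule sympI)
    fix x y :: "real ^ 'n ^ 'n" assume "pgl_rel x y"
    then obtain c where "invertible x" "invertible y" "c \<noteq> 0" "y = c *\<^sub>R x" by (auto simp: pgl_rel_def)
    then show "pgl_rel y x" by (auto simp: pgl_rel_def intro!: exI[of _ "inverse c"])
  qed
  show "transp (pgl_rel :: real ^ 'n ^ 'n \<Rightarrow> _)"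
  proof (rule transpI)
    fix x y z :: "real ^ 'n ^ 'n" assume "pgl_rel x y" "pgl_rel y z"
    then obtain c e where "invertible x" "invertible z" "c \<noteq> 0" "e \<noteq> 0" "y = c *\<^sub>R x" "z = e *\<^sub>R y"
      by (auto simp: pgl_rel_def)
    then show "pgl_rel x z" by (auto simp: pgl_rel_def intro!: exI[of _ "e * c"])
  qed
qed

quotient_type 'n pgl = "real ^ ('n::finite) ^ 'n" / partial: pgl_rel
  by (rule part_equivp_pgl_rel)

instantiation pgl :: (finite) topological_space
begin

definition open_pgl :: "'a pgl set \<Rightarrow> bool" where
  "open_pgl U \<longleftrightarrow> openin (top_of_set {A. invertible A}) {A. invertible A \<and> abs_pgl A \<in> U}"

instance
proof
  show "open (UNIV :: 'a pgl set)"
    by (simp add: open_pgl_def)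
next
  fix S T :: "'a pgl set" assume "open S" "open T"
  then have "openin (top_of_set {A. invertible A})
      ({A. invertible A \<and> abs_pgl A \<in> S} \<inter> {A. invertible A \<and> abs_pgl A \<in> T})"
    by (auto simp: open_pgl_def)
  also have "{A. invertible A \<and> abs_pgl A \<in> S} \<inter> {A. invertible A \<and> abs_pgl A \<in> T}
      = {A. invertible A \<and> abs_pgl A \<in> S \<inter> T}" by auto
  finally show "open (S \<inter> T)" by (simp add: open_pgl_def)
next
  fix K :: "'a pgl set set" assume "\<forall>S\<in>K. open S"
  then have "openin (top_of_set {A. invertible A}) (\<Union>S\<in>K. {A. invertible A \<and> abs_pgl A \<in> S})"
    by (intro openin_Union) (auto simp: open_pgl_def)
  also have "(\<Union>S\<in>K. {A. invertible A \<and> abs_pgl A \<in> S}) = {A. invertible A \<and> abs_pgl A \<in> \<Union>K}" by auto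
  finally show "open (\<Union>K)" by (simp add: open_pgl_def)
qed

end

lift_definition pgl_mult :: "'n::finite pgl \<Rightarrow> 'n pgl \<Rightarrow> 'n pgl" is "(**)"
proof -
  fix A A' B B' :: "real ^ 'n ^ 'n"
  assume "pgl_rel A A'" "pgl_rel B B'"
  then obtain c e where *: "invertible A" "invertible A'" "invertible B" "invertible B'"
    "c \<noteq> 0" "e \<noteq> 0" "A' = c *\<^sub>R A" "B' = e *\<^sub>R B"
    by (auto simp: pgl_rel_def)
  then have "A' ** B' = (c * e) *\<^sub>R (A ** B)"
    by (simp add: vec_eq_iff matrix_matrix_mult_def sum_distrib_left mult_ac)
  with * show "pgl_rel (A ** B) (A' ** B')"
    unfolding pgl_rel_def by (metis invertible_mult mult_eq_0_iff)
qed

lift_definition pgl_one :: "'n::finite pgl" is "mat 1"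
  by (auto simp: pgl_rel_def invertible_def intro!: exI[of _ 1] exI[of _ "mat 1"])

lift_definition pgl_act :: "'n::finite pgl \<Rightarrow> 'n proj \<Rightarrow> 'n proj" is "(*v)"
proof -
  fix A A' :: "real ^ 'n ^ 'n" and v v' :: "real ^ 'n"
  assume "pgl_rel A A'" "proj_rel v v'"
  then obtain c e where *: "invertible A" "invertible A'" "v \<noteq> 0" "v' \<noteq> 0"
    "c \<noteq> 0" "e \<noteq> 0" "A' = c *\<^sub>R A" "v' = e *\<^sub>R v"
    by (auto simp: pgl_rel_def proj_rel_def)
  then have eq: "A' *v v' = (c * e) *\<^sub>R (A *v v)"
    by (simp add: vec_eq_iff matrix_vector_mult_def sum_distrib_left mult_ac)
  have "A *v v \<noteq> 0"
    using \<open>invertible A\<close> \<open>v \<noteq> 0\<close>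
    by (metis invertible_left_inverse matrix_left_invertible_ker)
  with * eq show "proj_rel (A *v v) (A' *v v')"
    by (auto simp: proj_rel_def intro!: exI[of _ "c * e"])
qed

definition PGL :: "'n::finite pgl monoid" where
  "PGL = \<lparr>carrier = UNIV, mult = pgl_mult, one = pgl_one\<rparr>"

lemma group_PGL: "group (PGL :: 'n::finite pgl monoid)"
proof (rule groupI)
  fix x y z :: "'n pgl"
  show "(x \<otimes>\<^bsub>PGL\<^esub> y) \<otimes>\<^bsub>PGL\<^esub> z = x \<otimes>\<^bsub>PGL\<^esub> (y \<otimes>\<^bsub>PGL\<^esub> z)"
    unfolding PGL_def
    by simp (transfer, metis (no_types, lifting) matrix_mul_assoc pgl_rel_def invertible_mult scaleR_one zero_neq_one)
  show "\<one>\<^bsub>PGL\<^esub> \<otimes>\<^bsub>PGL\<^esub> x = x"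
    unfolding PGL_def by simp (transfer, simp)
  have "\<exists>y. pgl_mult y x = pgl_one"
  proof (transfer)
    fix A :: "real ^ 'n ^ 'n" assume "pgl_rel A A"
    then have "invertible A" by (simp add: pgl_rel_def)
    then obtain B where B: "A ** B = mat 1" "B ** A = mat 1" by (auto simp: invertible_def)
    then have "invertible B" by (auto simp: invertible_def)
    moreover have "invertible (mat 1 :: real ^ 'n ^ 'n)" by (auto simp: invertible_def intro!: exI[of _ "mat 1"])
    ultimately show "\<exists>B\<in>{B. pgl_rel B B}. pgl_rel (B ** A) (mat 1)"
      using B unfolding pgl_rel_def
      by (intro bexI[of _ B] conjI exI[of _ "1::real"] CollectI) simp_all
  qed
  then show "\<exists>y\<in>carrier PGL. y \<otimes>\<^bsub>PGL\<^esub> x = \<one>\<^bsub>PGL\<^esub>"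
    by (simp add: PGL_def)
qed (simp_all add: PGL_def)

definition is_lift :: "real ^ 'n ^ 'n \<Rightarrow> 'n::finite pgl \<Rightarrow> bool" where
  "is_lift A g \<longleftrightarrow> invertible A \<and> abs_pgl A = g"


section \<open>Properly convex domains\<close>

text \<open>
  A nonzero vector \<open>w\<close> determines the affine chart \<open>{[v]. w \<bullet> v \<noteq> 0}\<close>, identified with the affine
  hyperplane \<open>{v. w \<bullet> v = 1}\<close>; every affine chart arises in this way.
\<close>
definition affine_chart :: "real ^ 'n \<Rightarrow> 'n::finite proj set" where
  "affine_chart w = {abs_proj v | v. w \<bullet> v \<noteq> 0}"

lift_definition affine_coord :: "real ^ 'n \<Rightarrow> 'n::finite proj \<Rightarrow> real ^ 'n"
  is "\<lambda>w v. (1 / (w \<bullet> v)) *\<^sub>R v"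
  by (auto simp: proj_rel_def)

definition adapted_chart :: "'n::finite proj set \<Rightarrow> real ^ 'n \<Rightarrow> bool" where
  "adapted_chart \<Omega> w \<longleftrightarrow> w \<noteq> 0 \<and> closure \<Omega> \<subseteq> affine_chart w \<and>
     convex (affine_coord w ` \<Omega>) \<and> bounded (affine_coord w ` \<Omega>)"

definition properly_convex_domain :: "'n::finite proj set \<Rightarrow> bool" where
  "properly_convex_domain \<Omega> \<longleftrightarrow> \<Omega> \<noteq> {} \<and> open \<Omega> \<and> (\<exists>w. adapted_chart \<Omega> w)"

text \<open>
  Segments and the Hilbert metric are computed in one arbitrarily chosen affine chart containing
  \<open>closure \<Omega>\<close>; they do not depend on the choice, as coordinate changes are projective maps and
  preserve segments and cross ratios.
\<close>
definition chart :: "'n::finite proj set \<Rightarrow> 'n proj \<Rightarrow> real ^ 'n" where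
  "chart \<Omega> = affine_coord (SOME w. adapted_chart \<Omega> w)"

definition proj_closed_segment :: "'n::finite proj set \<Rightarrow> 'n proj \<Rightarrow> 'n proj \<Rightarrow> 'n proj set" where
  "proj_closed_segment \<Omega> x y = {z \<in> closure \<Omega>. chart \<Omega> z \<in> closed_segment (chart \<Omega> x) (chart \<Omega> y)}"

definition proj_open_segment :: "'n::finite proj set \<Rightarrow> 'n proj \<Rightarrow> 'n proj \<Rightarrow> 'n proj set" where
  "proj_open_segment \<Omega> x y = proj_closed_segment \<Omega> x y - {x, y}"

text \<open>\<open>a\<close>, \<open>b\<close> are the endpoints of the chord of \<open>\<Omega>\<close> through \<open>x\<close>, \<open>y\<close>, in the order \<open>a, x, y, b\<close>.\<close>
definition chord_endpoints ::
  "'n::finite proj set \<Rightarrow> 'n proj \<Rightarrow> 'n proj \<Rightarrow> 'n proj \<Rightarrow> 'n proj \<Rightarrow> bool" where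
  "chord_endpoints \<Omega> x y a b \<longleftrightarrow> a \<in> frontier \<Omega> \<and> b \<in> frontier \<Omega> \<and>
     closure \<Omega> \<inter> proj_line x y = proj_closed_segment \<Omega> a b \<and>
     x \<in> proj_closed_segment \<Omega> a y \<and> y \<in> proj_closed_segment \<Omega> x b"

definition hilbert_dist :: "'n::finite proj set \<Rightarrow> 'n proj \<Rightarrow> 'n proj \<Rightarrow> real" where
  "hilbert_dist \<Omega> x y =
    (if x = y then 0
     else (THE r. \<exists>a b. chord_endpoints \<Omega> x y a b \<and>
       r = 1 / 2 * ln ((dist (chart \<Omega> b) (chart \<Omega> x) * dist (chart \<Omega> y) (chart \<Omega> a)) /
                       (dist (chart \<Omega> b) (chart \<Omega> y) * dist (chart \<Omega> x) (chart \<Omega> a)))))"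


section \<open>Automorphisms\<close>

definition Aut :: "'n::finite proj set \<Rightarrow> 'n pgl set" where
  "Aut \<Omega> = {g. pgl_act g ` \<Omega> = \<Omega>}"

definition acts_cocompactly :: "'n::finite pgl set \<Rightarrow> 'n proj set \<Rightarrow> bool" where
  "acts_cocompactly \<Gamma> \<Omega> \<longleftrightarrow> (\<exists>K \<subseteq> \<Omega>. compact K \<and> (\<Union>g\<in>\<Gamma>. pgl_act g ` K) = \<Omega>)"

definition translation_length :: "'n::finite proj set \<Rightarrow> 'n pgl \<Rightarrow> real" where
  "translation_length \<Omega> g = (INF x\<in>\<Omega>. hilbert_dist \<Omega> x (pgl_act g x))"

text \<open>
  The first conjunct expresses that \<open>l\<close> is a non-trivial open segment; in particular the empty
  intersection of \<open>\<Omega>\<close> with an invariant line is not an axis.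
\<close>
definition is_axis :: "'n::finite proj set \<Rightarrow> 'n pgl \<Rightarrow> 'n proj set \<Rightarrow> bool" where
  "is_axis \<Omega> g l \<longleftrightarrow>
     (\<exists>a\<in>closure \<Omega>. \<exists>b\<in>closure \<Omega>. a \<noteq> b \<and> l = proj_open_segment \<Omega> a b) \<and>
     (\<exists>V A. subspace V \<and> dim V = 2 \<and> is_lift A g \<and> (*v) A ` V = V \<and> l = proj_space V \<inter> \<Omega>)"

definition in_half_triangle :: "'n::finite proj set \<Rightarrow> 'n proj set \<Rightarrow> bool" where
  "in_half_triangle \<Omega> l \<longleftrightarrow>
     (\<exists>a\<in>frontier \<Omega>. \<exists>b\<in>frontier \<Omega>. l = proj_open_segment \<Omega> a b \<and> l \<subseteq> \<Omega> \<and>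
       (\<exists>z\<in>frontier \<Omega>. proj_closed_segment \<Omega> a z \<union> proj_closed_segment \<Omega> z b \<subseteq> frontier \<Omega>))"

definition rank_one_isometry :: "'n::finite proj set \<Rightarrow> 'n pgl \<Rightarrow> bool" where
  "rank_one_isometry \<Omega> g \<longleftrightarrow> g \<in> Aut \<Omega> \<and> translation_length \<Omega> g > 0 \<and> (\<exists>l. is_axis \<Omega> g l) \<and>
     (\<forall>l. is_axis \<Omega> g l \<longrightarrow> \<not> in_half_triangle \<Omega> l)"


section \<open>Biproximality\<close>

definition complex_char_poly :: "real ^ 'n ^ 'n::finite \<Rightarrow> complex poly" where
  "complex_char_poly A =
     det (\<chi> i j. [:- complex_of_real (A $ i $ j), if i = j then 1 else 0:])"

text \<open>
  Moduli of the complex eigenvalues, with algebraic multiplicity, in decreasing order. The list has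
  length \<open>d + 1 = CARD('n)\<close> and is indexed from \<open>0\<close>. Replacing a lift by a scalar multiple rescales the
  whole list, so the choice of lift is immaterial for biproximality.
\<close>
definition eigenvalue_moduli :: "real ^ 'n ^ 'n::finite \<Rightarrow> real list" where
  "eigenvalue_moduli A = rev (sorted_list_of_multiset (image_mset cmod (proots (complex_char_poly A))))"

definition biproximal :: "'n::finite pgl \<Rightarrow> bool" where
  "biproximal g \<longleftrightarrow> (\<exists>A. is_lift A g \<and>
     (let m = eigenvalue_moduli A; N = CARD('n)
      in m ! 0 > m ! 1 \<and> m ! (N - 2) > m ! (N - 1)))"

end

(*
  Let K be the closed cone over the closure of \<Omega>, A the lift of \<gamma> preserving K, and a, b the
  eigenvectors spanning an axis, with eigenvalues p > q > 0. As a + b is interior to K, the powers of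
  A / p are bounded, so every eigenvalue of A on the quotient by a has modulus at most p. If one has
  modulus p, its real eigenspace contains a vector u outside the line of a to which the powers of A / p
  return arbitrarily closely. Such recurrent vectors are never interior to K, and the point
  z = a + s u with s maximal such that z lies in K completes [a, b] to a half triangle. The same
  argument for the inverse of A treats b.

  Conversely let \<gamma> be biproximal and z the vertex of a half triangle. Then (A / p)^n z and
  (q A^-1)^n z have limit points 0, and Brouwer's theorem gives a common eigenvector v of this kind in K.
  Along a + b + n v cocompactness provides group elements P n; the conjugates of A by P n stay in a
  bounded set, so by discreteness infinitely many coincide. This gives elements P m (P j)^-1, for fixed
  j and m tending to infinity, which commute with A and hence fix the lines of a and b; comparing the
  order on K yields m v <= const (a + b) with a constant independent of m, which is absurd.
*)
theory Submission
  imports Defs "HOL-Computational_Algebra.Fundamental_Theorem_Algebra"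
begin


section \<open>Characteristic polynomials and deflation\<close>

text \<open>In the converse the vector \<open>v\<close> serves twice. Since a, b and v are
  eigenvectors, A and its inverse stretch the points a + b + n v by at most a fixed factor in the
  order of K, and this bounds the conjugates. Since the limits L of (A / p)^n and L' of (q A^-1)^n
  along subsequences vanish at v, all these points have the same image a under L and b under L'.
  Applying L and L' to an order comparison between such points therefore bounds the factors by which
  a commuting element stretches a and b, whatever n is, while the points run off along v. The vertex
  z alone is only killed by L and L'; the fixed point argument turns it into an eigenvector.

  Biproximality counts algebraic multiplicities. A known eigenvalue is split off by deflation; the
  remaining ones, including its own repetitions, are the eigenvalues on the quotient by its line.
  Annihilating polynomials and quotient eigenvectors then take the place of the Jordan normal
  form.\<close>

definition char_matrix_poly :: "complex ^ 'n ^ 'n::finite \<Rightarrow> complex poly" where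
  "char_matrix_poly M = det (\<chi> i j. [:- (M $ i $ j), if i = j then 1 else 0:])"

lemma poly_char_matrix_poly:
  fixes M :: "complex ^ 'n::finite ^ 'n"
  shows "poly (char_matrix_poly M) x = det (mat x - M)"
proof -
  have "poly (char_matrix_poly M) x =
      (\<Sum>p | p permutes (UNIV :: 'n set). of_int (sign p) *
        (\<Prod>i\<in>UNIV. poly [:- (M $ i $ p i), if i = p i then 1 else 0:] x))"
    unfolding char_matrix_poly_def det_def by (simp add: poly_sum poly_prod)
  also have "\<dots> = det (mat x - M)"
    unfolding det_def by (intro sum.cong refl arg_cong2[of _ _ _ _ "(*)"] prod.cong) (auto simp: mat_def)
  finally show ?thesis .
qed

text \<open>Only the identity permutation contributes \<open>CARD('n)\<close> linear factors; any
  other permutation meets a constant factor.\<close>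

lemma degree_char_matrix_poly:
  fixes M :: "complex ^ 'n::finite ^ 'n"
  shows "degree (char_matrix_poly M) = CARD('n)"
proof -
  let ?f = "\<lambda>p. \<Prod>i\<in>(UNIV :: 'n set). [:- (M $ i $ p i), if i = p i then 1 else 0:]"
  let ?P = "{p. p permutes (UNIV :: 'n set)}"
  have id: "degree (?f id) = CARD('n)"
    by (subst degree_prod_eq_sum_degree) auto
  have other: "degree (of_int (sign p) * ?f p) < CARD('n)" if p: "p \<in> ?P - {id}" for p
  proof -
    obtain i0 where i0: "p i0 \<noteq> i0" using p by (metis DiffE eq_id_iff singletonI)
    have "degree (?f p) \<le> (\<Sum>i\<in>UNIV. degree [:- (M $ i $ p i), if i = p i then 1 else 0 :: complex:])"
      using degree_prod_sum_le[of "UNIV :: 'n set" "\<lambda>i. [:- (M $ i $ p i), if i = p i then 1 else 0:]"]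
      by (simp add: o_def)
    also have "\<dots> < (\<Sum>i\<in>(UNIV::'n set). 1)"
      by (rule sum_strict_mono_ex1) (use i0 in \<open>auto intro!: exI[of _ i0]\<close>)
    finally have "degree (?f p) < CARD('n)" by simp
    moreover have "degree (of_int (sign p) * ?f p) \<le> degree (?f p)"
      by (rule order.trans[OF degree_mult_le]) simp
    ultimately show ?thesis by linarith
  qed
  have pos: "0 < CARD('n)" by simp
  have "char_matrix_poly M = (\<Sum>p\<in>?P. of_int (sign p) * ?f p)"
    unfolding char_matrix_poly_def det_def by simp
  also have "\<dots> = of_int (sign (id :: 'n \<Rightarrow> 'n)) * ?f id + (\<Sum>p\<in>?P - {id}. of_int (sign p) * ?f p)"
    by (rule sum.remove) (auto simp: finite_permutations permutes_id)
  finally have eq: "char_matrix_poly M = ?f id + (\<Sum>p\<in>?P - {id}. of_int (sign p) * ?f p)"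
    by simp
  have "degree (\<Sum>p\<in>?P - {id}. of_int (sign p) * ?f p) < CARD('n)"
    by (rule degree_sum_less) (use other pos in auto)
  then show ?thesis unfolding eq using id by (subst degree_add_eq_left) auto
qed

text \<open>Wielandt deflation: M minus (l / a $ k) times the rank one matrix a e_k^T. If
  \<open>a\<close> is an eigenvector for \<open>l\<close>, the result kills \<open>a\<close> and
  induces the same map as M on the quotient by \<open>a\<close>.\<close>

definition deflate :: "complex ^ 'n ^ 'n::finite \<Rightarrow> complex \<Rightarrow> complex ^ 'n \<Rightarrow> 'n \<Rightarrow> complex ^ 'n ^ 'n" where
  "deflate M l a k = (\<chi> i j. M $ i $ j - (if j = k then l * a $ i / a $ k else 0))"

lemma deflate_mult: "deflate M l a k *v v = M *v v - (l * v $ k / a $ k) *s a"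
proof -
  have "(\<Sum>j\<in>UNIV. (M $ i $ j - (if j = k then l * a $ i / a $ k else 0)) * v $ j) =
      (\<Sum>j\<in>UNIV. M $ i $ j * v $ j) - l * v $ k / a $ k * a $ i" for i
    by (simp add: left_diff_distrib sum_subtractf if_distrib[of "\<lambda>x. x * _"] cong: if_cong)
  then show ?thesis by (simp add: deflate_def matrix_vector_mult_def vec_eq_iff)
qed

lemma mat_minus_mult:
  fixes M :: "complex ^ 'n::finite ^ 'n"
  shows "(mat x - M) *v v = x *s v - M *v v"
  by (simp add: vec_eq_iff matrix_vector_mult_def left_diff_distrib sum_subtractf mat_def
      if_distrib[of "\<lambda>x. x * _"] cong: if_cong)

text \<open>
  By Cramer's rule, replacing column \<open>k\<close> of \<open>x - M\<close> by \<open>(x - M) a = (x - l) a\<close> multiplies the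
  determinant by \<open>a $ k\<close>; expanding the determinant of \<open>x - deflate M l a k\<close> along column \<open>k\<close> then
  exchanges the eigenvalue \<open>l\<close> for \<open>0\<close>.
\<close>
lemma char_matrix_poly_deflate:
  fixes M :: "complex ^ 'n::finite ^ 'n"
  assumes a: "M *v a = l *s a" and k: "a $ k \<noteq> 0"
  shows "char_matrix_poly M * [:0, 1:] = char_matrix_poly (deflate M l a k) * [:- l, 1:]"
proof (rule poly_ext)
  fix x
  define X where "X = mat x - M"
  have XA: "X *v a = (x - l) *s a"
    unfolding X_def mat_minus_mult a by (simp add: vec_eq_iff left_diff_distrib)
  define D where "D = det (\<chi> i j. if j = k then a $ i else X $ i $ j)"
  have "(x - l) * D = det (\<chi> i j. if j = k then (X *v a) $ i else X $ i $ j)"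
  proof -
    have "det (\<chi> j. if j = k then (x - l) *s a else transpose X $ j) =
        (x - l) * det (\<chi> j. if j = k then a else transpose X $ j)"
      by (rule det_row_mul)
    moreover have "(\<chi> j. if j = k then (x - l) *s a else transpose X $ j) =
        transpose (\<chi> i j. if j = k then (X *v a) $ i else X $ i $ j)"
      by (simp add: XA vec_eq_iff transpose_def)
    moreover have "(\<chi> j. if j = k then a else transpose X $ j) =
        transpose (\<chi> i j. if j = k then a $ i else X $ i $ j)"
      by (simp add: vec_eq_iff transpose_def)
    ultimately show ?thesis by (simp add: D_def det_transpose)
  qed
  then have 1: "(x - l) * D = a $ k * det X" by (simp add: cramer_lemma)
  have 2: "det (mat x - deflate M l a k) = det X + l / a $ k * D"
  proof -
    have "det (\<chi> j. if j = k then transpose X $ k + (l / a $ k) *s a else transpose X $ j) =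
       det (\<chi> j. if j = k then transpose X $ k else transpose X $ j) +
       det (\<chi> j. if j = k then (l / a $ k) *s a else transpose X $ j)"
      by (rule det_row_add)
    also have "det (\<chi> j. if j = k then (l / a $ k) *s a else transpose X $ j) =
        (l / a $ k) * det (\<chi> j. if j = k then a else transpose X $ j)"
      by (rule det_row_mul)
    also have "(\<chi> j. if j = k then transpose X $ k + (l / a $ k) *s a else transpose X $ j) =
        transpose (mat x - deflate M l a k)"
      by (simp add: vec_eq_iff transpose_def X_def deflate_def mat_def)
    also have "(\<chi> j. if j = k then transpose X $ k else transpose X $ j) = transpose X"
      by (simp add: vec_eq_iff)
    also have "(\<chi> j. if j = k then a else transpose X $ j) =
        transpose (\<chi> i j. if j = k then a $ i else X $ i $ j)"
      by (simp add: vec_eq_iff transpose_def)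
    finally show ?thesis by (simp add: D_def det_transpose)
  qed
  have "det (mat x - deflate M l a k) * (x - l) = det X * x"
  proof -
    have "det (mat x - deflate M l a k) * (x - l) = det X * (x - l) + l / a $ k * ((x - l) * D)"
      unfolding 2 distrib_right by (simp only: mult_ac)
    also have "\<dots> = det X * x" unfolding 1 using k by (simp add: field_simps)
    finally show ?thesis .
  qed
  then show "poly (char_matrix_poly M * [:0, 1:]) x =
      poly (char_matrix_poly (deflate M l a k) * [:- l, 1:]) x"
    by (simp add: poly_char_matrix_poly X_def algebra_simps)
qed

lemma char_matrix_poly_root_iff:
  fixes M :: "complex ^ 'n::finite ^ 'n"
  shows "poly (char_matrix_poly M) x = 0 \<longleftrightarrow> (\<exists>v. v \<noteq> 0 \<and> M *v v = x *s v)"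
proof -
  have "poly (char_matrix_poly M) x = 0 \<longleftrightarrow> \<not> invertible (mat x - M)"
    by (simp add: poly_char_matrix_poly invertible_det_nz)
  also have "\<dots> \<longleftrightarrow> (\<exists>v. v \<noteq> 0 \<and> (mat x - M) *v v = 0)"
    using matrix_left_invertible_ker[of "mat x - M"] by (auto simp: invertible_left_inverse)
  finally show ?thesis by (auto simp: mat_minus_mult)
qed

text \<open>Eigenvalues of the map induced by \<open>M\<close> on the quotient by the line through \<open>a\<close>.\<close>
definition quotient_eigenvalue :: "complex ^ 'n ^ 'n::finite \<Rightarrow> complex ^ 'n \<Rightarrow> complex \<Rightarrow> bool" where
  "quotient_eigenvalue M a x \<longleftrightarrow> (\<exists>v c. (\<forall>t. v \<noteq> t *s a) \<and> M *v v = x *s v + c *s a)"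

text \<open>The deflation kills \<open>a\<close>, so its eigenvectors for x \<noteq> 0 avoid the
  line of \<open>a\<close>. Conversely, a quotient eigenvector becomes an eigenvector of the
  deflation after a shift along \<open>a\<close>.\<close>

lemma deflate_eigenvalue_iff:
  fixes M :: "complex ^ 'n::finite ^ 'n"
  assumes a: "M *v a = l *s a" and k: "a $ k \<noteq> 0" and x: "x \<noteq> 0"
  shows "(\<exists>v. v \<noteq> 0 \<and> deflate M l a k *v v = x *s v) \<longleftrightarrow> quotient_eigenvalue M a x"
proof
  assume "\<exists>v. v \<noteq> 0 \<and> deflate M l a k *v v = x *s v"
  then obtain v where v: "v \<noteq> 0" "deflate M l a k *v v = x *s v" by blast
  have Mv: "M *v v = x *s v + (l * v $ k / a $ k) *s a"
    using v(2) unfolding deflate_mult by (simp add: algebra_simps)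
  have "v \<noteq> t *s a" for t
  proof
    assume t: "v = t *s a"
    have "M *v v = (t * l) *s a" unfolding t using a by (simp add: vector_scalar_commute)
    then have "(x * t) *s a = 0" using v(2) k
      unfolding deflate_mult by (simp add: t vec_eq_iff field_simps)
    then have "t = 0" using x k by (metis mult_eq_0_iff vector_mul_eq_0 zero_index)
    then show False using v(1) t by simp
  qed
  then show "quotient_eigenvalue M a x" using Mv unfolding quotient_eigenvalue_def by blast
next
  assume "quotient_eigenvalue M a x"
  then obtain v c where v: "\<And>t. v \<noteq> t *s a" and Mv: "M *v v = x *s v + c *s a"
    unfolding quotient_eigenvalue_def by blast
  define q where "q = v - (v $ k / a $ k) *s a"
  define c' where "c' = c + (v $ k / a $ k) * (x - l)"
  have qk: "q $ k = 0" using k by (simp add: q_def)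
  have q: "q \<noteq> t *s a" for t
  proof
    assume "q = t *s a"
    then have "v = t *s a + (v $ k / a $ k) *s a" by (simp add: q_def eq_diff_eq[symmetric] diff_eq_eq)
    also have "\<dots> = (t + v $ k / a $ k) *s a" by (simp add: vec_eq_iff distrib_right)
    finally have "v = (t + v $ k / a $ k) *s a" .
    then show False using v by blast
  qed
  have Mq: "M *v q = x *s q + c' *s a"
    unfolding q_def c'_def matrix_vector_mult_diff_distrib Mv vector_scalar_commute a
    using k by (simp add: vec_eq_iff field_simps)
  \<comment> \<open>As coordinate \<open>k\<close> of \<open>q\<close> is 0, the deflation acts on
    \<open>q\<close> as M does, and it kills \<open>a\<close>; the multiple c' / x of
    \<open>a\<close> absorbs the error term.\<close>
  define u where "u = q + (c' / x) *s a"
  have "deflate M l a k *v u = x *s u"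
    unfolding deflate_mult u_def matrix_vector_right_distrib Mq vector_scalar_commute a
    using k x qk by (simp add: vec_eq_iff field_simps)
  moreover have "u \<noteq> 0"
    using q[of "- (c' / x)"] by (auto simp: u_def add_eq_0_iff)
  ultimately show "\<exists>v. v \<noteq> 0 \<and> deflate M l a k *v v = x *s v" by blast
qed

text \<open>Deflation trades one root \<open>l\<close> for one root 0, with multiplicities. As M is
  invertible, 0 is an eigenvalue neither of M nor of the quotient, so the roots left after removing
  that 0 are exactly the quotient eigenvalues.\<close>

lemma proots_char_matrix_poly_eigenvector:
  fixes M :: "complex ^ 'n::finite ^ 'n"
  assumes M: "invertible M" and a: "M *v a = l *s a" "a \<noteq> 0"
  obtains N where "proots (char_matrix_poly M) = add_mset l N" "size N = CARD('n) - 1"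
    "set_mset N = {x. quotient_eigenvalue M a x}"
proof -
  obtain k where k: "a $ k \<noteq> 0" using a(2) by (auto simp: vec_eq_iff)
  let ?p = "char_matrix_poly M" and ?q = "char_matrix_poly (deflate M l a k)"
  have inj: "M *v v = 0 \<Longrightarrow> v = 0" for v
    using M by (metis invertible_left_inverse matrix_left_invertible_ker)
  have l: "l \<noteq> 0" using inj a by (metis vector_smult_lzero)
  have deg: "degree ?p = CARD('n)" "degree ?q = CARD('n)" by (simp_all add: degree_char_matrix_poly)
  have nz: "?p \<noteq> 0" "?q \<noteq> 0" using deg by (metis degree_0 zero_less_card_finite less_irrefl)+
  have "proots (?p * [:0, 1:]) = proots (?q * [:- l, 1:])"
    by (simp only: char_matrix_poly_deflate[OF a(1) k])
  then have "proots ?p + proots [:0, 1:] = proots ?q + proots [:- l, 1:]"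
    using nz by (subst (asm) (1 2) proots_mult) auto
  then have eq: "add_mset 0 (proots ?p) = add_mset l (proots ?q)" by simp
  then have "l \<in># proots ?p" using l by (metis insert_noteq_member)
  then obtain N where N: "proots ?p = add_mset l N" by (metis multi_member_split)
  have qN: "proots ?q = add_mset 0 N" using eq by (simp add: N add_mset_commute)
  have "size (proots ?p) = CARD('n)" by (simp add: size_proots_complex deg)
  then have size: "size N = CARD('n) - 1" by (simp add: N)
  have "0 \<notin># proots ?p" using inj nz by (auto simp: char_matrix_poly_root_iff)
  then have N0: "0 \<notin># N" by (simp add: N)
  have not0: "\<not> quotient_eigenvalue M a 0"
  proof
    assume "quotient_eigenvalue M a 0"
    then obtain v c where v: "\<And>t. v \<noteq> t *s a" and "M *v v = c *s a"
      unfolding quotient_eigenvalue_def by auto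
    then have "M *v (v - (c / l) *s a) = 0"
      using l a by (simp add: matrix_vector_mult_diff_distrib vector_scalar_commute)
    then show False using inj v by (metis eq_iff_diff_eq_0)
  qed
  have "x \<in># N \<longleftrightarrow> quotient_eigenvalue M a x" for x
  proof (cases "x = 0")
    case False
    then have "x \<in># N \<longleftrightarrow> x \<in># proots ?q" by (simp add: qN)
    also have "\<dots> \<longleftrightarrow> quotient_eigenvalue M a x"
      using nz by (simp add: char_matrix_poly_root_iff deflate_eigenvalue_iff[OF a(1) k False])
    finally show ?thesis .
  qed (use N0 not0 in auto)
  then show ?thesis using that N size by blast
qed

section \<open>Extreme entries of a sorted list\<close>

lemma rev_sorted_list_of_multiset_top:
  fixes x :: "'a::linorder"
  assumes N: "N \<noteq> {#}" and le: "\<forall>y\<in>#N. y \<le> x"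
  defines "m \<equiv> rev (sorted_list_of_multiset (add_mset x N))"
  shows "m ! 0 = x" "m ! 1 \<in># N" "\<And>y. y \<in># N \<Longrightarrow> y \<le> m ! 1"
proof -
  let ?s = "sorted_list_of_multiset N"
  have s: "?s \<noteq> []" using N by (metis mset_sorted_list_of_multiset mset_zero_iff)
  have m: "m = x # rev ?s"
    using le by (simp add: m_def sorted_insort_is_snoc)
  have m1: "m ! 1 = last ?s" using s by (simp add: m hd_conv_nth[symmetric] hd_rev)
  show "m ! 0 = x" by (simp add: m)
  show "m ! 1 \<in># N" unfolding m1 using last_in_set[OF s] by simp
  show "y \<le> m ! 1" if "y \<in># N" for y
  proof -
    have "y \<in> set ?s" using that by simp
    moreover have "sorted ?s" by simp
    ultimately show ?thesis unfolding m1
      by (metis append_butlast_last_id s sorted_append set_append Un_iff list.set_intros(1)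
          empty_iff empty_set set_ConsD order_refl)
  qed
qed

lemma rev_sorted_list_of_multiset_bottom:
  fixes x :: "'a::linorder"
  assumes N: "N \<noteq> {#}" and le: "\<forall>y\<in>#N. x \<le> y"
  defines "m \<equiv> rev (sorted_list_of_multiset (add_mset x N))"
  shows "m ! size N = x" "m ! (size N - 1) \<in># N" "\<And>y. y \<in># N \<Longrightarrow> m ! (size N - 1) \<le> y"
proof -
  let ?s = "sorted_list_of_multiset N"
  have s: "?s \<noteq> []" using N by (metis mset_sorted_list_of_multiset mset_zero_iff)
  have len: "length ?s = size N" by (metis mset_sorted_list_of_multiset size_mset)
  have "insort x ?s = x # ?s"
    using le by (intro insort_is_Cons) auto
  then have m: "m = rev ?s @ [x]" by (simp add: m_def)
  have pos: "size N > 0" using N by (simp add: nonempty_has_size)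
  have m1: "m ! (size N - 1) = hd ?s"
    using s pos by (simp add: m nth_append len rev_nth hd_conv_nth)
  show "m ! size N = x" by (simp add: m nth_append len)
  show "m ! (size N - 1) \<in># N" unfolding m1 using hd_in_set[OF s] by simp
  show "m ! (size N - 1) \<le> y" if "y \<in># N" for y
  proof -
    have "y \<in> set ?s" using that by simp
    moreover have "sorted ?s" by simp
    ultimately show ?thesis unfolding m1 using s by (cases ?s) auto
  qed
qed

section \<open>Real matrices over the complex numbers, and the moduli of their eigenvalues\<close>

definition complex_vector :: "real ^ 'n \<Rightarrow> complex ^ 'n::finite" where
  "complex_vector v = (\<chi> i. complex_of_real (v $ i))"

definition complex_matrix :: "real ^ 'n ^ 'm \<Rightarrow> complex ^ 'n::finite ^ 'm::finite" where
  "complex_matrix A = (\<chi> i j. complex_of_real (A $ i $ j))"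

lemma complex_matrix_mult_vector: "complex_matrix A *v complex_vector v = complex_vector (A *v v)"
  by (simp add: complex_matrix_def complex_vector_def matrix_vector_mult_def vec_eq_iff)

lemma complex_matrix_mult: "complex_matrix A ** complex_matrix B = complex_matrix (A ** B)"
  by (simp add: complex_matrix_def matrix_matrix_mult_def vec_eq_iff)

lemma complex_matrix_mat1: "complex_matrix (mat 1) = mat 1"
  by (simp add: complex_matrix_def mat_def vec_eq_iff)

lemma complex_vector_scaleR: "complex_vector (c *\<^sub>R v) = complex_of_real c *s complex_vector v"
  by (simp add: complex_vector_def vec_eq_iff)

lemma complex_vector_eq_0_iff [simp]: "complex_vector v = 0 \<longleftrightarrow> v = 0"
  by (simp add: complex_vector_def vec_eq_iff)

lemma invertible_complex_matrix: "invertible A \<Longrightarrow> invertible (complex_matrix A)"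
  unfolding invertible_def by (metis complex_matrix_mult complex_matrix_mat1)

lemma complex_char_poly_eq: "complex_char_poly A = char_matrix_poly (complex_matrix A)"
  by (simp add: complex_char_poly_def char_matrix_poly_def complex_matrix_def)

abbreviation other_eigenvalue :: "real ^ 'n ^ 'n::finite \<Rightarrow> real ^ 'n \<Rightarrow> complex \<Rightarrow> bool" where
  "other_eigenvalue A a x \<equiv> quotient_eigenvalue (complex_matrix A) (complex_vector a) x"

lemma eigenvalue_moduli_eigenvector:
  fixes A :: "real ^ 'n::finite ^ 'n"
  assumes A: "invertible A" and a: "A *v a = l *\<^sub>R a" "a \<noteq> 0"
  obtains N where "eigenvalue_moduli A = rev (sorted_list_of_multiset (add_mset \<bar>l\<bar> N))"
    "size N = CARD('n) - 1" "set_mset N = cmod ` {x. other_eigenvalue A a x}"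
proof -
  have "complex_matrix A *v complex_vector a = complex_of_real l *s complex_vector a"
    by (simp add: complex_matrix_mult_vector a complex_vector_scaleR)
  then obtain N where "proots (char_matrix_poly (complex_matrix A)) = add_mset (complex_of_real l) N"
      "size N = CARD('n) - 1" "set_mset N = {x. other_eigenvalue A a x}"
    using proots_char_matrix_poly_eigenvector[OF invertible_complex_matrix[OF A]] a(2)
    by (metis complex_vector_eq_0_iff)
  then show ?thesis
    by (intro that[of "image_mset cmod N"]) (simp_all add: eigenvalue_moduli_def complex_char_poly_eq)
qed

text \<open>If \<open>l\<close> has higher multiplicity, it occurs again on the quotient; the right
  hand side thus also excludes a repeated top eigenvalue.\<close>

lemma eigenvalue_moduli_top:
  fixes A :: "real ^ 'n::finite ^ 'n"
  assumes A: "invertible A" and a: "A *v a = l *\<^sub>R a" "a \<noteq> 0" and card: "CARD('n) \<ge> 2"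
    and le: "\<And>x. other_eigenvalue A a x \<Longrightarrow> cmod x \<le> \<bar>l\<bar>"
  shows "eigenvalue_moduli A ! 0 > eigenvalue_moduli A ! 1 \<longleftrightarrow>
    (\<forall>x. other_eigenvalue A a x \<longrightarrow> cmod x < \<bar>l\<bar>)"
proof -
  obtain N where N: "eigenvalue_moduli A = rev (sorted_list_of_multiset (add_mset \<bar>l\<bar> N))"
    "size N = CARD('n) - 1" "set_mset N = cmod ` {x. other_eigenvalue A a x}"
    using eigenvalue_moduli_eigenvector[OF A a] .
  have ne: "N \<noteq> {#}" using N(2) card by auto
  have "\<forall>y\<in>#N. y \<le> \<bar>l\<bar>" using N(3) le by auto
  note top = rev_sorted_list_of_multiset_top[OF ne this, folded N(1)]
  have "eigenvalue_moduli A ! 0 > eigenvalue_moduli A ! 1 \<longleftrightarrow> (\<forall>y\<in>#N. y < \<bar>l\<bar>)"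
  proof (rule iffI)
    assume "eigenvalue_moduli A ! 0 > eigenvalue_moduli A ! 1"
    then show "\<forall>y\<in>#N. y < \<bar>l\<bar>" using top(1,3) by fastforce
  next
    assume "\<forall>y\<in>#N. y < \<bar>l\<bar>"
    then show "eigenvalue_moduli A ! 0 > eigenvalue_moduli A ! 1" unfolding top(1) by (rule bspec[OF _ top(2)])
  qed
  then show ?thesis by (simp add: N(3))
qed

lemma eigenvalue_moduli_bottom:
  fixes A :: "real ^ 'n::finite ^ 'n"
  assumes A: "invertible A" and a: "A *v a = l *\<^sub>R a" "a \<noteq> 0" and card: "CARD('n) \<ge> 2"
    and le: "\<And>x. other_eigenvalue A a x \<Longrightarrow> \<bar>l\<bar> \<le> cmod x"
  shows "eigenvalue_moduli A ! (CARD('n) - 2) > eigenvalue_moduli A ! (CARD('n) - 1) \<longleftrightarrow>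
    (\<forall>x. other_eigenvalue A a x \<longrightarrow> \<bar>l\<bar> < cmod x)"
proof -
  obtain N where N: "eigenvalue_moduli A = rev (sorted_list_of_multiset (add_mset \<bar>l\<bar> N))"
    "size N = CARD('n) - 1" "set_mset N = cmod ` {x. other_eigenvalue A a x}"
    using eigenvalue_moduli_eigenvector[OF A a] .
  have ne: "N \<noteq> {#}" using N(2) card by auto
  have *: "\<forall>y\<in>#N. \<bar>l\<bar> \<le> y" using N(3) le by auto
  have 1: "CARD('n) - 1 - 1 = CARD('n) - 2" by simp
  note bot = rev_sorted_list_of_multiset_bottom[OF ne *, folded N(1), unfolded N(2) 1]
  have "eigenvalue_moduli A ! (CARD('n) - 2) > eigenvalue_moduli A ! (CARD('n) - 1) \<longleftrightarrow> (\<forall>y\<in>#N. \<bar>l\<bar> < y)"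
  proof (rule iffI)
    assume "eigenvalue_moduli A ! (CARD('n) - 2) > eigenvalue_moduli A ! (CARD('n) - 1)"
    then show "\<forall>y\<in>#N. \<bar>l\<bar> < y" using bot(3) unfolding bot(1) by fastforce
  next
    assume "\<forall>y\<in>#N. \<bar>l\<bar> < y"
    then show "eigenvalue_moduli A ! (CARD('n) - 2) > eigenvalue_moduli A ! (CARD('n) - 1)"
      unfolding bot(1) by (rule bspec[OF _ bot(2)])
  qed
  then show ?thesis by (simp add: N(3))
qed


section \<open>Powers of a matrix\<close>

primrec mpow :: "'a::comm_semiring_1 ^ 'n ^ 'n::finite \<Rightarrow> nat \<Rightarrow> 'a ^ 'n ^ 'n" where
  "mpow A 0 = mat 1"
| "mpow A (Suc n) = A ** mpow A n"

lemma mpow_0_mult [simp]: "mpow A 0 *v v = v"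
  by simp

lemma mpow_Suc_mult [simp]: "mpow A (Suc n) *v v = A *v (mpow A n *v v)"
  by (simp add: matrix_vector_mul_assoc)

declare mpow.simps [simp del]

lemma mpow_commute:
  assumes "\<And>x. H *v (A *v x) = A *v (H *v x)"
  shows "H *v (mpow A n *v v) = mpow A n *v (H *v v)"
  by (induction n) (simp_all add: assms)

lemma mpow_shift: "mpow A n *v (A *v v) = A *v (mpow A n *v v)"
  by (simp add: mpow_commute)

lemma mpow_eigenvector:
  fixes A :: "'a::field ^ 'n::finite ^ 'n"
  shows "A *v v = c *s v \<Longrightarrow> mpow A n *v v = c ^ n *s v"
  by (induction n) (simp_all add: vector_scalar_commute mult.commute)

lemma mpow_eigenvector_real:
  fixes A :: "real ^ 'n::finite ^ 'n"
  shows "A *v v = c *\<^sub>R v \<Longrightarrow> mpow A n *v v = c ^ n *\<^sub>R v"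
  using mpow_eigenvector[of A v c n] by (simp add: scalar_mult_eq_scaleR)

lemma mpow_complex_matrix:
  "mpow (complex_matrix A) n *v complex_vector v = complex_vector (mpow A n *v v)"
  by (induction n) (simp_all add: complex_matrix_mult_vector)

lemma norm_vector_smult: "norm (c *s v) = cmod c * norm v" for v :: "complex ^ 'n::finite"
  by (simp add: norm_vec_def norm_mult L2_set_right_distrib)

subsection \<open>Applying polynomials of a matrix\<close>

text \<open>The vector p(T) v, computed by Horner's scheme.\<close>

definition poly_apply :: "complex ^ 'n ^ 'n::finite \<Rightarrow> complex poly \<Rightarrow> complex ^ 'n \<Rightarrow> complex ^ 'n" where
  "poly_apply T p v = fold_coeffs (\<lambda>c w. c *s v + T *v w) p 0"

lemma poly_apply_0 [simp]: "poly_apply T 0 v = 0"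
  by (simp add: poly_apply_def)

lemma poly_apply_pCons [simp]: "poly_apply T (pCons c p) v = c *s v + T *v poly_apply T p v"
  by (cases "c = 0 \<and> p = 0") (auto simp: poly_apply_def)

lemma poly_apply_add: "poly_apply T (p + q) v = poly_apply T p v + poly_apply T q v"
  by (induction p q rule: poly_induct2)
    (simp_all add: matrix_vector_right_distrib vector_sadd_rdistrib add_ac)

lemma poly_apply_smult: "poly_apply T (smult c p) v = c *s poly_apply T p v"
  by (induction p) (simp_all add: vector_scalar_commute vector_add_ldistrib vector_smult_assoc)

lemma poly_apply_monom: "poly_apply T (monom c n) v = c *s (mpow T n *v v)"
proof (induction n)
  case (Suc n)
  then show ?case by (simp add: monom_Suc vector_scalar_commute)
qed (simp add: monom_0)

lemma poly_apply_sum: "finite I \<Longrightarrow> poly_apply T (\<Sum>i\<in>I. f i) v = (\<Sum>i\<in>I. poly_apply T (f i) v)"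
  by (induction I rule: finite_induct) (simp_all add: poly_apply_add)

lemma poly_apply_linear_factor:
  "poly_apply T ([:- c, 1:] * q) v = T *v poly_apply T q v - c *s poly_apply T q v"
proof -
  have "[:- c, 1:] * q = smult (- c) q + pCons 0 q" by simp
  then show ?thesis by (simp only: poly_apply_add poly_apply_smult poly_apply_pCons) (simp add: vec_eq_iff)
qed

text \<open>p(T) commutes with T - c. With the preceding lemma, a linear factor of an annihilating
  polynomial can thus be moved onto the vector.\<close>

lemma poly_apply_shift: "poly_apply T p (T *v v - c *s v) = T *v poly_apply T p v - c *s poly_apply T p v"
proof (induction p)
  case (pCons d p)
  then show ?case
    by (simp add: matrix_vector_mult_diff_distrib matrix_vector_right_distrib vector_scalar_commute
        vector_ssub_ldistrib vector_smult_assoc vector_add_ldistrib)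
qed simp

text \<open>There are more iterates of \<open>v\<close> than the real dimension, so they satisfy a
  linear relation, even one with real coefficients.\<close>

lemma exists_annihilating_poly:
  fixes T :: "complex ^ 'n::finite ^ 'n"
  obtains p where "p \<noteq> 0" "poly_apply T p v = 0"
proof -
  define f where "f i = mpow T i *v v" for i
  let ?d = "DIM(complex ^ 'n)"
  show ?thesis
  proof (cases "inj_on f {..?d}")
    \<comment> \<open>\<open>dependent\<close> speaks of the set of iterates and does not see
      repetitions; a repeated iterate gives the difference of two monomials.\<close>
    case False
    then obtain i j where ij: "i \<noteq> j" "f i = f j" by (auto simp: inj_on_def)
    have "poly_apply T (monom 1 i + smult (- 1) (monom 1 j)) v = 0"
      unfolding poly_apply_add poly_apply_smult poly_apply_monom using ij(2) by (simp add: f_def vec_eq_iff)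
    moreover have "coeff (monom 1 i + smult (- 1) (monom (1::complex) j)) i \<noteq> 0" using ij(1) by simp
    ultimately show ?thesis using that by (metis coeff_0)
  next
    case True
    have "dependent (f ` {..?d})"
      by (rule dependent_biggerset) (use card_image[OF True] in simp)
    then obtain u where u: "\<exists>w\<in>f ` {..?d}. u w \<noteq> 0" "(\<Sum>w\<in>f ` {..?d}. u w *\<^sub>R w) = 0"
      by (auto simp: dependent_finite)
    define p where "p = (\<Sum>i\<le>?d. monom (complex_of_real (u (f i))) i)"
    have "poly_apply T p v = (\<Sum>i\<le>?d. u (f i) *\<^sub>R f i)"
      unfolding p_def by (simp add: poly_apply_sum poly_apply_monom f_def[symmetric])
        (simp add: vec_eq_iff scaleR_conv_of_real[where 'a = complex])
    also have "\<dots> = 0" using u(2) unfolding sum.reindex[OF True] by (simp add: o_def)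
    finally have "poly_apply T p v = 0" .
    moreover have "p \<noteq> 0"
    proof -
      obtain i where i: "i \<le> ?d" "u (f i) \<noteq> 0" using u(1) by auto
      have "coeff p i = complex_of_real (u (f i))"
        unfolding p_def using i(1) by (simp add: coeff_sum)
      then show ?thesis using i(2) by auto
    qed
    ultimately show ?thesis using that by blast
  qed
qed

section \<open>Decay of powers\<close>

lemma contraction_recursion_tendsto_0:
  fixes x :: "nat \<Rightarrow> 'a::real_normed_vector" and e :: "nat \<Rightarrow> real"
  assumes r: "0 \<le> r" "r < 1" and e: "e \<longlonglongrightarrow> 0"
    and le: "\<And>n. norm (x (Suc n)) \<le> r * norm (x n) + e n"
  shows "x \<longlonglongrightarrow> 0"
proof (rule tendstoI)
  fix d :: real assume d: "d > 0"
  have "\<forall>\<^sub>F n in sequentially. dist (e n) 0 < d / 2 * (1 - r)"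
    by (rule tendstoD[OF e]) (use d r in simp)
  then obtain N where N: "\<And>n. n \<ge> N \<Longrightarrow> e n < d / 2 * (1 - r)"
    unfolding eventually_sequentially dist_real_def by (metis abs_ge_self diff_zero le_less_trans)
  \<comment> \<open>The number d / 2 is the fixed point of t -> r t + d / 2 (1 - r), which bounds
    every step beyond \<open>N\<close>.\<close>
  have bound: "norm (x (N + k)) \<le> r ^ k * norm (x N) + d / 2" for k
  proof (induction k)
    case (Suc k)
    have "norm (x (N + Suc k)) \<le> r * norm (x (N + k)) + e (N + k)" using le[of "N + k"] by simp
    also have "\<dots> \<le> r * (r ^ k * norm (x N) + d / 2) + d / 2 * (1 - r)"
      using Suc r N[of "N + k"] by (intro add_mono mult_left_mono) auto
    also have "\<dots> = r ^ Suc k * norm (x N) + d / 2" by (simp add: field_simps)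
    finally show ?case .
  qed (use d in simp)
  have "(\<lambda>k. r ^ k * norm (x N)) \<longlonglongrightarrow> 0 * norm (x N)"
    by (intro tendsto_intros LIMSEQ_power_zero) (use r in simp)
  then have "\<forall>\<^sub>F k in sequentially. dist (r ^ k * norm (x N)) 0 < d / 2"
    by (intro tendstoD) (use d in simp_all)
  then have "\<forall>\<^sub>F k in sequentially. norm (x (N + k)) < d"
    by eventually_elim (use bound in \<open>fastforce simp: abs_less_iff intro: le_less_trans\<close>)
  then have "\<forall>\<^sub>F k in sequentially. dist (x (k + N)) 0 < d" by (simp add: add.commute)
  then show "\<forall>\<^sub>F n in sequentially. dist (x n) 0 < d" by (rule eventually_sequentially_seg[THEN iffD1])
qed

text \<open>Induction on the degree of a polynomial p = (X - x) q annihilating \<open>v\<close>. If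
  |x| >= 1, then q(T) v = 0, as it would otherwise be a forbidden eigenvector. If |x| < 1, the
  induction hypothesis applies to (T - x) v, and the powers at \<open>v\<close> obey a contracting
  recursion with this error term.\<close>

lemma mpow_tendsto_0:
  fixes T :: "complex ^ 'n::finite ^ 'n"
  assumes small: "\<And>x v. v \<noteq> 0 \<Longrightarrow> T *v v = x *s v \<Longrightarrow> cmod x < 1"
  shows "(\<lambda>n. mpow T n *v v) \<longlonglongrightarrow> 0"
proof -
  have "(\<lambda>n. mpow T n *v v) \<longlonglongrightarrow> 0" if "p \<noteq> 0" "poly_apply T p v = 0" for p v
    using that
  proof (induction "degree p" arbitrary: p v)
    case 0
    then obtain c where "p = [:c:]" "c \<noteq> 0" by (metis degree_eq_zeroE pCons_0_0)
    then have "v = 0" using 0 by simp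
    then show ?case by simp
  next
    case (Suc d)
    then obtain x where "poly p x = 0" by (metis fundamental_theorem_of_algebra constant_degree nat.distinct(1))
    then obtain q where q: "p = [:- x, 1:] * q" by (auto simp: poly_eq_0_iff_dvd elim: dvdE)
    have q0: "q \<noteq> 0" using Suc.prems(1) q by auto
    have deg: "d = degree q" using Suc.hyps(2) q0 unfolding q by (subst (asm) degree_mult_eq) auto
    have eig: "T *v poly_apply T q v = x *s poly_apply T q v"
      using Suc.prems(2) unfolding q poly_apply_linear_factor by simp
    show ?case
    proof (cases "cmod x < 1")
      case False
      then have "poly_apply T q v = 0" using small eig by blast
      then show ?thesis using Suc.hyps(1)[OF deg q0] by blast
    next
      case True
      have "poly_apply T q (T *v v - x *s v) = 0" unfolding poly_apply_shift using eig by simp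
      then have lim: "(\<lambda>n. mpow T n *v (T *v v - x *s v)) \<longlonglongrightarrow> 0"
        using Suc.hyps(1)[OF deg q0] by blast
      have step: "mpow T (Suc n) *v v = x *s (mpow T n *v v) + mpow T n *v (T *v v - x *s v)" for n
        by (simp add: matrix_vector_mult_diff_distrib vector_scalar_commute mpow_shift)
      show ?thesis
      proof (rule contraction_recursion_tendsto_0[OF norm_ge_zero True tendsto_norm_zero[OF lim]])
        show "norm (mpow T (Suc n) *v v) \<le>
            cmod x * norm (mpow T n *v v) + norm (mpow T n *v (T *v v - x *s v))" for n
          unfolding step by (metis norm_triangle_ineq norm_vector_smult)
      qed
    qed
  qed
  then show ?thesis by (metis exists_annihilating_poly)
qed

text \<open>\<open>v - (v $ k / a $ k) a\<close> is the projection of \<open>v\<close> along \<open>a\<close> onto the hyperplane \<open>{v. v $ k = 0}\<close>.\<close>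
lemma mpow_tendsto_span:
  fixes A :: "real ^ 'n::finite ^ 'n"
  assumes a: "A *v a = l *\<^sub>R a" and k: "a $ k \<noteq> 0" and l: "l > 0"
    and small: "\<And>x. other_eigenvalue A a x \<Longrightarrow> cmod x < l"
  shows "(\<lambda>n. (1 / l ^ n) *\<^sub>R (mpow A n *v v - ((mpow A n *v v) $ k / a $ k) *\<^sub>R a)) \<longlonglongrightarrow> 0"
proof -
  let ?M = "complex_matrix A" and ?a = "complex_vector a"
  define D where "D = deflate ?M l ?a k"
  \<comment> \<open>The nonzero eigenvalues of the deflation are quotient eigenvalues, so after
    division by \<open>l\<close> all eigenvalues have modulus below 1.\<close>
  define T where "T = (\<chi> i j. D $ i $ j / l)"
  define Q where "Q v = v - (v $ k / a $ k) *s ?a" for v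
  have Ma: "?M *v ?a = complex_of_real l *s ?a"
    by (simp add: complex_matrix_mult_vector a complex_vector_scaleR)
  have k': "?a $ k \<noteq> 0" using k by (simp add: complex_vector_def)
  have T: "T *v v = (1 / complex_of_real l) *s (D *v v)" for v
    by (simp add: T_def vec_eq_iff matrix_vector_mult_def sum_divide_distrib)
  have lim: "(\<lambda>n. mpow T n *v v) \<longlonglongrightarrow> 0" for v
  proof (rule mpow_tendsto_0)
    fix x v assume v: "v \<noteq> 0" "T *v v = x *s v"
    have D: "D *v v = (l * x) *s v" using v(2) l unfolding T by (simp add: vec_eq_iff field_simps)
    show "cmod x < 1"
    proof (cases "x = 0")
      case False
      then have "other_eigenvalue A a (l * x)"
        using deflate_eigenvalue_iff[OF Ma k', of "l * x"] v(1) D l unfolding D_def by auto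
      from small[OF this] show ?thesis using l by (simp add: norm_mult)
    qed simp
  qed
  \<comment> \<open>\<open>Q\<close> kills \<open>a\<close>, and D differs from M by multiples of
    \<open>a\<close>, so \<open>Q\<close> cannot tell them apart; since M preserves the line of
    \<open>a\<close>, projecting before applying M changes nothing either.\<close>
  have QD: "Q (D *v v) = Q (?M *v v)" and QM: "Q (?M *v Q v) = Q (?M *v v)" for v
    using k k' unfolding Q_def D_def deflate_mult matrix_vector_mult_diff_distrib vector_scalar_commute Ma
    by (simp_all add: vec_eq_iff complex_vector_def field_simps)
  have Qs: "Q (c *s v) = c *s Q v" for c v by (simp add: Q_def vec_eq_iff algebra_simps)
  have QT: "Q (mpow T n *v v) = (1 / complex_of_real l ^ n) *s Q (mpow ?M n *v v)" for n v
  proof (induction n)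
    case (Suc n)
    have "Q (mpow T (Suc n) *v v) = (1 / complex_of_real l) *s Q (?M *v Q (mpow T n *v v))"
      by (simp add: T Qs QD QM)
    also have "\<dots> = (1 / complex_of_real l ^ Suc n) *s Q (?M *v (mpow ?M n *v v))"
      unfolding Suc vector_scalar_commute Qs QM by (simp add: vector_smult_assoc)
    finally show ?case by simp
  qed simp
  have comp: "(Q (mpow T n *v complex_vector v)) $ i =
      complex_of_real (((1 / l ^ n) *\<^sub>R (mpow A n *v v - ((mpow A n *v v) $ k / a $ k) *\<^sub>R a)) $ i)" for n i
    unfolding QT unfolding mpow_complex_matrix Q_def by (simp add: complex_vector_def diff_divide_distrib)
  have "(\<lambda>n. Q (mpow T n *v complex_vector v) $ i) \<longlonglongrightarrow> 0 $ i - 0 $ k / complex_of_real (a $ k) * ?a $ i" for i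
    unfolding Q_def vector_minus_component vector_smult_component
    by (intro tendsto_diff tendsto_mult tendsto_divide tendsto_const tendsto_vec_nth lim) (use k in simp)
  then have "(\<lambda>n. Q (mpow T n *v complex_vector v) $ i) \<longlonglongrightarrow> complex_of_real 0" for i by simp
  then show ?thesis unfolding comp tendsto_of_real_iff by (intro vec_tendstoI) simp
qed

section \<open>Real and imaginary parts, and recurrence on the circle\<close>

definition Re_vector :: "complex ^ 'n \<Rightarrow> real ^ 'n::finite" where
  "Re_vector v = (\<chi> i. Re (v $ i))"

definition Im_vector :: "complex ^ 'n \<Rightarrow> real ^ 'n::finite" where
  "Im_vector v = (\<chi> i. Im (v $ i))"

lemma norm_Re_vector_le: "norm (Re_vector v) \<le> norm v"
  unfolding norm_vec_def Re_vector_def by (rule L2_set_mono) (auto simp: abs_Re_le_cmod)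

lemma norm_Im_vector_le: "norm (Im_vector v) \<le> norm v"
  unfolding norm_vec_def Im_vector_def by (rule L2_set_mono) (auto simp: abs_Im_le_cmod)

lemma Re_vector_mpow: "Re_vector (mpow (complex_matrix A) n *v v) = mpow A n *v Re_vector v"
proof (induction n)
  case (Suc n)
  have "Re_vector (complex_matrix A *v w) = A *v Re_vector w" for w
    by (simp add: Re_vector_def complex_matrix_def matrix_vector_mult_def vec_eq_iff Re_sum)
  with Suc show ?case by simp
qed simp

lemma Im_vector_mpow: "Im_vector (mpow (complex_matrix A) n *v v) = mpow A n *v Im_vector v"
proof (induction n)
  case (Suc n)
  have "Im_vector (complex_matrix A *v w) = A *v Im_vector w" for w
    by (simp add: Im_vector_def complex_matrix_def matrix_vector_mult_def vec_eq_iff Im_sum)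
  with Suc show ?case by simp
qed simp

lemma norm_le_Re_Im_vector: "norm v \<le> norm (Re_vector v) + norm (Im_vector v)"
proof -
  have "v = complex_vector (Re_vector v) + \<i> *s complex_vector (Im_vector v)"
    by (simp add: vec_eq_iff Re_vector_def Im_vector_def complex_vector_def complex_eq_iff)
  then have "norm v \<le> norm (complex_vector (Re_vector v)) + norm (\<i> *s complex_vector (Im_vector v))"
    by (metis norm_triangle_ineq)
  also have "norm (complex_vector w) = norm w" for w :: "real ^ 'n"
    by (simp add: norm_vec_def complex_vector_def)
  finally show ?thesis by (simp add: norm_vector_smult \<open>\<And>w. norm (complex_vector w) = norm w\<close>)
qed

text \<open>By compactness of the circle two powers at indices at least \<open>N\<close> apart are
  close; dividing by the earlier one, of modulus 1, moves their quotient close to 1.\<close>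

lemma unit_complex_recurrent:
  fixes z :: complex
  assumes z: "cmod z = 1" and e: "e > 0"
  shows "\<exists>n\<ge>N. cmod (z ^ n - 1) < e"
proof -
  have "compact (sphere (0::complex) 1)" by simp
  then have "seq_compact (sphere (0::complex) 1)" by (simp add: compact_eq_seq_compact_metric)
  moreover have "\<forall>n. z ^ n \<in> sphere 0 1" using z by (simp add: norm_power)
  ultimately obtain l s where "strict_mono s" and "((\<lambda>n. z ^ n) \<circ> s) \<longlonglongrightarrow> l"
    by (metis seq_compactE)
  then have s: "strict_mono s" and "Cauchy (\<lambda>n. z ^ s n)"
    by (auto simp: o_def intro: LIMSEQ_imp_Cauchy)
  then obtain K where K: "\<And>m n. m \<ge> K \<Longrightarrow> n \<ge> K \<Longrightarrow> dist (z ^ s m) (z ^ s n) < e"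
    using e unfolding Cauchy_def by metis
  have "s K + N \<le> s (K + N)"
    by (induction N) (use s in \<open>auto simp: strict_mono_Suc_iff Suc_le_eq intro: le_less_trans\<close>)
  then have le: "s K \<le> s (K + N)" and N: "N \<le> s (K + N) - s K" by auto
  have "z ^ s (K + N) - z ^ s K = z ^ s K * (z ^ (s (K + N) - s K) - 1)"
    using le by (simp add: algebra_simps flip: power_add)
  then have "cmod (z ^ (s (K + N) - s K) - 1) = dist (z ^ s (K + N)) (z ^ s K)"
    using z by (simp add: dist_norm norm_mult norm_power)
  also have "\<dots> < e" by (rule K) auto
  finally show ?thesis using N by blast
qed


text \<open>Returns are required at arbitrarily late times: later a return is always combined with a
  power of q / p or p / q that must already be small or large.\<close>

definition recurrent :: "real ^ 'n ^ 'n::finite \<Rightarrow> real \<Rightarrow> (real ^ 'n) \<Rightarrow> bool" where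
  "recurrent A l u \<longleftrightarrow> (\<forall>e>0. \<forall>N. \<exists>n\<ge>N. norm ((1 / l ^ n) *\<^sub>R (mpow A n *v u) - u) < e)"

lemma not_linearly_bounded: "\<exists>n. c * real n > B" if "c > 0"
  using reals_Archimedean3[OF that, rule_format, of B] by (auto simp: mult.commute)

text \<open>Boundedness of the powers of A / l forces modulus \<open>l\<close> and excludes a Jordan
  block over \<open>a\<close>, so there is a complex eigenvector \<open>w\<close> off the line of
  \<open>a\<close>; its real or imaginary part is the wanted \<open>u\<close>. Adding multiples of
  \<open>a\<close> keeps recurrence, since A / l fixes \<open>a\<close>.\<close>

lemma power_bounded_eigenvalue:
  fixes A :: "real ^ 'n::finite ^ 'n"
  assumes a: "A *v a = l *\<^sub>R a" "a \<noteq> 0" and l: "l > 0" and B: "B \<ge> 0"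
    and bdd: "\<And>n v. norm (mpow A n *v v) \<le> B * l ^ n * norm v"
    and x: "other_eigenvalue A a x" "cmod x \<ge> l"
  shows "cmod x = l" "\<exists>u. (\<forall>t. u \<noteq> t *\<^sub>R a) \<and> (\<forall>s t. recurrent A l (s *\<^sub>R a + t *\<^sub>R u))"
proof -
  let ?M = "complex_matrix A" and ?a = "complex_vector a"
  have Ma: "?M *v ?a = complex_of_real l *s ?a"
    by (simp add: complex_matrix_mult_vector a complex_vector_scaleR)
  have bddM: "norm (mpow ?M n *v v) \<le> (2 * B * norm v) * l ^ n" for n v
  proof -
    have "B * l ^ n \<ge> 0" using B l by simp
    then have "norm (mpow A n *v Re_vector v) \<le> B * l ^ n * norm v"
      "norm (mpow A n *v Im_vector v) \<le> B * l ^ n * norm v"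
      by (meson bdd mult_left_mono norm_Re_vector_le norm_Im_vector_le order_trans)+
    with norm_le_Re_Im_vector[of "mpow ?M n *v v"] show ?thesis
      unfolding Re_vector_mpow Im_vector_mpow by (simp add: algebra_simps)
  qed
  obtain v c where v: "\<And>t. v \<noteq> t *s ?a" and Mv: "?M *v v = x *s v + c *s ?a"
    using x(1) unfolding quotient_eigenvalue_def by blast
  have "\<exists>w. (\<forall>t. w \<noteq> t *s ?a) \<and> ?M *v w = x *s w"
  proof (cases "x = l")
    case True
    \<comment> \<open>A nonzero \<open>c\<close> would be a Jordan block, and by this formula the
      powers would grow like n l^n.\<close>
    have Mn: "mpow ?M n *v v = complex_of_real l ^ n *s v + (real n * complex_of_real l ^ (n - 1) * c) *s ?a" for n
    proof (induction n)
      case (Suc n)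
      show ?case
        by (simp add: Suc matrix_vector_right_distrib vector_scalar_commute Mv Ma True)
          (cases n; simp add: vec_eq_iff algebra_simps)
    qed simp
    have "c = 0"
    proof (rule ccontr)
      assume c: "c \<noteq> 0"
      define K where "K = cmod c * norm ?a / l"
      have K: "K > 0" using c a(2) l by (simp add: K_def)
      obtain n where n: "K * real n > 2 * B * norm v + norm v" using not_linearly_bounded[OF K] by blast
      have Bv: "2 * B * norm v \<ge> norm v" using bddM[of 0 v] by simp
      have n0: "n > 0" using n Bv norm_ge_zero[of v] by (cases n) (auto simp del: norm_ge_zero)
      have "K * real n * l ^ n = norm ((real n * complex_of_real l ^ (n - 1) * c) *s ?a)"
        using l n0 unfolding norm_vector_smult norm_mult norm_power norm_of_nat norm_of_real
        by (cases n) (simp_all add: K_def)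
      also have "(real n * complex_of_real l ^ (n - 1) * c) *s ?a = mpow ?M n *v v - complex_of_real l ^ n *s v"
        by (simp add: Mn)
      also have "norm \<dots> \<le> (2 * B * norm v) * l ^ n + l ^ n * norm v"
        by (rule order_trans[OF norm_triangle_ineq4])
          (use bddM[of n v] l in \<open>simp add: norm_vector_smult norm_power\<close>)
      finally have "(K * real n) * l ^ n \<le> (2 * B * norm v + norm v) * l ^ n" by (simp add: algebra_simps)
      then show False using n l by simp
    qed
    then show ?thesis using v Mv by auto
  next
    case False
    define t where "t = c / (x - l)"
    have "?M *v (v + t *s ?a) = x *s (v + t *s ?a)"
      using False unfolding matrix_vector_right_distrib vector_scalar_commute Mv Ma
      by (simp add: vec_eq_iff t_def field_simps)
    moreover have "v + t *s ?a \<noteq> r *s ?a" for r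
      using v[of "r - t"] by (auto simp: vec_eq_iff algebra_simps)
    ultimately show ?thesis by blast
  qed
  then obtain w where w: "\<And>t. w \<noteq> t *s ?a" and Mw: "?M *v w = x *s w" by blast
  have w0: "w \<noteq> 0" using w[of 0] by simp
  define z where "z = x / l"
  have z1: "cmod z \<ge> 1" using x(2) l by (simp add: z_def norm_divide)
  have zn: "(1 / complex_of_real l ^ n) *s (mpow ?M n *v w) = z ^ n *s w" for n
    by (simp add: mpow_eigenvector[OF Mw] vector_smult_assoc z_def power_divide)
  have "cmod z ^ n \<le> 2 * B" for n
  proof -
    have "l ^ n * (cmod z ^ n * norm w) = norm (mpow ?M n *v w)"
      using arg_cong[OF zn[of n], of norm] l by (simp add: norm_vector_smult norm_divide norm_power field_simps)
    also have "\<dots> \<le> l ^ n * (2 * B * norm w)" using bddM[of n w] by (simp add: mult.commute)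
    finally show ?thesis using l w0 by simp
  qed
  then have "\<not> cmod z > 1" using real_arch_pow[of "cmod z" "2 * B"] by (metis not_le)
  then have z: "cmod z = 1" using z1 by simp
  then show "cmod x = l" using l by (simp add: z_def norm_divide)
  \<comment> \<open>On the span of \<open>a\<close> and \<open>w\<close> the powers of M / l
    multiply the \<open>w\<close> part by z^n and fix the \<open>a\<close> part, so returns of z^n
    to 1 are returns of the vector.\<close>
  have close: "\<exists>n\<ge>N. norm ((1 / complex_of_real l ^ n) *s (mpow ?M n *v y) - y) < e"
    if e: "e > 0" and y: "y = s *s ?a + t *s w" for e N s t y
  proof -
    have "e / (cmod t * norm w + 1) > 0" using e by (simp add: add_nonneg_pos)
    from unit_complex_recurrent[OF z this, of N] obtain n where n: "n \<ge> N"
      "cmod (z ^ n - 1) < e / (cmod t * norm w + 1)" by blast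
    have "(1 / complex_of_real l ^ n) *s (mpow ?M n *v y) - y = (t * (z ^ n - 1)) *s w"
      using zn[of n] mpow_eigenvector[OF Ma, of n] l
      by (simp add: y matrix_vector_right_distrib vector_scalar_commute)
        (simp add: vec_eq_iff field_simps)
    then have "norm ((1 / complex_of_real l ^ n) *s (mpow ?M n *v y) - y) = cmod (z ^ n - 1) * (cmod t * norm w)"
      by (simp add: norm_vector_smult norm_mult)
    also have "\<dots> \<le> cmod (z ^ n - 1) * (cmod t * norm w + 1)" by (intro mult_left_mono) auto
    also have "\<dots> < e" using n(2) by (simp add: pos_less_divide_eq add_nonneg_pos)
    finally show ?thesis using n(1) by blast
  qed
  have Re: "Re_vector ((1 / complex_of_real l ^ n) *s (mpow ?M n *v y) - y) =
      (1 / l ^ n) *\<^sub>R (mpow A n *v Re_vector y) - Re_vector y" for n y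
    by (simp add: Re_vector_mpow[symmetric]) (simp add: Re_vector_def vec_eq_iff flip: of_real_power)
  have rec: "recurrent A l (Re_vector y)" if "y = s *s ?a + t *s w" for y s t
    unfolding recurrent_def Re[symmetric] using close[OF _ that] norm_Re_vector_le le_less_trans by blast
  have "recurrent A l (s *\<^sub>R a + t *\<^sub>R Re_vector w)" "recurrent A l (s *\<^sub>R a + t *\<^sub>R Im_vector w)" for s t
  proof -
    \<comment> \<open>The coefficient -\<i> turns the imaginary part of \<open>w\<close> into a real
      part.\<close>
    have "s *\<^sub>R a + t *\<^sub>R Re_vector w = Re_vector (of_real s *s ?a + of_real t *s w)"
      "s *\<^sub>R a + t *\<^sub>R Im_vector w = Re_vector (of_real s *s ?a + (- \<i> * of_real t) *s w)"
      by (simp_all add: vec_eq_iff Re_vector_def Im_vector_def complex_vector_def)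
    then show "recurrent A l (s *\<^sub>R a + t *\<^sub>R Re_vector w)" "recurrent A l (s *\<^sub>R a + t *\<^sub>R Im_vector w)"
      using rec by metis+
  qed
  moreover have "(\<forall>t. Re_vector w \<noteq> t *\<^sub>R a) \<or> (\<forall>t. Im_vector w \<noteq> t *\<^sub>R a)"
  proof (rule ccontr)
    assume "\<not> ?thesis"
    then obtain s t where st: "Re_vector w = s *\<^sub>R a" "Im_vector w = t *\<^sub>R a" by blast
    have "w = Complex s t *s ?a"
      using arg_cong[OF st(1), of "\<lambda>v. v $ _"] arg_cong[OF st(2), of "\<lambda>v. v $ _"]
      by (simp add: vec_eq_iff Re_vector_def Im_vector_def complex_vector_def complex_eq_iff)
    then show False using w by blast
  qed
  ultimately show "\<exists>u. (\<forall>t. u \<noteq> t *\<^sub>R a) \<and> (\<forall>s t. recurrent A l (s *\<^sub>R a + t *\<^sub>R u))" by blast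
qed


section \<open>Open convex cones and their automorphisms\<close>

lemma norm_matrix_le:
  fixes X :: "real ^ 'n::finite ^ 'm::finite"
  assumes "\<And>v. norm (X *v v) \<le> c * norm v"
  shows "norm X \<le> real (CARD('m) * CARD('n)) * c"
proof -
  have entry: "\<bar>X $ i $ j\<bar> \<le> c" for i j
  proof -
    have "X $ i $ j = (X *v axis j 1) $ i"
      by (simp add: matrix_vector_mul_component inner_axis)
    then have "\<bar>X $ i $ j\<bar> \<le> norm (X *v axis j 1)" by (metis component_le_norm_cart)
    also have "\<dots> \<le> c" using assms[of "axis j 1"] by simp
    finally show ?thesis .
  qed
  have "norm X \<le> (\<Sum>i\<in>UNIV. norm (X $ i))" unfolding norm_vec_def by (rule L2_set_le_sum) simp
  also have "\<dots> \<le> (\<Sum>i\<in>(UNIV::'m set). \<Sum>j\<in>(UNIV::'n set). \<bar>X $ i $ j\<bar>)"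
    by (intro sum_mono norm_le_l1_cart)
  also have "\<dots> \<le> (\<Sum>i\<in>(UNIV::'m set). \<Sum>j\<in>(UNIV::'n set). c)"
    by (intro sum_mono entry)
  finally show ?thesis by (simp add: mult.assoc)
qed

lemma tendsto_matrix_vector_mult:
  fixes X :: "'b \<Rightarrow> real ^ 'n::finite ^ 'm::finite"
  assumes "(X \<longlongrightarrow> L) F"
  shows "((\<lambda>k. X k *v v) \<longlongrightarrow> L *v v) F"
  unfolding matrix_vector_mult_def
  by (intro tendsto_vec_lambda tendsto_sum tendsto_mult tendsto_vec_nth assms tendsto_const)

lemma tendsto_matrix_matrix_mult:
  fixes X :: "'b \<Rightarrow> real ^ 'n::finite ^ 'm::finite" and Y :: "'b \<Rightarrow> real ^ 'k::finite ^ 'n"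
  assumes "(X \<longlongrightarrow> L) F" "(Y \<longlongrightarrow> M) F"
  shows "((\<lambda>k. X k ** Y k) \<longlongrightarrow> L ** M) F"
  unfolding matrix_matrix_mult_def
  by (intro tendsto_vec_lambda tendsto_sum tendsto_mult tendsto_vec_nth assms)

lemma matrix_scaleR_mult_vector: "(c *\<^sub>R X) *v v = c *\<^sub>R (X *v v)"
  for X :: "real ^ 'n::finite ^ 'm::finite"
  by (simp add: matrix_vector_mult_def vec_eq_iff sum_distrib_left mult.assoc)

text \<open>The last assumption bounds the slice w \<bullet> v = 1. It is proper convexity in linear
  form: it makes the closed cone pointed and turns order estimates into norm estimates.\<close>

locale bounded_cone =
  fixes C :: "(real ^ 'n::finite) set" and w :: "real ^ 'n" and R :: real
  assumes R_pos: "R > 0" and open_cone: "open C" and convex_cone: "convex C" and cone_nonempty: "C \<noteq> {}"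
    and cone_scale: "v \<in> C \<Longrightarrow> c > 0 \<Longrightarrow> c *\<^sub>R v \<in> C"
    and cone_bounded: "v \<in> C \<Longrightarrow> norm v \<le> R * (w \<bullet> v)"
begin

abbreviation K where "K \<equiv> closure C"

lemma cone_subset: "v \<in> C \<Longrightarrow> v \<in> K"
  using closure_subset by blast

lemma K_bounded: "v \<in> K \<Longrightarrow> norm v \<le> R * (w \<bullet> v)"
proof -
  have "closed {v. norm v \<le> R * (w \<bullet> v)}" by (intro closed_Collect_le continuous_intros)
  then have "K \<subseteq> {v. norm v \<le> R * (w \<bullet> v)}"
    by (rule closure_minimal[rotated]) (use cone_bounded in auto)
  then show "v \<in> K \<Longrightarrow> norm v \<le> R * (w \<bullet> v)" by blast
qed

lemma K_scale_pos: "v \<in> K \<Longrightarrow> c > 0 \<Longrightarrow> c *\<^sub>R v \<in> K"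
proof -
  assume v: "v \<in> K" and c: "c > 0"
  have "(\<lambda>v. c *\<^sub>R v) ` K = closure ((\<lambda>v. c *\<^sub>R v) ` C)" by (rule closure_scaleR)
  also have "\<dots> \<subseteq> K" by (rule closure_mono) (use c cone_scale in auto)
  finally show ?thesis using v by blast
qed

lemma cone_add_K: "v \<in> C \<Longrightarrow> x \<in> K \<Longrightarrow> v + x \<in> C"
proof -
  assume v: "v \<in> C" and x: "x \<in> K"
  have "(1/2) *\<^sub>R v + (1/2) *\<^sub>R x \<in> C"
  proof (cases "v = x")
    case True then show ?thesis using v by (simp flip: scaleR_add_left)
  next
    case False
    have "open_segment v x \<subseteq> interior C"
      by (rule in_interior_closure_convex_segment) (use v x convex_cone open_cone in \<open>auto simp: interior_open\<close>)
    moreover have "(1/2) *\<^sub>R v + (1/2) *\<^sub>R x \<in> open_segment v x"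
      using False by (auto simp: in_segment intro!: exI[of _ "1/2"])
    ultimately show ?thesis using open_cone by (auto simp: interior_open)
  qed
  from cone_scale[OF this, of 2] show ?thesis by (simp add: scaleR_add_right)
qed

lemma K_add: "v \<in> K \<Longrightarrow> x \<in> K \<Longrightarrow> v + x \<in> K"
proof -
  assume v: "v \<in> K" and x: "x \<in> K"
  have "convex K" by (rule convex_closure[OF convex_cone])
  then have "(1/2) *\<^sub>R v + (1/2) *\<^sub>R x \<in> K" using v x by (auto simp: convex_def)
  from K_scale_pos[OF this, of 2] show ?thesis by (simp add: scaleR_add_right)
qed

lemma zero_in_K: "0 \<in> K"
proof -
  obtain v where v: "v \<in> C" using cone_nonempty by blast
  have "(\<lambda>n. (1 / real (Suc n)) *\<^sub>R v) \<longlonglongrightarrow> 0 *\<^sub>R v"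
    by (intro tendsto_scaleR tendsto_const lim_1_over_n[THEN LIMSEQ_Suc])
  moreover have "\<forall>n. (1 / real (Suc n)) *\<^sub>R v \<in> C" using v cone_scale by simp
  ultimately show ?thesis unfolding closure_sequential scaleR_zero_left by (intro exI conjI)
qed

lemma K_scale: "v \<in> K \<Longrightarrow> c \<ge> 0 \<Longrightarrow> c *\<^sub>R v \<in> K"
  using K_scale_pos zero_in_K by (cases "c = 0") auto

lemma K_inner_pos:
  assumes "v \<in> K" "v \<noteq> 0"
  shows "w \<bullet> v > 0"
proof -
  have "0 < norm v" using assms(2) by simp
  also have "\<dots> \<le> R * (w \<bullet> v)" by (rule K_bounded[OF assms(1)])
  finally show ?thesis using R_pos by (simp add: zero_less_mult_iff)
qed

lemma K_pointed:
  assumes "v \<in> K" "- v \<in> K"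
  shows "v = 0"
proof (rule ccontr)
  assume "v \<noteq> 0"
  then have "w \<bullet> v > 0" "w \<bullet> (- v) > 0"
    using K_inner_pos[OF assms(1)] K_inner_pos[OF assms(2)] by auto
  then show False by simp
qed

lemma exists_nonzero: "\<exists>v \<in> C. v \<noteq> 0"
proof (rule ccontr)
  assume "\<not> ?thesis"
  then have "C = {0}" using cone_nonempty by auto
  with open_cone have "open {0 :: real ^ 'n}" by simp
  then show False using not_open_singleton by blast
qed

lemma zero_notin_cone: "0 \<notin> C"
proof
  assume 0: "0 \<in> C"
  obtain v where v: "v \<in> C" "v \<noteq> 0" using exists_nonzero by blast
  obtain e where e: "e > 0" "ball 0 e \<subseteq> C" using open_cone 0 open_contains_ball by blast
  have "- ((e / (2 * norm v)) *\<^sub>R v) \<in> C" using e v by (intro subsetD[OF e(2)]) (simp add: dist_norm)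
  from cone_scale[OF this, of "2 * norm v / e"] have "- v \<in> C" using e v by simp
  then show False using K_pointed cone_subset v by blast
qed

text \<open>\<open>t\<close> is the reciprocal of the radius of a ball around \<open>u\<close>
  inside C. Applied to \<open>v\<close> and to \<open>- v\<close>, it traps \<open>v\<close> between
  multiples of \<open>u\<close>.\<close>

lemma order_unit:
  assumes "u \<in> C"
  obtains t where "t > 0" "\<And>v. (t * norm v) *\<^sub>R u + v \<in> K"
proof -
  obtain e where e: "e > 0" "cball u e \<subseteq> C" using open_cone assms open_contains_cball by blast
  have "(1 / e * norm v) *\<^sub>R u + v \<in> K" for v
  proof (cases "v = 0")
    case False
    have "u + (e / norm v) *\<^sub>R v \<in> C" using e False by (intro subsetD[OF e(2)]) (simp add: dist_norm)
    from cone_scale[OF this, of "1 / e * norm v"] have "(1 / e * norm v) *\<^sub>R u + v \<in> C"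
      using e False by (simp add: scaleR_add_right)
    then show ?thesis by (rule cone_subset)
  qed (simp add: zero_in_K)
  then show ?thesis using that[of "1 / e"] e by simp
qed

text \<open>Normality of the cone: 2 x is the difference of two vectors of K whose norms are
  controlled by \<open>w\<close>.\<close>

lemma norm_le_of_order_interval: "p + x \<in> K \<Longrightarrow> p - x \<in> K \<Longrightarrow> norm x \<le> R * (w \<bullet> p)"
proof -
  assume *: "p + x \<in> K" "p - x \<in> K"
  have "2 *\<^sub>R x = (p + x) - (p - x)" by (simp add: scaleR_2)
  then have "2 * norm x \<le> norm (p + x) + norm (p - x)"
    by (metis norm_scaleR norm_triangle_ineq4 abs_numeral)
  also have "\<dots> \<le> R * (w \<bullet> (p + x)) + R * (w \<bullet> (p - x))" using * K_bounded by (intro add_mono) auto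
  also have "\<dots> = 2 * (R * (w \<bullet> p))" by (simp add: inner_add_right inner_diff_right algebra_simps)
  finally show ?thesis by simp
qed

lemma matrix_maps_K:
  assumes "\<And>v. v \<in> C \<Longrightarrow> X *v v \<in> K" and "v \<in> K"
  shows "X *v v \<in> K"
proof -
  have "(*v) X ` K \<subseteq> closure ((*v) X ` C)"
    by (rule closure_linear_image_subset) simp
  also have "\<dots> \<subseteq> K" using assms(1) by (intro closure_minimal) auto
  finally show ?thesis using assms(2) by blast
qed

text \<open>A map preserving the order is controlled by its value at an order unit. The constant
  depends on \<open>u\<close> alone, so whole families of matrices are bounded by bounding them at
  \<open>u\<close>.\<close>

lemma matrix_bound:
  assumes "u \<in> C"
  obtains M where "M \<ge> 0" "\<And>X c v. (\<And>v. v \<in> C \<Longrightarrow> X *v v \<in> K) \<Longrightarrow> c *\<^sub>R u - X *v u \<in> K \<Longrightarrow>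
    norm (X *v v) \<le> M * c * norm v"
proof -
  obtain t where t: "t > 0" "\<And>v. (t * norm v) *\<^sub>R u + v \<in> K" using order_unit[OF assms] by blast
  have u: "u \<in> K" "u \<noteq> 0" using assms cone_subset zero_notin_cone by auto
  show ?thesis
  proof (rule that[of "t * (R * (w \<bullet> u))"])
    show "t * (R * (w \<bullet> u)) \<ge> 0" using t R_pos K_inner_pos[OF u] by simp
    fix X c v assume X: "\<And>v. v \<in> C \<Longrightarrow> X *v v \<in> K" and c: "c *\<^sub>R u - X *v u \<in> K"
    have "(t * norm v) *\<^sub>R u - v \<in> K" using t(2)[of "- v"] by simp
    then have "norm (X *v v) \<le> R * (w \<bullet> ((t * norm v) *\<^sub>R (X *v u)))"
      using matrix_maps_K[OF X, of "(t * norm v) *\<^sub>R u + v"] matrix_maps_K[OF X, of "(t * norm v) *\<^sub>R u - v"] t(2)[of v]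
      by (intro norm_le_of_order_interval)
        (simp_all add: matrix_vector_right_distrib matrix_vector_mult_diff_distrib
          matrix_vector_mult_scaleR)
    also have "\<dots> = t * norm v * (R * (w \<bullet> (X *v u)))" by simp
    also have "\<dots> \<le> t * norm v * (R * (w \<bullet> (c *\<^sub>R u)))"
    proof (rule mult_left_mono)
      have "0 \<le> R * (w \<bullet> (c *\<^sub>R u - X *v u))" using K_bounded[OF c] norm_ge_zero order_trans by blast
      then show "R * (w \<bullet> (X *v u)) \<le> R * (w \<bullet> (c *\<^sub>R u))" by (simp add: inner_diff_right right_diff_distrib)
    qed (use t in simp)
    finally show "norm (X *v v) \<le> t * (R * (w \<bullet> u)) * c * norm v" by (simp add: mult_ac)
  qed
qed

end


section \<open>Linear automorphisms of the cone with an axis through its interior\<close>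

lemma matrix_inv:
  assumes "invertible A"
  shows matrix_inv_right: "A ** matrix_inv A = mat 1" and matrix_inv_left: "matrix_inv A ** A = mat 1"
  using someI_ex[OF assms[unfolded invertible_def]] unfolding matrix_inv_def by auto

lemma closure_dense_sequence:
  fixes S :: "'a::real_normed_vector set"
  assumes "\<And>e. e > 0 \<Longrightarrow> \<exists>y\<in>closure S. norm (y - x) < e"
  shows "x \<in> closure S"
  using assms closure_approachable[of x "closure S"] by (auto simp: dist_norm)

text \<open>Only q < p is assumed. That \<open>p\<close> is the largest and \<open>q\<close> the
  smallest modulus of an eigenvalue follows from a + b being interior.\<close>

locale hyperbolic_cone_map = bounded_cone C w R for C :: "(real ^ 'n::finite) set" and w R +
  fixes A :: "real ^ 'n ^ 'n" and a b :: "real ^ 'n" and p q :: real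
  assumes invertible_A: "invertible A" and A_cone: "(*v) A ` C = C"
    and A_a: "A *v a = p *\<^sub>R a" and A_b: "A *v b = q *\<^sub>R b" and q_pos: "0 < q" and q_less_p: "q < p"
    and a_in_K: "a \<in> K" and b_in_K: "b \<in> K" and a_nonzero: "a \<noteq> 0" and b_nonzero: "b \<noteq> 0"
    and a_plus_b: "a + b \<in> C"
begin

lemma p_pos: "p > 0"
  using q_pos q_less_p by linarith

lemma A_in_cone: "v \<in> C \<Longrightarrow> A *v v \<in> C"
  using A_cone by blast

lemma A_in_K: "v \<in> K \<Longrightarrow> A *v v \<in> K"
  using matrix_maps_K A_in_cone cone_subset by blast

lemma A_in_cone_iff: "A *v v \<in> C \<longleftrightarrow> v \<in> C"
proof
  assume "A *v v \<in> C"
  then obtain u where u: "u \<in> C" "A *v v = A *v u" using A_cone by (metis imageE)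
  then have "v = u" using invertible_A by (metis inj_matrix_vector_mult injD)
  then show "v \<in> C" using u by simp
qed (rule A_in_cone)

lemma mpow_in_K: "v \<in> K \<Longrightarrow> mpow A n *v v \<in> K"
  by (induction n) (simp_all add: A_in_K)

lemma mpow_in_cone_iff: "mpow A n *v v \<in> C \<longleftrightarrow> v \<in> C"
  by (induction n) (simp_all add: A_in_cone_iff)

lemma cone_scale_iff: "c > 0 \<Longrightarrow> c *\<^sub>R v \<in> C \<longleftrightarrow> v \<in> C"
  using cone_scale[of v c] cone_scale[of "c *\<^sub>R v" "inverse c"] by auto

lemma power_bound:
  obtains B where "B \<ge> 0" "\<And>n v. norm (mpow A n *v v) \<le> B * p ^ n * norm v"
proof -
  obtain M where M: "M \<ge> 0" "\<And>X c v. (\<And>v. v \<in> C \<Longrightarrow> X *v v \<in> K) \<Longrightarrow>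
      c *\<^sub>R (a + b) - X *v (a + b) \<in> K \<Longrightarrow> norm (X *v v) \<le> M * c * norm v"
    using matrix_bound[OF a_plus_b] by blast
  have "norm (mpow A n *v v) \<le> M * p ^ n * norm v" for n v
  proof (rule M(2))
    show "mpow A n *v x \<in> K" if "x \<in> C" for x using that mpow_in_K cone_subset by blast
    have "p ^ n *\<^sub>R (a + b) - mpow A n *v (a + b) = (p ^ n - q ^ n) *\<^sub>R b"
      by (simp add: matrix_vector_right_distrib mpow_eigenvector_real[OF A_a]
          mpow_eigenvector_real[OF A_b] algebra_simps)
    moreover have "p ^ n - q ^ n \<ge> 0" using power_mono[of q p n] q_pos q_less_p by simp
    ultimately show "p ^ n *\<^sub>R (a + b) - mpow A n *v (a + b) \<in> K" using K_scale b_in_K by simp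
  qed
  then show ?thesis using that M(1) by blast
qed

lemma other_eigenvalue_le: "other_eigenvalue A a x \<Longrightarrow> cmod x \<le> p"
  by (rule power_bound) (metis power_bounded_eigenvalue(1)[OF A_a a_nonzero p_pos] order_refl le_cases)

text \<open>At a late return time the rescaled power has nearly erased the \<open>b\<close>
  component, and what is left is close to \<open>x\<close>.\<close>

lemma recurrent_in_K:
  assumes rec: "recurrent A p x" and xb: "x + c *\<^sub>R b \<in> K"
  shows "x \<in> K"
proof (rule closure_dense_sequence)
  fix e :: real assume e: "e > 0"
  have "(\<lambda>n. (q / p) ^ n *\<^sub>R (c *\<^sub>R b)) \<longlonglongrightarrow> 0 *\<^sub>R (c *\<^sub>R b)"
    by (intro tendsto_scaleR tendsto_const LIMSEQ_power_zero) (use q_pos q_less_p in simp)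
  then have "\<forall>\<^sub>F n in sequentially. norm ((q / p) ^ n *\<^sub>R (c *\<^sub>R b)) < e / 2"
    using e by (auto dest!: tendstoD[of _ _ _ "e / 2"] simp: dist_norm)
  then obtain N where N: "\<And>n. n \<ge> N \<Longrightarrow> norm ((q / p) ^ n *\<^sub>R (c *\<^sub>R b)) < e / 2"
    by (auto simp: eventually_sequentially)
  obtain n where n: "n \<ge> N" "norm ((1 / p ^ n) *\<^sub>R (mpow A n *v x) - x) < e / 2"
    using rec e unfolding recurrent_def by (metis half_gt_zero)
  let ?y = "(1 / p ^ n) *\<^sub>R (mpow A n *v (x + c *\<^sub>R b))"
  have "?y \<in> K" using K_scale[OF mpow_in_K[OF xb], of "1 / p ^ n" n] p_pos by simp
  moreover have "?y - x = ((1 / p ^ n) *\<^sub>R (mpow A n *v x) - x) + (q / p) ^ n *\<^sub>R (c *\<^sub>R b)"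
    by (simp add: matrix_vector_right_distrib matrix_vector_mult_scaleR mpow_eigenvector_real[OF A_b]
        scaleR_add_right power_divide)
  then have "norm (?y - x) < e / 2 + e / 2"
    using n N[OF n(1)] by (metis norm_triangle_lt add_strict_mono)
  ultimately show "\<exists>y\<in>K. norm (y - x) < e" by auto
qed

text \<open>If \<open>x\<close> were interior, a fixed s b could be subtracted from its returns.
  Pulled back by A^n, this subtracts s (p/q)^n b from \<open>x\<close> without leaving C, for
  arbitrarily large n, which the positivity of \<open>w\<close> on C forbids.\<close>

lemma recurrent_notin_cone:
  assumes rec: "recurrent A p x"
  shows "x \<notin> C"
proof
  assume "x \<in> C"
  then obtain d where d: "d > 0" "ball x d \<subseteq> C" using open_cone open_contains_ball by blast
  define s where "s = d / (2 * norm b)"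
  have s: "s > 0" "s * norm b = d / 2" using d b_nonzero by (simp_all add: s_def)
  have wb: "w \<bullet> b > 0" by (rule K_inner_pos[OF b_in_K b_nonzero])
  have "1 < p / q" using q_pos q_less_p by simp
  then obtain N where N: "(w \<bullet> x) / (s * (w \<bullet> b)) < (p / q) ^ N" using real_arch_pow by blast
  obtain n where n: "n \<ge> N" "norm ((1 / p ^ n) *\<^sub>R (mpow A n *v x) - x) < d / 2"
    using rec d unfolding recurrent_def by (metis half_gt_zero)
  have "(1 / p ^ n) *\<^sub>R (mpow A n *v x) - s *\<^sub>R b \<in> C"
  proof (rule subsetD[OF d(2)])
    have "norm (((1 / p ^ n) *\<^sub>R (mpow A n *v x) - x) - s *\<^sub>R b) < d / 2 + d / 2"
      by (rule le_less_trans[OF norm_triangle_ineq4 add_less_le_mono]) (use n s in simp_all)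
    then show "(1 / p ^ n) *\<^sub>R (mpow A n *v x) - s *\<^sub>R b \<in> ball x d"
      unfolding mem_ball dist_norm by (subst norm_minus_commute) (simp add: algebra_simps)
  qed
  moreover have "(1 / p ^ n) *\<^sub>R (mpow A n *v x) - s *\<^sub>R b =
      (1 / p ^ n) *\<^sub>R (mpow A n *v (x - (s * (p / q) ^ n) *\<^sub>R b))"
    using p_pos q_pos by (simp add: matrix_vector_mult_diff_distrib matrix_vector_mult_scaleR
        mpow_eigenvector_real[OF A_b] scaleR_diff_right power_divide)
  ultimately have "x - (s * (p / q) ^ n) *\<^sub>R b \<in> C"
    using p_pos by (simp add: cone_scale_iff mpow_in_cone_iff del: scaleR_scaleR)
  then have "0 \<le> w \<bullet> (x - (s * (p / q) ^ n) *\<^sub>R b)"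
    using cone_subset zero_notin_cone K_inner_pos by (metis less_imp_le)
  then have "(p / q) ^ n \<le> (w \<bullet> x) / (s * (w \<bullet> b))"
    using s wb by (simp add: inner_diff_right field_simps)
  moreover have "(p / q) ^ N \<le> (p / q) ^ n" using \<open>1 < p / q\<close> n(1) by (intro power_increasing) auto
  ultimately show False using N by linarith
qed

text \<open>\<open>z + a \<notin> C\<close> is the linear form of the side from a to z lying in the
  boundary. It holds because z + a is again recurrent; \<open>z + b \<notin> C\<close> comes from
  the maximality of \<open>s0\<close>.\<close>

lemma nonproximal_half_triangle:
  assumes x: "other_eigenvalue A a x" "cmod x \<ge> p"
  obtains z where "z \<in> K" "z \<noteq> 0" "z + a \<notin> C" "z + b \<notin> C"
proof -
  obtain B where B: "B \<ge> 0" "\<And>n v. norm (mpow A n *v v) \<le> B * p ^ n * norm v"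
    using power_bound by blast
  obtain u0 where u0: "\<And>t. u0 \<noteq> t *\<^sub>R a" "\<And>s t. recurrent A p (s *\<^sub>R a + t *\<^sub>R u0)"
    using power_bounded_eigenvalue(2)[OF A_a a_nonzero p_pos B x] by blast
  \<comment> \<open>The ray from \<open>a\<close> must leave K in one of the two directions:
    otherwise dividing by s in the limit puts both \<open>u0\<close> and \<open>- u0\<close> into
    K.\<close>
  have "\<not> ((\<forall>s>0. a + s *\<^sub>R u0 \<in> K) \<and> (\<forall>s>0. a + s *\<^sub>R (- u0) \<in> K))"
  proof
    assume all: "(\<forall>s>0. a + s *\<^sub>R u0 \<in> K) \<and> (\<forall>s>0. a + s *\<^sub>R (- u0) \<in> K)"
    have lim: "v \<in> K" if v: "\<forall>s>0. a + s *\<^sub>R v \<in> K" for v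
    proof (rule Lim_in_closed_set[OF closed_closure])
      show "(\<lambda>n. (1 / real (Suc n)) *\<^sub>R a + v) \<longlonglongrightarrow> v"
        by (rule tendsto_eq_intros lim_1_over_n[THEN LIMSEQ_Suc] tendsto_const refl)+ simp
      have "(1 / real (Suc n)) *\<^sub>R (a + real (Suc n) *\<^sub>R v) \<in> K" for n
        using v by (intro K_scale) auto
      then show "\<forall>\<^sub>F n in sequentially. (1 / real (Suc n)) *\<^sub>R a + v \<in> K"
        by (simp add: scaleR_add_right)
    qed simp
    have "u0 = 0" using K_pointed lim all by blast
    then show False using u0(1)[of 0] by simp
  qed
  then obtain u s1 where u: "u = u0 \<or> u = - u0" and s1: "s1 > 0" "a + s1 *\<^sub>R u \<notin> K" by blast
  have rec: "recurrent A p (s *\<^sub>R a + t *\<^sub>R u)" for s t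
    using u u0(2)[of s t] u0(2)[of s "- t"] by auto
  have u_span: "u \<noteq> t *\<^sub>R a" for t
    using u u0(1)[of t] u0(1)[of "- t"] by auto
  obtain t where t: "t > 0" "\<And>v. (t * norm v) *\<^sub>R (a + b) + v \<in> K" using order_unit[OF a_plus_b] by blast
  \<comment> \<open>The vector r (a + b) + u lies in K, and recurrence removes its r b. Hence a + (1
    / r) u is in K, and \<open>s0\<close> will be positive.\<close>
  define r where "r = t * norm u"
  have r: "r > 0" using t u_span[of 0] by (simp add: r_def)
  have "r *\<^sub>R a + 1 *\<^sub>R u \<in> K"
    by (rule recurrent_in_K[OF rec, where c = r]) (use t(2)[of u] in \<open>simp add: r_def algebra_simps\<close>)
  from K_scale[OF this, of "1 / r"] have start: "a + (1 / r) *\<^sub>R u \<in> K"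
    using r by (simp add: scaleR_add_right)
  have conv: "convex K" by (rule convex_closure[OF convex_cone])
  define I where "I = {s. 0 \<le> s \<and> a + s *\<^sub>R u \<in> K}"
  have "s \<le> s1" if "s \<in> I" for s
  proof (rule ccontr)
    assume "\<not> s \<le> s1"
    then have "(1 - s1 / s) *\<^sub>R a + (s1 / s) *\<^sub>R (a + s *\<^sub>R u) \<in> K"
      using that s1 a_in_K by (intro convexD[OF conv]) (auto simp: I_def)
    then show False using s1 \<open>\<not> s \<le> s1\<close> by (simp add: algebra_simps)
  qed
  then have "I \<subseteq> {0..s1}" by (auto simp: I_def)
  moreover have "closed I"
  proof -
    have "I = {0..} \<inter> (\<lambda>s. a + s *\<^sub>R u) -` K" by (auto simp: I_def)
    moreover have "closed ((\<lambda>s. a + s *\<^sub>R u) -` K)"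
      by (intro continuous_closed_vimage closed_closure) (auto intro!: continuous_intros)
    ultimately show ?thesis by (simp add: closed_Int)
  qed
  ultimately have "compact I" by (meson bounded_closed_interval bounded_subset compact_eq_bounded_closed)
  moreover have start_I: "1 / r \<in> I" using start r by (simp add: I_def)
  ultimately obtain s0 where s0: "s0 \<in> I" "\<forall>s\<in>I. s \<le> s0" using compact_attains_sup by blast
  then have s0_pos: "s0 > 0" using start_I r by (meson divide_pos_pos less_le_trans zero_less_one)
  define z where "z = a + s0 *\<^sub>R u"
  have zK: "z \<in> K" using s0 by (simp add: z_def I_def)
  have rec_z: "recurrent A p (z + c *\<^sub>R a)" for c
    using rec[of "1 + c" s0] by (simp add: z_def algebra_simps)
  have "z \<noteq> 0"
  proof
    assume "z = 0"
    then have "s0 *\<^sub>R u = - a" unfolding z_def by (metis add.commute eq_neg_iff_add_eq_0)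
    then have "(1 / s0) *\<^sub>R (s0 *\<^sub>R u) = (- 1 / s0) *\<^sub>R a" by simp
    then have "u = (- 1 / s0) *\<^sub>R a" using s0_pos by simp
    then show False using u_span by blast
  qed
  moreover have "z + a \<notin> C" using recurrent_notin_cone rec_z[of 1] by simp
  moreover have "z + b \<notin> C"
  proof
    assume "z + b \<in> C"
    then obtain d where d: "d > 0" "ball (z + b) d \<subseteq> C" using open_cone open_contains_ball by blast
    \<comment> \<open>If z + b is interior, so is z + b - e a; recurrence then gives z - e a in K.
      Rescaled by 1 / (1 - e), this is a + s u with s = s0 / (1 - e) beyond the maximum.\<close>
    define e where "e = min (1 / 2) (d / (2 * norm a))"
    have e: "0 < e" "e < 1" "e * norm a < d"
    proof -
      have "e * norm a \<le> d / (2 * norm a) * norm a" by (intro mult_right_mono) (auto simp: e_def)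
      also have "\<dots> < d" using d a_nonzero by simp
      finally show "e * norm a < d" .
    qed (use d a_nonzero in \<open>auto simp: e_def\<close>)
    have "z + b - e *\<^sub>R a \<in> C" using e by (intro subsetD[OF d(2)]) (simp add: dist_norm)
    then have "(z + (- e) *\<^sub>R a) + 1 *\<^sub>R b \<in> K" using cone_subset by (simp add: algebra_simps)
    then have "z + (- e) *\<^sub>R a \<in> K" by (rule recurrent_in_K[OF rec_z])
    also have "z + (- e) *\<^sub>R a = (1 - e) *\<^sub>R a + s0 *\<^sub>R u" by (simp add: z_def algebra_simps)
    finally have "a + (s0 / (1 - e)) *\<^sub>R u \<in> K"
      using K_scale[of "(1 - e) *\<^sub>R a + s0 *\<^sub>R u" "1 / (1 - e)"] e by (simp add: scaleR_add_right)
    then have "s0 / (1 - e) \<in> I" using e s0_pos by (simp add: I_def)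
    then have "s0 / (1 - e) \<le> s0" using s0 by blast
    moreover have "e * s0 > 0" using e s0_pos by simp
    ultimately show False using e by (simp add: field_simps)
  qed
  ultimately show ?thesis using that zK by blast
qed

text \<open>\<open>L\<close> is a limit of a subsequence of the powers of A / p, which exists by
  their boundedness; it inherits positivity and commutes with everything that commutes with
  A.\<close>

lemma proximal_limit:
  assumes prox: "\<And>x. other_eigenvalue A a x \<Longrightarrow> cmod x < p"
  obtains L where "L *v a = a" "L *v b = 0" "\<And>v. v \<in> K \<Longrightarrow> L *v v \<in> K"
    "\<And>H v. (\<And>x. H *v (A *v x) = A *v (H *v x)) \<Longrightarrow> H *v (L *v v) = L *v (H *v v)"
    "\<And>z. z \<in> K \<Longrightarrow> z + b \<notin> C \<Longrightarrow> L *v z = 0"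
proof -
  obtain B where B: "B \<ge> 0" "\<And>n v. norm (mpow A n *v v) \<le> B * p ^ n * norm v"
    using power_bound by blast
  define T where "T n = (1 / p ^ n) *\<^sub>R mpow A n" for n
  have T: "T n *v v = (1 / p ^ n) *\<^sub>R (mpow A n *v v)" for n v
    by (simp add: T_def matrix_scaleR_mult_vector)
  have "norm (T n *v v) \<le> B * norm v" for n v
    using B(2)[of n v] p_pos unfolding T by (simp add: field_simps)
  then have "bounded (range T)"
    unfolding bounded_iff using norm_matrix_le[of "T _" B] by blast
  then obtain L r where r: "strict_mono r" and L: "(T \<circ> r) \<longlonglongrightarrow> L"
    using bounded_imp_convergent_subsequence by blast
  have Lim: "(\<lambda>k. T (r k) *v v) \<longlonglongrightarrow> L *v v" for v
    using tendsto_matrix_vector_mult[OF L] by (simp add: o_def)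
  have "T n *v a = a" for n using p_pos by (simp add: T mpow_eigenvector_real[OF A_a])
  then have "(\<lambda>k. a) \<longlonglongrightarrow> L *v a" using Lim[of a] by simp
  then have La: "L *v a = a" using LIMSEQ_unique tendsto_const by blast
  have Tb: "T n *v b = (q / p) ^ n *\<^sub>R b" for n by (simp add: T mpow_eigenvector_real[OF A_b] power_divide)
  have "(\<lambda>n. (q / p) ^ n *\<^sub>R b) \<longlonglongrightarrow> 0 *\<^sub>R b"
    by (intro tendsto_scaleR tendsto_const LIMSEQ_power_zero) (use q_pos q_less_p in simp)
  from LIMSEQ_subseq_LIMSEQ[OF this r] have "(\<lambda>k. T (r k) *v b) \<longlonglongrightarrow> 0" by (simp add: Tb o_def)
  then have Lb: "L *v b = 0" using Lim LIMSEQ_unique by blast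
  have LK: "L *v v \<in> K" if "v \<in> K" for v
  proof (rule Lim_in_closed_set[OF closed_closure _ _ Lim])
    show "\<forall>\<^sub>F k in sequentially. T (r k) *v v \<in> K"
      unfolding T using K_scale mpow_in_K[OF that] p_pos by simp
  qed simp
  have comm: "H *v (L *v v) = L *v (H *v v)" if H: "\<And>x. H *v (A *v x) = A *v (H *v x)" for H v
  proof -
    have "(\<lambda>k. H *v (T (r k) *v v)) \<longlonglongrightarrow> H *v (L *v v)"
      by (rule bounded_linear.tendsto[OF matrix_vector_mul_bounded_linear Lim])
    moreover have "H *v (T n *v v) = T n *v (H *v v)" for n
      by (simp add: T matrix_vector_mult_scaleR mpow_commute[OF H])
    ultimately show ?thesis using Lim[of "H *v v"] LIMSEQ_unique by simp
  qed
  obtain k where k: "a $ k \<noteq> 0" using a_nonzero by (auto simp: vec_eq_iff)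
  \<comment> \<open>Proximality enters here: the part of the rescaled powers transverse to
    \<open>a\<close> tends to 0, so the image of \<open>L\<close> is the line of
    \<open>a\<close>.\<close>
  have L_span: "L *v v = ((L *v v) $ k / a $ k) *\<^sub>R a" for v
  proof -
    have "(\<lambda>n. T n *v v - ((T n *v v) $ k / a $ k) *\<^sub>R a) \<longlonglongrightarrow> 0"
      using mpow_tendsto_span[OF A_a k p_pos prox, of v] by (simp add: T scaleR_diff_right)
    from LIMSEQ_subseq_LIMSEQ[OF this r]
    have "(\<lambda>n. T (r n) *v v - ((T (r n) *v v) $ k / a $ k) *\<^sub>R a) \<longlonglongrightarrow> 0" by (simp add: o_def)
    moreover have "(\<lambda>n. T (r n) *v v - ((T (r n) *v v) $ k / a $ k) *\<^sub>R a) \<longlonglongrightarrow>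
        L *v v - ((L *v v) $ k / a $ k) *\<^sub>R a"
      by (intro tendsto_intros tendsto_vec_nth Lim k)
    ultimately have "L *v v - ((L *v v) $ k / a $ k) *\<^sub>R a = 0" using LIMSEQ_unique by blast
    then show ?thesis by simp
  qed
  have "L *v z = 0" if z: "z \<in> K" "z + b \<notin> C" for z
  proof -
    define t where "t = (L *v z) $ k / a $ k"
    have Lz: "L *v z = t *\<^sub>R a" unfolding t_def by (rule L_span)
    have "\<not> t < 0"
    proof
      assume "t < 0"
      then have "- a \<in> K" using K_scale[OF LK[OF z(1)], of "- 1 / t"] by (simp add: Lz)
      then show False using K_pointed a_in_K a_nonzero by blast
    qed
    moreover have "\<not> t > 0"
    proof
      assume t: "t > 0"
      define m where "m = min t 1"
      have m: "m > 0" "m \<le> t" "m \<le> 1" using t by (auto simp: m_def)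
      have "t *\<^sub>R a + b = m *\<^sub>R (a + b) + ((t - m) *\<^sub>R a + (1 - m) *\<^sub>R b)"
        by (simp add: algebra_simps)
      moreover have "m *\<^sub>R (a + b) + ((t - m) *\<^sub>R a + (1 - m) *\<^sub>R b) \<in> C"
        using m by (intro cone_add_K K_add K_scale cone_scale a_plus_b a_in_K b_in_K) auto
      ultimately have "L *v z + b \<in> C" by (simp add: Lz)
      moreover have "(\<lambda>k. T (r k) *v z + b) \<longlonglongrightarrow> L *v z + b" by (intro tendsto_intros Lim)
      ultimately have "\<forall>\<^sub>F k in sequentially. T (r k) *v z + b \<in> C"
        using open_cone by (metis topological_tendstoD)
      then obtain n where n: "T n *v z + b \<in> C" by (auto simp: eventually_sequentially)
      \<comment> \<open>Undoing A^n enlarges \<open>b\<close> by (p/q)^n >= 1. Adding a nonnegative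
        multiple of \<open>z\<close> then yields a positive multiple of z + b.\<close>
      have "T n *v z + b = (1 / p ^ n) *\<^sub>R (mpow A n *v (z + (p / q) ^ n *\<^sub>R b))"
        using p_pos q_pos by (simp add: T matrix_vector_right_distrib matrix_vector_mult_scaleR
            mpow_eigenvector_real[OF A_b] scaleR_add_right power_divide)
      then have "z + (p / q) ^ n *\<^sub>R b \<in> C"
        using n p_pos by (simp add: cone_scale_iff mpow_in_cone_iff del: scaleR_scaleR)
      moreover have pq: "(p / q) ^ n \<ge> 1" using q_pos q_less_p by (intro one_le_power) simp
      then have "((p / q) ^ n - 1) *\<^sub>R z \<in> K" using z by (intro K_scale) auto
      ultimately have "(z + (p / q) ^ n *\<^sub>R b) + ((p / q) ^ n - 1) *\<^sub>R z \<in> C" by (rule cone_add_K)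
      then have "(p / q) ^ n *\<^sub>R (z + b) \<in> C" by (simp add: algebra_simps)
      then show False using z(2) pq cone_scale_iff by (metis less_le_trans zero_less_one)
    qed
    ultimately show ?thesis using Lz by simp
  qed
  then show ?thesis using that[OF La Lb LK comm] by blast
qed

lemma inverse_mult: "matrix_inv A *v (A *v v) = v" "A *v (matrix_inv A *v v) = v"
  using matrix_inv_left[OF invertible_A] matrix_inv_right[OF invertible_A]
  by (simp_all add: matrix_vector_mul_assoc)

lemma hyperbolic_inverse: "hyperbolic_cone_map C w R (matrix_inv A) b a (1 / q) (1 / p)"
proof unfold_locales
  show "invertible (matrix_inv A)"
    unfolding invertible_def using matrix_inv_left[OF invertible_A] matrix_inv_right[OF invertible_A] by blast
  have "(*v) (matrix_inv A) ` ((*v) A ` C) = C" by (simp add: image_image inverse_mult)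
  then show "(*v) (matrix_inv A) ` C = C" by (simp add: A_cone)
  have "(1 / p) *\<^sub>R (matrix_inv A *v (A *v a)) = matrix_inv A *v a"
    using p_pos by (simp add: A_a matrix_vector_mult_scaleR)
  then show "matrix_inv A *v a = (1 / p) *\<^sub>R a" unfolding inverse_mult by simp
  have "(1 / q) *\<^sub>R (matrix_inv A *v (A *v b)) = matrix_inv A *v b"
    using q_pos by (simp add: A_b matrix_vector_mult_scaleR)
  then show "matrix_inv A *v b = (1 / q) *\<^sub>R b" unfolding inverse_mult by simp
  show "0 < 1 / p" "1 / p < 1 / q" using p_pos q_pos q_less_p by (simp_all add: frac_less2)
  show "b \<in> K" "a \<in> K" "b \<noteq> 0" "a \<noteq> 0" by (fact b_in_K a_in_K b_nonzero a_nonzero)+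
  show "b + a \<in> C" using a_plus_b by (simp add: add.commute)
qed

end

section \<open>Exchanging the two ends by passing to the inverse\<close>

lemma other_eigenvalue_inverse:
  fixes A :: "real ^ 'n::finite ^ 'n"
  assumes A: "invertible A" and b: "A *v b = q *\<^sub>R b" and x: "other_eigenvalue A b x" and q: "q \<noteq> 0"
  shows "x \<noteq> 0" "other_eigenvalue (matrix_inv A) b (1 / x)"
proof -
  let ?N = "complex_matrix (matrix_inv A)" and ?b = "complex_vector b"
  obtain v c where v: "\<And>t. v \<noteq> t *s ?b" "complex_matrix A *v v = x *s v + c *s ?b"
    using x unfolding quotient_eigenvalue_def by blast
  have inv: "?N *v (complex_matrix A *v u) = u" for u
    using matrix_inv_left[OF A]
    by (simp add: matrix_vector_mul_assoc complex_matrix_mult complex_matrix_mat1)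
  have "?N *v (complex_matrix A *v ?b) = complex_of_real q *s (?N *v ?b)"
    by (simp add: complex_matrix_mult_vector b complex_vector_scaleR vector_scalar_commute)
  then have Nb: "?N *v ?b = (1 / complex_of_real q) *s ?b"
    unfolding inv using q by (simp add: vec_eq_iff)
  have Nv: "v = x *s (?N *v v) + (c / complex_of_real q) *s ?b"
    using inv[of v] by (simp add: v(2) Nb matrix_vector_right_distrib vector_scalar_commute vector_smult_assoc)
  show x: "x \<noteq> 0"
  proof
    assume "x = 0"
    then have "v = (c / complex_of_real q) *s ?b" using Nv by simp
    then show False using v(1) by blast
  qed
  have "(1 / x) *s v = (1 / x) *s (x *s (?N *v v) + (c / complex_of_real q) *s ?b)" using Nv by simp
  then have "?N *v v = (1 / x) *s v + (- c / (x * complex_of_real q)) *s ?b"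
    using x by (simp add: vec_eq_iff distrib_left)
  then show "other_eigenvalue (matrix_inv A) b (1 / x)"
    using v(1) unfolding quotient_eigenvalue_def by blast
qed

lemma matrix_inv_matrix_inv:
  assumes "invertible A"
  shows "matrix_inv (matrix_inv A) = A" "invertible (matrix_inv A)"
proof -
  show inv: "invertible (matrix_inv A)"
    using matrix_inv_left[OF assms] matrix_inv_right[OF assms] unfolding invertible_def by blast
  show "matrix_inv (matrix_inv A) = A"
    using matrix_mul_assoc[of A "matrix_inv A" "matrix_inv (matrix_inv A)"]
    by (simp add: matrix_inv_right[OF assms] matrix_inv_right[OF inv])
qed

context hyperbolic_cone_map
begin

lemma other_eigenvalue_ge: "other_eigenvalue A b x \<Longrightarrow> q \<le> cmod x"
proof -
  assume x: "other_eigenvalue A b x"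
  have "cmod (1 / x) \<le> 1 / q"
    using hyperbolic_cone_map.other_eigenvalue_le[OF hyperbolic_inverse]
      other_eigenvalue_inverse(2)[OF invertible_A A_b x] q_pos by simp
  then show ?thesis
    using other_eigenvalue_inverse(1)[OF invertible_A A_b x] q_pos by (simp add: norm_divide field_simps)
qed

lemma proximal_inverse_iff:
  "(\<forall>x. other_eigenvalue (matrix_inv A) b x \<longrightarrow> cmod x < 1 / q) \<longleftrightarrow>
    (\<forall>x. other_eigenvalue A b x \<longrightarrow> q < cmod x)"
proof (intro iffI allI impI)
  fix x assume *: "\<forall>x. other_eigenvalue (matrix_inv A) b x \<longrightarrow> cmod x < 1 / q" and x: "other_eigenvalue A b x"
  have "cmod (1 / x) < 1 / q" using * other_eigenvalue_inverse(2)[OF invertible_A A_b x] q_pos by simp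
  then show "q < cmod x"
    using other_eigenvalue_inverse(1)[OF invertible_A A_b x] q_pos by (simp add: norm_divide field_simps)
next
  fix x assume *: "\<forall>x. other_eigenvalue A b x \<longrightarrow> q < cmod x" and x: "other_eigenvalue (matrix_inv A) b x"
  interpret h': hyperbolic_cone_map C w R "matrix_inv A" b a "1 / q" "1 / p" by (rule hyperbolic_inverse)
  have x0: "x \<noteq> 0" and "other_eigenvalue A b (1 / x)"
    using other_eigenvalue_inverse[OF h'.invertible_A h'.A_a x] q_pos
    by (simp_all add: matrix_inv_matrix_inv[OF invertible_A])
  then have "q < cmod (1 / x)" using * by blast
  then show "cmod x < 1 / q" using x0 q_pos by (simp add: norm_divide field_simps)
qed

end


section \<open>Eigenvectors in the proximal case\<close>

context hyperbolic_cone_map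
begin

text \<open>An eigenvector for \<open>p\<close> off the line of \<open>a\<close> would make
  \<open>p\<close> itself an eigenvalue on the quotient.\<close>

lemma proximal_eigenvector:
  assumes prox: "\<And>x. other_eigenvalue A a x \<Longrightarrow> cmod x < p" and y: "A *v y = p *\<^sub>R y"
  obtains t where "y = t *\<^sub>R a"
proof -
  have "\<exists>t. y = t *\<^sub>R a"
  proof (rule ccontr)
    assume no: "\<not> ?thesis"
    have "complex_vector y \<noteq> t *s complex_vector a" for t
    proof
      assume "complex_vector y = t *s complex_vector a"
      then have "Re (complex_vector y $ i) = Re ((t *s complex_vector a) $ i)" for i by simp
      then have "y = Re t *\<^sub>R a" by (simp add: complex_vector_def vec_eq_iff)
      then show False using no by blast
    qed
    moreover have "complex_matrix A *v complex_vector y = complex_of_real p *s complex_vector y + 0 *s complex_vector a"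
      by (simp add: complex_matrix_mult_vector y complex_vector_scaleR)
    ultimately have "other_eigenvalue A a (complex_of_real p)" unfolding quotient_eigenvalue_def by blast
    from prox[OF this] show False using p_pos by simp
  qed
  then show ?thesis using that by blast
qed

text \<open>The kernels of \<open>L\<close> and \<open>L'\<close> are invariant under A, so
  normalizing A v gives a self-map of the slice of K inside both kernels. This slice is compact,
  convex and contains the normalized \<open>z\<close>; a fixed point is an eigenvector.\<close>

lemma exists_common_eigenvector:
  assumes L: "\<And>v. L *v (A *v v) = A *v (L *v v)" and L': "\<And>v. L' *v (A *v v) = A *v (L' *v v)"
    and z: "z \<in> K" "z \<noteq> 0" "L *v z = 0" "L' *v z = 0"
  obtains v m where "v \<in> K" "v \<noteq> 0" "L *v v = 0" "L' *v v = 0" "m > 0" "A *v v = m *\<^sub>R v"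
proof -
  define S where "S = {v \<in> K. w \<bullet> v = 1 \<and> L *v v = 0 \<and> L' *v v = 0}"
  define f where "f v = (1 / (w \<bullet> (A *v v))) *\<^sub>R (A *v v)" for v
  have nz: "v \<noteq> 0" if "v \<in> S" for v using that by (auto simp: S_def)
  have AK: "A *v v \<in> K" "w \<bullet> (A *v v) > 0" if "v \<in> S" for v
  proof -
    show "A *v v \<in> K" using that A_in_K by (simp add: S_def)
    moreover have "A *v v \<noteq> 0" using nz[OF that] inverse_mult(1)[of v] by auto
    ultimately show "w \<bullet> (A *v v) > 0" by (rule K_inner_pos)
  qed
  have "S = K \<inter> {v. w \<bullet> v = 1} \<inter> {v. L *v v = 0} \<inter> {v. L' *v v = 0}" by (auto simp: S_def)
  then have "closed S"
    by (simp add: closed_Int closed_hyperplane closed_Collect_eq continuous_intros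
        linear_continuous_on matrix_vector_mul_bounded_linear)
  moreover have "bounded S" unfolding bounded_iff using K_bounded by (force simp: S_def)
  ultimately have "compact S" by (simp add: compact_eq_bounded_closed)
  moreover have "convex S"
    using convex_closure[OF convex_cone] unfolding convex_def S_def
    by (auto simp: inner_add_right matrix_vector_right_distrib matrix_vector_mult_scaleR)
  moreover have "(1 / (w \<bullet> z)) *\<^sub>R z \<in> S"
    using z K_inner_pos[OF z(1,2)] K_scale[OF z(1), of "1 / (w \<bullet> z)"]
    by (simp add: S_def matrix_vector_mult_scaleR)
  then have "S \<noteq> {}" by blast
  moreover have "continuous_on S f"
    unfolding f_def
    by (intro continuous_intros linear_continuous_on matrix_vector_mul_bounded_linear) (use AK in force)
  moreover have "f \<in> S \<rightarrow> S"
  proof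
    fix v assume v: "v \<in> S"
    show "f v \<in> S"
      using AK[OF v] K_scale[OF AK(1)[OF v], of "1 / (w \<bullet> (A *v v))"] v
      by (simp add: S_def f_def matrix_vector_mult_scaleR L L')
  qed
  ultimately obtain v where v: "v \<in> S" "f v = v" using brouwer by blast
  define m where "m = w \<bullet> (A *v v)"
  have m: "m > 0" using AK(2)[OF v(1)] by (simp add: m_def)
  then have "A *v v = m *\<^sub>R f v" by (simp add: f_def m_def)
  then have "A *v v = m *\<^sub>R v" by (simp only: v(2))
  then show ?thesis using that[of v m] v(1) nz[OF v(1)] m by (auto simp: S_def)
qed

end

section \<open>Discrete groups acting cocompactly on the cone\<close>

lemma det_scaleR: "det (c *\<^sub>R X) = c ^ CARD('n) * det X" for X :: "real ^ 'n::finite ^ 'n"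
proof -
  have "det (c *\<^sub>R X) = (\<Sum>p | p permutes (UNIV :: 'n set). of_int (sign p) *
      (c ^ CARD('n) * (\<Prod>i\<in>UNIV. X $ i $ p i)))"
    unfolding det_def by (simp add: prod.distrib)
  then show ?thesis unfolding det_def by (simp add: sum_distrib_left mult_ac)
qed

text \<open>G is meant as a group of lifts, taken with all their positive multiples: hence P k can
  hit x exactly, and elements near the identity are only known to be scalar. The compact fundamental
  set is replaced by the order interval from e u to M u.\<close>

locale cocompact_cone_group = bounded_cone C w R for C :: "(real ^ 'n::finite) set" and w R +
  fixes G :: "(real ^ 'n ^ 'n) set" and u :: "real ^ 'n" and e M d :: real
  assumes G_invertible: "P \<in> G \<Longrightarrow> invertible P" and G_cone: "P \<in> G \<Longrightarrow> (*v) P ` C = C"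
    and G_mult: "P \<in> G \<Longrightarrow> Q \<in> G \<Longrightarrow> P ** Q \<in> G" and G_inv: "P \<in> G \<Longrightarrow> matrix_inv P \<in> G"
    and u_in_cone: "u \<in> C" and e_pos: "e > 0" and M_pos: "M > 0" and d_pos: "d > 0"
    and cocompact: "x \<in> C \<Longrightarrow> \<exists>P\<in>G. \<exists>k. P *v k = x \<and> k - e *\<^sub>R u \<in> K \<and> M *\<^sub>R u - k \<in> K"
    and discrete: "P \<in> G \<Longrightarrow> norm (P - mat 1) < d \<Longrightarrow> \<exists>c. P = c *\<^sub>R mat 1"
begin

lemma G_inverse_mult: "P \<in> G \<Longrightarrow> matrix_inv P *v (P *v v) = v" "P \<in> G \<Longrightarrow> P *v (matrix_inv P *v v) = v"
  using matrix_inv_left[OF G_invertible] matrix_inv_right[OF G_invertible]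
  by (simp_all add: matrix_vector_mul_assoc)

lemma G_in_cone: "P \<in> G \<Longrightarrow> v \<in> C \<Longrightarrow> P *v v \<in> C"
  using G_cone by blast

lemma G_in_K: "P \<in> G \<Longrightarrow> v \<in> K \<Longrightarrow> P *v v \<in> K"
  by (rule matrix_maps_K) (use G_in_cone cone_subset in blast)+

text \<open>
  If \<open>Q x \<le> c x\<close> for all points of an orbit sequence \<open>x n = P n k n\<close>, then the conjugates of \<open>Q\<close> by
  \<open>P n\<close> satisfy \<open>Q' k n \<le> c k n\<close>, where \<open>k n\<close> is comparable to the fixed order unit \<open>u\<close>.
\<close>
lemma bounded_conjugates:
  fixes P :: "nat \<Rightarrow> real ^ 'n ^ 'n"
  assumes P: "\<And>n. P n \<in> G" and Q: "Q \<in> G" and c: "c \<ge> 0"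
    and k: "\<And>n. k n - e *\<^sub>R u \<in> K" "\<And>n. M *\<^sub>R u - k n \<in> K"
    and le: "\<And>n. c *\<^sub>R (P n *v k n) - Q *v (P n *v k n) \<in> K"
  shows "bounded (range (\<lambda>n. matrix_inv (P n) ** Q ** P n))"
proof -
  obtain N where N: "N \<ge> 0" "\<And>X c v. (\<And>v. v \<in> C \<Longrightarrow> X *v v \<in> K) \<Longrightarrow> c *\<^sub>R u - X *v u \<in> K \<Longrightarrow>
    norm (X *v v) \<le> N * c * norm v" using matrix_bound[OF u_in_cone] by blast
  define X where "X n = matrix_inv (P n) ** Q ** P n" for n
  have XG: "X n \<in> G" for n unfolding X_def by (intro G_mult G_inv P Q)
  \<comment> \<open>The constant comes from the chain e X u <= X k <= c k <= c M u in the order of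
    K.\<close>
  have "norm (X n *v v) \<le> (N * (c * M / e)) * norm v" for n v
  proof (rule N(2))
    show "X n *v x \<in> K" if "x \<in> C" for x using G_in_cone[OF XG that] by (rule cone_subset)
    have "matrix_inv (P n) *v (c *\<^sub>R (P n *v k n) - Q *v (P n *v k n)) \<in> K"
      by (intro G_in_K G_inv P le)
    then have 1: "c *\<^sub>R k n - X n *v k n \<in> K"
      by (simp add: X_def matrix_vector_mult_diff_distrib matrix_vector_mult_scaleR G_inverse_mult[OF P]
          flip: matrix_vector_mul_assoc)
    have 2: "X n *v k n - e *\<^sub>R (X n *v u) \<in> K"
      using G_in_K[OF XG k(1)] by (simp add: matrix_vector_mult_diff_distrib matrix_vector_mult_scaleR)
    have "(c / e) *\<^sub>R (M *\<^sub>R u - k n) + ((1 / e) *\<^sub>R (c *\<^sub>R k n - X n *v k n) +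
        (1 / e) *\<^sub>R (X n *v k n - e *\<^sub>R (X n *v u))) \<in> K"
      using e_pos c by (intro K_add K_scale 1 2 k) auto
    also have "(c / e) *\<^sub>R (M *\<^sub>R u - k n) + ((1 / e) *\<^sub>R (c *\<^sub>R k n - X n *v k n) +
        (1 / e) *\<^sub>R (X n *v k n - e *\<^sub>R (X n *v u))) = (c * M / e) *\<^sub>R u - X n *v u"
      using e_pos by (simp add: scaleR_diff_right)
    finally show "(c * M / e) *\<^sub>R u - X n *v u \<in> K" .
  qed
  from norm_matrix_le[OF this] show ?thesis unfolding bounded_iff X_def by blast
qed

text \<open>Discreteness determines Y only up to a scalar \<open>c\<close>. Equal determinants give
  a power of \<open>c\<close> equal to 1, and since both matrices preserve the cone,
  \<open>c\<close> is positive.\<close>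

lemma near_scalar_eq:
  assumes XG: "X \<in> G" and YG: "Y \<in> G" and near: "norm (matrix_inv X ** Y - mat 1) < d" and det: "det X = det Y"
  shows "Y = X"
proof -
  obtain c where c: "matrix_inv X ** Y = c *\<^sub>R mat 1"
    using discrete[OF G_mult[OF G_inv[OF XG] YG] near] by blast
  have "Y = X ** (matrix_inv X ** Y)"
    using matrix_inv_right[OF G_invertible[OF XG]] by (simp add: matrix_mul_assoc)
  also have "\<dots> = c *\<^sub>R X" unfolding c by (simp add: matrix_scaleR matrix_scalar_ac)
  finally have Y: "Y = c *\<^sub>R X" .
  have "det X \<noteq> 0" using G_invertible[OF XG] by (simp add: invertible_det_nz)
  then have "c ^ CARD('n) = 1" using det unfolding Y det_scaleR by simp
  moreover have "c > 0"
  proof (rule ccontr)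
    assume "\<not> c > 0"
    have "Y *v u = c *\<^sub>R (X *v u)" by (simp add: Y matrix_scaleR_mult_vector)
    moreover have "Y *v u \<in> C" "X *v u \<in> C" using G_in_cone XG YG u_in_cone by auto
    ultimately have "c *\<^sub>R (X *v u) + (- c) *\<^sub>R (X *v u) \<in> C"
      using \<open>\<not> c > 0\<close> by (metis cone_add_K K_scale cone_subset linorder_not_le neg_0_le_iff_le not_less)
    then show False using zero_notin_cone by simp
  qed
  ultimately have "c = 1" by (metis less_imp_le power_eq_1_iff zero_less_card_finite less_irrefl real_norm_def abs_of_pos)
  then show ?thesis using Y by simp
qed

lemma no_half_triangle:
  assumes hyp: "hyperbolic_cone_map C w R A a b p q" and AG: "A \<in> G"
    and prox_a: "\<And>x. other_eigenvalue A a x \<Longrightarrow> cmod x < p"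
    and prox_b: "\<And>x. other_eigenvalue (matrix_inv A) b x \<Longrightarrow> cmod x < 1 / q"
    and z: "z \<in> K" "z \<noteq> 0" "z + a \<notin> C" "z + b \<notin> C"
  shows False
proof -
  interpret h: hyperbolic_cone_map C w R A a b p q by (rule hyp)
  interpret h': hyperbolic_cone_map C w R "matrix_inv A" b a "1 / q" "1 / p" by (rule h.hyperbolic_inverse)
  obtain L where L: "L *v a = a" "L *v b = 0" "\<And>v. v \<in> K \<Longrightarrow> L *v v \<in> K"
    "\<And>H v. (\<And>x. H *v (A *v x) = A *v (H *v x)) \<Longrightarrow> H *v (L *v v) = L *v (H *v v)"
    "\<And>z. z \<in> K \<Longrightarrow> z + b \<notin> C \<Longrightarrow> L *v z = 0"
    using h.proximal_limit[OF prox_a] by blast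
  obtain L' where L': "L' *v b = b" "L' *v a = 0" "\<And>v. v \<in> K \<Longrightarrow> L' *v v \<in> K"
    "\<And>H v. (\<And>x. H *v (matrix_inv A *v x) = matrix_inv A *v (H *v x)) \<Longrightarrow> H *v (L' *v v) = L' *v (H *v v)"
    "\<And>z. z \<in> K \<Longrightarrow> z + a \<notin> C \<Longrightarrow> L' *v z = 0"
    using h'.proximal_limit[OF prox_b] by blast
  obtain v m where v: "v \<in> K" "v \<noteq> 0" "L *v v = 0" "L' *v v = 0" "m > 0" "A *v v = m *\<^sub>R v"
  proof (rule h.exists_common_eigenvector[of L L' z])
    show "L *v (A *v v) = A *v (L *v v)" for v by (rule L(4)[symmetric]) simp
    show "L' *v (A *v v) = A *v (L' *v v)" for v by (rule L'(4)[symmetric]) (simp add: h.inverse_mult)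
  qed (use z L(5) L'(5) in auto)
  define x where "x n = (a + b) + real n *\<^sub>R v" for n
  have xC: "x n \<in> C" for n unfolding x_def by (intro cone_add_K h.a_plus_b K_scale v) simp
  obtain P k where P: "\<And>n. P n \<in> G" "\<And>n. P n *v k n = x n" "\<And>n. k n - e *\<^sub>R u \<in> K" "\<And>n. M *\<^sub>R u - k n \<in> K"
    using cocompact[OF xC] by metis
  define X where "X n = matrix_inv (P n) ** A ** P n" for n
  \<comment> \<open>The inverse conjugates are bounded as well, so the limit of the conjugates is
    invertible. Consecutive terms of a convergent subsequence then have quotient near 1 and
    eventually coincide.\<close>
  define Y where "Y n = matrix_inv (P n) ** matrix_inv A ** P n" for n
  have XG: "X n \<in> G" and YG: "Y n \<in> G" for n unfolding X_def Y_def by (intro G_mult G_inv P AG)+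
  have YX: "Y n ** X n = mat 1" for n
    by (simp add: matrix_eq X_def Y_def G_inverse_mult[OF P(1)] h.inverse_mult
        flip: matrix_vector_mul_assoc)
  have Y_inv: "Y n = matrix_inv (X n)" for n
    by (metis YX matrix_inv_right[OF G_invertible[OF XG]] matrix_mul_assoc matrix_mul_lid matrix_mul_rid)
  \<comment> \<open>x n is a nonnegative combination of the common eigenvectors a, b, v, so any
    \<open>c\<close> above the three eigenvalues works for every n.\<close>
  have le: "c *\<^sub>R (P n *v k n) - Q *v (P n *v k n) \<in> K"
    if Q: "Q *v a = p' *\<^sub>R a" "Q *v b = q' *\<^sub>R b" "Q *v v = m' *\<^sub>R v"
      and c: "c \<ge> p'" "c \<ge> q'" "c \<ge> m'" for Q c p' q' m' n
  proof -
    have "c *\<^sub>R x n - Q *v x n = ((c - p') *\<^sub>R a + (c - q') *\<^sub>R b) + (real n * (c - m')) *\<^sub>R v"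
      by (simp add: x_def matrix_vector_right_distrib matrix_vector_mult_scaleR Q algebra_simps)
    also have "\<dots> \<in> K" using c by (intro K_add K_scale h.a_in_K h.b_in_K v) auto
    finally show ?thesis by (simp add: P)
  qed
  have v_inv: "matrix_inv A *v v = (1 / m) *\<^sub>R v"
  proof -
    have "(1 / m) *\<^sub>R (matrix_inv A *v (A *v v)) = matrix_inv A *v v"
      using v(5) by (simp add: v(6) matrix_vector_mult_scaleR)
    then show ?thesis unfolding h.inverse_mult by simp
  qed
  have bddX: "bounded (range X)" unfolding X_def
    by (rule bounded_conjugates[OF P(1) AG _ P(3,4) le[OF h.A_a h.A_b v(6)], where c = "p + q + m"])
      (use h.p_pos h.q_pos v(5) in auto)
  have bddY: "bounded (range Y)" unfolding Y_def
    by (rule bounded_conjugates[OF P(1) G_inv[OF AG] _ P(3,4) le[OF h'.A_b h'.A_a v_inv], where c = "1 / p + 1 / q + 1 / m"])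
      (use h.p_pos h.q_pos v(5) in auto)
  have "bounded (range (\<lambda>n. (X n, Y n)))"
    by (rule bounded_subset[OF bounded_Times[OF bddX bddY]]) auto
  then obtain l r where r: "strict_mono r" and lim: "((\<lambda>n. (X n, Y n)) \<circ> r) \<longlonglongrightarrow> l"
    using bounded_imp_convergent_subsequence by blast
  have limX: "(\<lambda>n. X (r n)) \<longlonglongrightarrow> fst l" and limY: "(\<lambda>n. Y (r n)) \<longlonglongrightarrow> snd l"
    using tendsto_fst[OF lim] tendsto_snd[OF lim] by (simp_all add: o_def)
  have "(\<lambda>n. mat 1) \<longlonglongrightarrow> snd l ** fst l" using tendsto_matrix_matrix_mult[OF limY limX] by (simp add: YX)
  then have "snd l ** fst l = mat 1" using LIMSEQ_unique tendsto_const by blast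
  then have "(\<lambda>n. Y (r n) ** X (r (Suc n))) \<longlonglongrightarrow> mat 1"
    using tendsto_matrix_matrix_mult[OF limY LIMSEQ_Suc[OF limX]] by simp
  then obtain N where N: "\<And>n. n \<ge> N \<Longrightarrow> norm (Y (r n) ** X (r (Suc n)) - mat 1) < d"
    using LIMSEQ_D[OF _ d_pos] by blast
  have det: "det (X n) = det A" for n
  proof -
    have "det (matrix_inv (P n)) * det (P n) = 1"
      using matrix_inv_left[OF G_invertible[OF P(1)[of n]]] by (metis det_I det_mul)
    then show ?thesis by (simp add: X_def det_mul algebra_simps)
  qed
  have const: "X (r (N + n)) = X (r N)" for n
  proof (induction n)
    case (Suc n)
    have "X (r (Suc (N + n))) = X (r (N + n))"
      by (rule near_scalar_eq[OF XG XG]) (use N[of "N + n"] det Y_inv in auto)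
    then show ?case using Suc by simp
  qed simp
  define j where "j = r N"
  \<comment> \<open>k i' <= M u <= (M / e) k i, for any two indices.\<close>
  define D where "D = M / e"
  have D: "D > 0" using e_pos M_pos by (simp add: D_def)
  have comparable: "D *\<^sub>R k i - k i' \<in> K" for i i'
  proof -
    have "D *\<^sub>R (k i - e *\<^sub>R u) + (M *\<^sub>R u - k i') \<in> K" using D by (intro K_add K_scale P) auto
    then show ?thesis using e_pos by (simp add: D_def scaleR_diff_right)
  qed
  obtain t where t: "t > 0" "\<And>y. (t * norm y) *\<^sub>R (a + b) + y \<in> K" using order_unit[OF h.a_plus_b] by blast
  define s where "s = t * norm (x j)"
  have s: "s \<ge> 0" "s *\<^sub>R (a + b) - x j \<in> K" using t(1) t(2)[of "- x j"] by (auto simp: s_def)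
  \<comment> \<open>Here the vanishing of \<open>L\<close> and \<open>L'\<close> at \<open>v\<close>
    pays off: the values do not depend on i. Applied to D x i - H x j they will bound the factors of
    H on \<open>a\<close> and \<open>b\<close> by \<open>D\<close>.\<close>
  have Lx: "L *v x i = a" "L' *v x i = b" for i
    by (simp_all add: x_def matrix_vector_right_distrib matrix_vector_mult_scaleR L L' v)
  have bound: "(D * (s * D)) *\<^sub>R (a + b) - x (r (N + n)) \<in> K" for n
  proof -
    define i where "i = r (N + n)"
    \<comment> \<open>P i and P j conjugate A to the same matrix, so H commutes with A.\<close>
    define H where "H = P i ** matrix_inv (P j)"
    have HG: "H \<in> G" unfolding H_def by (intro G_mult G_inv P)
    have comm: "H *v (A *v y) = A *v (H *v y)" for y
    proof -
      have "P i *v (X j *v (matrix_inv (P j) *v y)) = P i *v (X i *v (matrix_inv (P j) *v y))"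
        using const[of n] by (simp add: i_def j_def)
      then show ?thesis
        by (simp add: X_def H_def G_inverse_mult[OF P(1)] flip: matrix_vector_mul_assoc)
    qed
    have comm': "H *v (matrix_inv A *v y) = matrix_inv A *v (H *v y)" for y
      using comm[of "matrix_inv A *v y"] by (metis h.inverse_mult)
    have Hx: "H *v x j = P i *v k j"
      by (simp add: H_def P(2)[symmetric] G_inverse_mult[OF P(1)] flip: matrix_vector_mul_assoc)
    have up: "D *\<^sub>R x i - H *v x j \<in> K" and low: "D *\<^sub>R (H *v x j) - x i \<in> K"
      using G_in_K[OF P(1) comparable[of i j], of i] G_in_K[OF P(1) comparable[of j i], of i]
      by (simp_all add: Hx P(2) matrix_vector_mult_diff_distrib matrix_vector_mult_scaleR)
    have "A *v (H *v a) = p *\<^sub>R (H *v a)" using comm[of a] by (simp add: h.A_a matrix_vector_mult_scaleR)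
    then obtain \<alpha> where \<alpha>: "H *v a = \<alpha> *\<^sub>R a" using h.proximal_eigenvector[OF prox_a] by blast
    have "matrix_inv A *v (H *v b) = (1 / q) *\<^sub>R (H *v b)"
      using comm'[of b] by (simp add: h'.A_a matrix_vector_mult_scaleR)
    then obtain \<beta> where \<beta>: "H *v b = \<beta> *\<^sub>R b" using h'.proximal_eigenvector[OF prox_b] by blast
    have "L *v (D *\<^sub>R x i - H *v x j) = (D - \<alpha>) *\<^sub>R a"
      using L(4)[OF comm, of "x j"]
      by (simp add: matrix_vector_mult_diff_distrib matrix_vector_mult_scaleR Lx \<alpha> scaleR_diff_left)
    then have "(D - \<alpha>) *\<^sub>R a \<in> K" using L(3)[OF up] by simp
    moreover have "L' *v (D *\<^sub>R x i - H *v x j) = (D - \<beta>) *\<^sub>R b"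
      using L'(4)[OF comm', of "x j"]
      by (simp add: matrix_vector_mult_diff_distrib matrix_vector_mult_scaleR Lx \<beta> scaleR_diff_left)
    then have "(D - \<beta>) *\<^sub>R b \<in> K" using L'(3)[OF up] by simp
    ultimately have 1: "D *\<^sub>R (a + b) - H *v (a + b) \<in> K"
      using K_add by (fastforce simp: matrix_vector_right_distrib \<alpha> \<beta> algebra_simps)
    have 2: "s *\<^sub>R (H *v (a + b)) - H *v x j \<in> K"
      using G_in_K[OF HG s(2)] by (simp add: matrix_vector_mult_diff_distrib matrix_vector_mult_scaleR)
    \<comment> \<open>This sums the chain x i <= D H x j <= D s H (a + b) <= D s D (a + b); neither
      \<open>D\<close> nor \<open>s\<close> depends on i.\<close>
    have "(D * s) *\<^sub>R (D *\<^sub>R (a + b) - H *v (a + b)) +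
        (D *\<^sub>R (s *\<^sub>R (H *v (a + b)) - H *v x j) + (D *\<^sub>R (H *v x j) - x i)) \<in> K"
      using D s(1) by (intro K_add K_scale 1 2 low) auto
    then show ?thesis by (simp add: i_def scaleR_diff_right mult.assoc)
  qed
  have wv: "w \<bullet> v > 0" by (rule K_inner_pos[OF v(1,2)])
  have wab: "w \<bullet> (a + b) > 0"
    using h.a_plus_b zero_notin_cone by (intro K_inner_pos cone_subset) auto
  obtain n where n: "(w \<bullet> v) * real n > D * (s * D) * (w \<bullet> (a + b))"
    using not_linearly_bounded[OF wv] by blast
  define y where "y = (D * (s * D)) *\<^sub>R (a + b) - x (r (N + n))"
  have "0 \<le> w \<bullet> y" using bound[of n] K_inner_pos[of y] by (cases "y = 0") (auto simp: y_def)
  then have "real (r (N + n)) * (w \<bullet> v) \<le> D * (s * D) * (w \<bullet> (a + b))"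
    using wab by (simp add: y_def x_def inner_diff_right inner_add_right)
  moreover have "real n * (w \<bullet> v) \<le> real (r (N + n)) * (w \<bullet> v)"
    using wv seq_suble[OF r, of "N + n"] by (intro mult_right_mono) auto
  ultimately show False using n by (simp add: mult.commute)
qed

end


section \<open>The cone over a properly convex domain\<close>

lemma abs_proj_eq_iff:
  assumes "v \<noteq> 0" "u \<noteq> 0"
  shows "abs_proj v = abs_proj u \<longleftrightarrow> (\<exists>c. c \<noteq> 0 \<and> u = c *\<^sub>R v)"
proof -
  have refl: "proj_rel x x" if "x \<noteq> 0" for x :: "real ^ 'n"
    using that by (auto simp: proj_rel_def intro!: exI[of _ 1])
  show ?thesis
    using Quotient3_rel[OF Quotient3_proj, of v u] refl assms by (auto simp: proj_rel_def)
qed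

lemma proj_exhaust: obtains v where "v \<noteq> 0" "x = abs_proj v"
  using Quotient3_abs_rep[OF Quotient3_proj, of x] Quotient3_rep_reflp[OF Quotient3_proj, of x]
  by (metis proj_rel_def)

lemma abs_pgl_eq_iff:
  assumes "invertible A" "invertible B"
  shows "abs_pgl A = abs_pgl B \<longleftrightarrow> (\<exists>c. c \<noteq> 0 \<and> B = c *\<^sub>R A)"
proof -
  have refl: "pgl_rel X X" if "invertible X" for X :: "real ^ 'n ^ 'n"
    using that by (auto simp: pgl_rel_def intro!: exI[of _ 1])
  show ?thesis
    using Quotient3_rel[OF Quotient3_pgl, of A B] refl assms by (auto simp: pgl_rel_def)
qed

lemma pgl_exhaust: obtains A where "invertible A" "g = abs_pgl A"
  using Quotient3_abs_rep[OF Quotient3_pgl, of g] Quotient3_rep_reflp[OF Quotient3_pgl, of g]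
  by (metis pgl_rel_def)

lemma pgl_act_abs: "invertible A \<Longrightarrow> v \<noteq> 0 \<Longrightarrow> pgl_act (abs_pgl A) (abs_proj v) = abs_proj (A *v v)"
  by (rule pgl_act.abs_eq) (auto simp: pgl_rel_def proj_rel_def intro!: exI[of _ 1])

lemma pgl_mult_abs: "invertible A \<Longrightarrow> invertible B \<Longrightarrow> pgl_mult (abs_pgl A) (abs_pgl B) = abs_pgl (A ** B)"
  by (rule pgl_mult.abs_eq) (auto simp: pgl_rel_def intro!: exI[of _ 1])

lemma affine_coord_abs: "v \<noteq> 0 \<Longrightarrow> affine_coord w (abs_proj v) = (1 / (w \<bullet> v)) *\<^sub>R v"
  by (rule affine_coord.abs_eq) (auto simp: proj_rel_def intro!: exI[of _ 1])

lemma abs_proj_scale: "v \<noteq> 0 \<Longrightarrow> c \<noteq> 0 \<Longrightarrow> abs_proj (c *\<^sub>R v) = abs_proj v"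
  by (subst eq_commute, subst abs_proj_eq_iff) auto

lemma abs_pgl_scale:
  assumes "invertible A" "c \<noteq> 0"
  shows "abs_pgl (c *\<^sub>R A) = abs_pgl A" "invertible (c *\<^sub>R A)"
proof -
  show inv: "invertible (c *\<^sub>R A)" using assms by (simp add: invertible_det_nz det_scaleR)
  show "abs_pgl (c *\<^sub>R A) = abs_pgl A"
    by (subst eq_commute, subst abs_pgl_eq_iff) (use assms inv in auto)
qed

lemma invertible_mult_nonzero: "invertible A \<Longrightarrow> v \<noteq> 0 \<Longrightarrow> A *v v \<noteq> 0" for A :: "real ^ 'n::finite ^ 'n"
  by (metis invertible_left_inverse matrix_left_invertible_ker)

text \<open>The preimage of the image is the union of U and - U.\<close>

lemma open_proj_image:
  fixes U :: "(real ^ 'n::finite) set"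
  assumes U: "open U" "0 \<notin> U" and scale: "\<And>v c. v \<in> U \<Longrightarrow> c > 0 \<Longrightarrow> c *\<^sub>R v \<in> U"
  shows "open (abs_proj ` U)"
proof -
  have "{v. v \<noteq> 0 \<and> abs_proj v \<in> abs_proj ` U} = U \<union> uminus ` U"
  proof (intro equalityI subsetI)
    fix v assume "v \<in> {v. v \<noteq> 0 \<and> abs_proj v \<in> abs_proj ` U}"
    then obtain u where u: "v \<noteq> 0" "u \<in> U" "abs_proj v = abs_proj u" by blast
    then have "u \<noteq> 0" using U(2) by blast
    then obtain c where c: "c \<noteq> 0" "v = c *\<^sub>R u" using u abs_proj_eq_iff[of u v] by auto
    show "v \<in> U \<union> uminus ` U"
    proof (cases "c > 0")
      case False
      then have "(- c) *\<^sub>R u \<in> U" using c by (intro scale u) auto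
      then show ?thesis using c(2) by (auto simp: image_iff intro!: bexI[of _ "(- c) *\<^sub>R u"])
    qed (use c u scale in auto)
  next
    fix v assume v: "v \<in> U \<union> uminus ` U"
    then have "v \<noteq> 0" using U(2) by (auto simp: image_iff)
    moreover have "abs_proj (- v) = abs_proj v" using abs_proj_scale[OF \<open>v \<noteq> 0\<close>, of "-1"] by simp
    then have "abs_proj v \<in> abs_proj ` U" using v by (metis UnE imageE image_eqI minus_minus)
    ultimately show "v \<in> {v. v \<noteq> 0 \<and> abs_proj v \<in> abs_proj ` U}" by blast
  qed
  moreover have "open (U \<union> uminus ` U)" using U(1) by (simp add: open_Un open_negations)
  ultimately show ?thesis
    unfolding open_proj_def by (auto simp: openin_open intro!: exI[of _ "U \<union> uminus ` U"])
qed

locale convex_domain =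
  fixes \<Omega> :: "'n::finite proj set"
  assumes domain: "properly_convex_domain \<Omega>"
begin

definition normal :: "real ^ 'n" where
  "normal = (SOME w. adapted_chart \<Omega> w)"

abbreviation pt :: "'n proj \<Rightarrow> real ^ 'n" where
  "pt \<equiv> affine_coord normal"

lemma chart_eq: "chart \<Omega> = pt"
  by (simp add: chart_def normal_def)

lemma adapted: "adapted_chart \<Omega> normal"
  using domain unfolding properly_convex_domain_def normal_def by (metis someI)

text \<open>One half of the preimage of \<Omega>: as \<open>normal\<close> has no zero over the
  closure of \<Omega>, its sign separates v from - v.\<close>

definition cone :: "(real ^ 'n) set" where
  "cone = {v. normal \<bullet> v > 0 \<and> abs_proj v \<in> \<Omega>}"

definition radius :: real where
  "radius = (SOME R. R > 0 \<and> (\<forall>x\<in>pt ` \<Omega>. norm x \<le> R))"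

lemma radius: "radius > 0" "x \<in> pt ` \<Omega> \<Longrightarrow> norm x \<le> radius"
proof -
  have "\<exists>R>0. \<forall>x\<in>pt ` \<Omega>. norm x \<le> R"
    using adapted unfolding adapted_chart_def by (simp add: bounded_pos)
  from someI_ex[OF this[unfolded Bex_def]] show "radius > 0" "x \<in> pt ` \<Omega> \<Longrightarrow> norm x \<le> radius"
    unfolding radius_def by (auto simp: Bex_def)
qed

lemma closure_inner_nonzero: "v \<noteq> 0 \<Longrightarrow> abs_proj v \<in> closure \<Omega> \<Longrightarrow> normal \<bullet> v \<noteq> 0"
proof -
  assume v: "v \<noteq> 0" "abs_proj v \<in> closure \<Omega>"
  then obtain u where u: "abs_proj v = abs_proj u" "normal \<bullet> u \<noteq> 0"
    using adapted unfolding adapted_chart_def affine_chart_def by blast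
  then have "u \<noteq> 0" by auto
  then obtain c where "c \<noteq> 0" "v = c *\<^sub>R u" using u(1) v(1) abs_proj_eq_iff[of u v] by auto
  then show ?thesis using u(2) by simp
qed

lemma cone_nonzero: "v \<in> cone \<Longrightarrow> v \<noteq> 0"
  by (auto simp: cone_def)

lemma pt_abs: "normal \<bullet> v = 1 \<Longrightarrow> pt (abs_proj v) = v"
  by (subst affine_coord_abs) auto

lemma pt_closure:
  assumes "x \<in> closure \<Omega>"
  shows "normal \<bullet> pt x = 1" "abs_proj (pt x) = x" "pt x \<noteq> 0"
proof -
  obtain v where v: "v \<noteq> 0" "x = abs_proj v" by (rule proj_exhaust)
  then have "normal \<bullet> v \<noteq> 0" using closure_inner_nonzero assms by blast
  then show 1: "normal \<bullet> pt x = 1" "abs_proj (pt x) = x"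
    using v by (simp_all add: affine_coord_abs abs_proj_scale)
  then show "pt x \<noteq> 0" by auto
qed

lemma pt_in_cone_iff: "x \<in> closure \<Omega> \<Longrightarrow> pt x \<in> cone \<longleftrightarrow> x \<in> \<Omega>"
  using pt_closure[of x] by (simp add: cone_def)

lemma pt_image: "pt ` \<Omega> = {v \<in> cone. normal \<bullet> v = 1}"
proof (intro equalityI subsetI)
  fix v assume "v \<in> pt ` \<Omega>"
  then obtain x where x: "x \<in> \<Omega>" "v = pt x" by blast
  then have "x \<in> closure \<Omega>" using closure_subset by blast
  then show "v \<in> {v \<in> cone. normal \<bullet> v = 1}" using x pt_in_cone_iff pt_closure by simp
next
  fix v assume v: "v \<in> {v \<in> cone. normal \<bullet> v = 1}"
  then have "v = pt (abs_proj v)" using pt_abs[of v] by simp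
  then show "v \<in> pt ` \<Omega>" using v by (simp add: cone_def)
qed

lemma cone_scale: "v \<in> cone \<Longrightarrow> c > 0 \<Longrightarrow> c *\<^sub>R v \<in> cone"
  using abs_proj_scale[of v c] cone_nonzero[of v] by (auto simp: cone_def)

lemma cone_normalize: "v \<in> cone \<Longrightarrow> (1 / (normal \<bullet> v)) *\<^sub>R v \<in> pt ` \<Omega>"
  using cone_scale[of v "1 / (normal \<bullet> v)"] unfolding pt_image by (simp add: cone_def)

lemma open_cone: "open cone"
proof -
  have "open \<Omega>" using domain by (simp add: properly_convex_domain_def)
  then have "openin (top_of_set (- {0})) {v. v \<noteq> 0 \<and> abs_proj v \<in> \<Omega>}" by (simp add: open_proj_def)
  then have "open {v. v \<noteq> 0 \<and> abs_proj v \<in> \<Omega>}" by (rule openin_open_trans) (simp add: open_Compl)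
  moreover have "open {v. normal \<bullet> v > 0}" by (rule open_halfspace_gt)
  moreover have "cone = {v. v \<noteq> 0 \<and> abs_proj v \<in> \<Omega>} \<inter> {v. normal \<bullet> v > 0}" by (auto simp: cone_def)
  ultimately show ?thesis by (simp add: open_Int)
qed

lemma convex_cone: "convex cone"
proof (rule convexI)
  fix x y :: "real ^ 'n" and s t :: real
  assume x: "x \<in> cone" and y: "y \<in> cone" and st: "0 \<le> s" "0 \<le> t" "s + t = 1"
  \<comment> \<open>p / (p + q) and q / (p + q) are the weights of the same point as a convex
    combination in the chart.\<close>
  define p q where "p = s * (normal \<bullet> x)" and "q = t * (normal \<bullet> y)"
  have pos: "normal \<bullet> x > 0" "normal \<bullet> y > 0" using x y by (auto simp: cone_def)
  have pq: "p \<ge> 0" "q \<ge> 0" "p + q > 0"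
  proof -
    have "s > 0 \<or> t > 0" using st by linarith
    then show "p + q > 0" using pos st unfolding p_def q_def by (auto intro: add_pos_nonneg add_nonneg_pos)
  qed (use pos st in \<open>simp_all add: p_def q_def\<close>)
  have "convex (pt ` \<Omega>)" using adapted by (simp add: adapted_chart_def)
  then have "(p / (p + q)) *\<^sub>R ((1 / (normal \<bullet> x)) *\<^sub>R x) + (q / (p + q)) *\<^sub>R ((1 / (normal \<bullet> y)) *\<^sub>R y) \<in> pt ` \<Omega>"
    using pq by (intro convexD cone_normalize x y) (auto simp flip: add_divide_distrib)
  then have "(p + q) *\<^sub>R ((p / (p + q)) *\<^sub>R ((1 / (normal \<bullet> x)) *\<^sub>R x) + (q / (p + q)) *\<^sub>R ((1 / (normal \<bullet> y)) *\<^sub>R y)) \<in> cone"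
    using pq(3) unfolding pt_image by (intro cone_scale) auto
  then show "s *\<^sub>R x + t *\<^sub>R y \<in> cone"
    using pos pq by (simp add: scaleR_add_right p_def q_def)
qed

sublocale bounded_cone cone normal radius
proof
  show "radius > 0" by (rule radius)
  show "open cone" by (rule open_cone)
  show "convex cone" by (rule convex_cone)
  have "pt ` \<Omega> \<noteq> {}" using domain by (simp add: properly_convex_domain_def)
  then show "cone \<noteq> {}" unfolding pt_image by blast
  show "v \<in> cone \<Longrightarrow> c > 0 \<Longrightarrow> c *\<^sub>R v \<in> cone" for v c by (rule cone_scale)
  fix v assume v: "v \<in> cone"
  have "norm v / (normal \<bullet> v) \<le> radius"
    using radius(2)[OF cone_normalize[OF v]] v by (simp add: cone_def)
  then show "norm v \<le> radius * (normal \<bullet> v)" using v by (simp add: cone_def field_simps)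
qed

text \<open>With the next lemma, K without 0 is the part of the preimage of the closure of \<Omega>
  where \<open>normal\<close> is positive. In both directions an open set around a missing point
  would have to meet the cone or \<Omega>.\<close>

lemma abs_in_closure:
  assumes v: "v \<in> K" "v \<noteq> 0"
  shows "abs_proj v \<in> closure \<Omega>"
proof (rule ccontr)
  assume no: "abs_proj v \<notin> closure \<Omega>"
  define U where "U = {v. v \<noteq> 0 \<and> abs_proj v \<in> - closure \<Omega>}"
  have "open (- closure \<Omega>)" by (rule open_Compl[OF closed_closure])
  then have "openin (top_of_set (- {0})) U" by (simp only: open_proj_def U_def)
  then have "open U" by (rule openin_open_trans) (simp add: open_Compl)
  moreover have "v \<in> U \<inter> K" using v no by (simp add: U_def)
  ultimately have "U \<inter> cone \<noteq> {}" using open_Int_closure_eq_empty by blast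
  then obtain u where "abs_proj u \<notin> closure \<Omega>" "abs_proj u \<in> \<Omega>" by (auto simp: U_def cone_def)
  then show False using closure_subset by blast
qed

lemma closure_abs_in_K:
  assumes v: "abs_proj v \<in> closure \<Omega>" "normal \<bullet> v > 0"
  shows "v \<in> K"
proof (rule ccontr)
  assume no: "v \<notin> K"
  define U where "U = {v. normal \<bullet> v > 0} - K"
  have "open U" unfolding U_def by (intro open_Diff open_halfspace_gt closed_closure)
  moreover have "c *\<^sub>R u \<in> U" if u: "u \<in> U" and c: "c > 0" for u c
  proof -
    have "c *\<^sub>R u \<notin> K"
    proof
      assume "c *\<^sub>R u \<in> K"
      from K_scale[OF this, of "1 / c"] show False using u c by (simp add: U_def)
    qed
    then show ?thesis using u c by (simp add: U_def)
  qed
  moreover have "0 \<notin> U" by (simp add: U_def)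
  ultimately have "open (abs_proj ` U)" by (intro open_proj_image)
  moreover have "abs_proj v \<in> abs_proj ` U \<inter> closure \<Omega>" using v no by (auto simp: U_def)
  ultimately have "abs_proj ` U \<inter> \<Omega> \<noteq> {}" using open_Int_closure_eq_empty by blast
  then obtain u where "u \<in> U" "abs_proj u \<in> \<Omega>" by blast
  then have "u \<in> U" "u \<in> cone" by (auto simp: U_def cone_def)
  then show False using cone_subset by (auto simp: U_def)
qed

lemma pt_in_K: "x \<in> closure \<Omega> \<Longrightarrow> pt x \<in> K"
  using pt_closure[of x] by (intro closure_abs_in_K) auto

lemma frontier_iff: "x \<in> frontier \<Omega> \<longleftrightarrow> x \<in> closure \<Omega> \<and> x \<notin> \<Omega>"
  using domain by (simp add: properly_convex_domain_def frontier_def interior_open)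

lemma pt_inj: "x \<in> closure \<Omega> \<Longrightarrow> y \<in> closure \<Omega> \<Longrightarrow> pt x = pt y \<Longrightarrow> x = y"
  using pt_closure(2) by metis

lemma segment_in_K:
  assumes "x \<in> closure \<Omega>" "y \<in> closure \<Omega>" "v \<in> closed_segment (pt x) (pt y)"
  shows "v \<in> K" "normal \<bullet> v = 1" "abs_proj v \<in> closure \<Omega>"
proof -
  obtain t where t: "0 \<le> t" "t \<le> 1" "v = (1 - t) *\<^sub>R pt x + t *\<^sub>R pt y" using assms(3) by (auto simp: in_segment)
  show "v \<in> K" unfolding t(3) using t assms by (intro K_add K_scale pt_in_K) auto
  moreover show "normal \<bullet> v = 1" unfolding t(3) using pt_closure assms by (simp add: inner_add_right)
  ultimately show "abs_proj v \<in> closure \<Omega>" by (intro abs_in_closure) auto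
qed

lemma proj_closed_segment_eq:
  assumes "x \<in> closure \<Omega>" "y \<in> closure \<Omega>"
  shows "proj_closed_segment \<Omega> x y = abs_proj ` closed_segment (pt x) (pt y)"
proof (intro equalityI subsetI)
  fix z assume "z \<in> proj_closed_segment \<Omega> x y"
  then have "z \<in> closure \<Omega>" "pt z \<in> closed_segment (pt x) (pt y)"
    by (auto simp: proj_closed_segment_def chart_eq)
  then show "z \<in> abs_proj ` closed_segment (pt x) (pt y)" using pt_closure(2)[of z] by force
next
  fix z assume "z \<in> abs_proj ` closed_segment (pt x) (pt y)"
  then obtain v where v: "v \<in> closed_segment (pt x) (pt y)" "z = abs_proj v" by blast
  then show "z \<in> proj_closed_segment \<Omega> x y"
    using segment_in_K[OF assms v(1)] pt_abs[of v] by (simp add: proj_closed_segment_def chart_eq)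
qed

lemma pt_image_closed_segment:
  assumes "x \<in> closure \<Omega>" "y \<in> closure \<Omega>"
  shows "pt ` proj_closed_segment \<Omega> x y = closed_segment (pt x) (pt y)"
  unfolding proj_closed_segment_eq[OF assms] image_image
  using segment_in_K(2)[OF assms] pt_abs by (force simp: image_iff)

end


section \<open>Automorphisms of the domain acting on the cone\<close>

context convex_domain
begin

lemma inner_nonzero: "v \<noteq> 0 \<Longrightarrow> abs_proj v \<in> \<Omega> \<Longrightarrow> normal \<bullet> v \<noteq> 0"
  using closure_inner_nonzero closure_subset by blast

text \<open>A lift preserves the preimage of \<Omega>, which has two halves. If it sent two vectors
  of the cone to different halves, some positive combination of them would land in the hyperplane
  where \<open>normal\<close> vanishes.\<close>

lemma lift_sign:
  assumes A: "is_lift A g" and g: "g \<in> Aut \<Omega>"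
  obtains s where "s \<noteq> 0" "(*v) (s *\<^sub>R A) ` cone = cone"
proof -
  have inv: "invertible A" and gA: "g = abs_pgl A" using A by (auto simp: is_lift_def)
  have g_img: "pgl_act g ` \<Omega> = \<Omega>" using g by (simp add: Aut_def)
  have act: "abs_proj (A *v v) \<in> \<Omega>" "normal \<bullet> (A *v v) \<noteq> 0" if "v \<in> cone" for v
  proof -
    have v: "v \<noteq> 0" "abs_proj v \<in> \<Omega>" using that cone_nonzero by (auto simp: cone_def)
    then have "pgl_act g (abs_proj v) \<in> \<Omega>" using g_img by blast
    then show 1: "abs_proj (A *v v) \<in> \<Omega>" using pgl_act_abs[OF inv v(1)] by (simp add: gA)
    show "normal \<bullet> (A *v v) \<noteq> 0" by (rule inner_nonzero[OF invertible_mult_nonzero[OF inv v(1)] 1])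
  qed
  have same: "\<not> (normal \<bullet> (A *v v) > 0 \<and> normal \<bullet> (A *v u) < 0)" if "v \<in> cone" "u \<in> cone" for u v
  proof
    assume *: "normal \<bullet> (A *v v) > 0 \<and> normal \<bullet> (A *v u) < 0"
    define \<alpha> \<beta> where "\<alpha> = normal \<bullet> (A *v v)" and "\<beta> = - (normal \<bullet> (A *v u))"
    have "\<beta> *\<^sub>R v + \<alpha> *\<^sub>R u \<in> cone"
      using * that by (intro cone_add_K cone_scale cone_subset) (auto simp: \<alpha>_def \<beta>_def)
    from act(2)[OF this] show False
      by (simp add: matrix_vector_mult_diff_distrib matrix_vector_right_distrib matrix_vector_mult_scaleR
          inner_add_right inner_diff_right \<alpha>_def \<beta>_def mult.commute)
  qed
  obtain v0 where v0: "v0 \<in> cone" using cone_nonempty by blast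
  define s :: real where "s = (if normal \<bullet> (A *v v0) > 0 then 1 else - 1)"
  have s: "s \<noteq> 0" by (simp add: s_def)
  have pos: "normal \<bullet> (s *\<^sub>R (A *v v)) > 0" if "v \<in> cone" for v
    using same[OF that v0] same[OF v0 that] act(2)[OF that] act(2)[OF v0] by (auto simp: s_def)
  have into: "s *\<^sub>R (A *v v) \<in> cone" if v: "v \<in> cone" for v
    using pos[OF v] act(1)[OF v] abs_proj_scale[of "A *v v" s] invertible_mult_nonzero[OF inv cone_nonzero[OF v]] s
    by (simp add: cone_def)
  have "u \<in> (*v) (s *\<^sub>R A) ` cone" if u: "u \<in> cone" for u
  proof -
    have "abs_proj u \<in> pgl_act g ` \<Omega>" using u g_img by (simp add: cone_def)
    then obtain x where x: "x \<in> \<Omega>" "abs_proj u = pgl_act g x" by blast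
    then have xc: "x \<in> closure \<Omega>" using closure_subset by blast
    define v where "v = pt x"
    have v: "v \<in> cone" "abs_proj v = x" using pt_in_cone_iff[OF xc] pt_closure[OF xc] x by (auto simp: v_def)
    have "abs_proj u = abs_proj (s *\<^sub>R (A *v v))"
      using x(2) pgl_act_abs[OF inv cone_nonzero[OF v(1)]] v(2)
        abs_proj_scale[of "A *v v" s] invertible_mult_nonzero[OF inv cone_nonzero[OF v(1)]] s by (simp add: gA)
    then obtain c where c: "c \<noteq> 0" "u = c *\<^sub>R (s *\<^sub>R (A *v v))"
      using abs_proj_eq_iff[OF cone_nonzero[OF into[OF v(1)]] cone_nonzero[OF u]] by auto
    have "0 < c * (normal \<bullet> (s *\<^sub>R (A *v v)))" using u unfolding c(2) by (simp add: cone_def)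
    then have "c > 0" using pos[OF v(1)] by (rule zero_less_mult_pos2)
    then have "u = (s *\<^sub>R A) *v (c *\<^sub>R v)"
      by (simp add: c(2) matrix_scaleR_mult_vector matrix_vector_mult_scaleR mult.commute)
    then show ?thesis using cone_scale[OF v(1) \<open>c > 0\<close>] by blast
  qed
  then have "(*v) (s *\<^sub>R A) ` cone = cone" using into by (auto simp: matrix_scaleR_mult_vector)
  then show ?thesis using that s by blast
qed

text \<open>A fixed point has displacement 0, but an infimum of reals lies below its members only if
  they are bounded below. The proof must therefore bound \<open>hilbert_dist\<close> from below for
  all pairs.\<close>

lemma no_fixed_point:
  assumes tl: "translation_length \<Omega> g > 0" and x: "x \<in> \<Omega>"
  shows "pgl_act g x \<noteq> x"
proof
  assume fix_x: "pgl_act g x = x"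
  \<comment> \<open>The value that the description in \<open>hilbert_dist\<close> takes when there
    are no chord endpoints; nothing is known about it except that it is one fixed real.\<close>
  define T where "T = (THE r :: real. False)"
  have bound: "min 0 T \<le> hilbert_dist \<Omega> y z" for y z
  proof (cases "y = z")
    case False
    define ratio where "ratio a b = 1 / 2 * ln ((dist (pt b) (pt y) * dist (pt z) (pt a)) /
                       (dist (pt b) (pt z) * dist (pt y) (pt a)))" for a b
    have hd: "hilbert_dist \<Omega> y z = (THE r. \<exists>a b. chord_endpoints \<Omega> y z a b \<and> r = ratio a b)"
      using False by (simp add: hilbert_dist_def ratio_def chart_eq)
    have ends: "a \<in> closure \<Omega>" "b \<in> closure \<Omega>" "pt y \<in> closed_segment (pt a) (pt z)"
        "pt z \<in> closed_segment (pt y) (pt b)" "y \<in> closure \<Omega>" "z \<in> closure \<Omega>"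
      if "chord_endpoints \<Omega> y z a b" for a b
      using that by (auto simp: chord_endpoints_def frontier_def proj_closed_segment_def chart_eq)
    have unique: "a = a' \<and> b = b'" if 1: "chord_endpoints \<Omega> y z a b" and 2: "chord_endpoints \<Omega> y z a' b'" for a b a' b'
    proof -
      have "proj_closed_segment \<Omega> a b = proj_closed_segment \<Omega> a' b'"
        using 1 2 by (simp add: chord_endpoints_def)
      then have "closed_segment (pt a) (pt b) = closed_segment (pt a') (pt b')"
        using pt_image_closed_segment ends 1 2 by metis
      then have "pt a = pt a' \<and> pt b = pt b' \<or> pt a = pt b' \<and> pt b = pt a'"
        by (auto simp: closed_segment_eq doubleton_eq_iff)
      \<comment> \<open>Exchanged endpoints would place y between z and a, and z between y and
        a.\<close>
      moreover have "\<not> (pt a = pt b' \<and> pt b = pt a')"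
      proof
        assume swap: "pt a = pt b' \<and> pt b = pt a'"
        have "between (pt z, pt a) (pt y)" "between (pt y, pt a) (pt z)"
          using ends(3)[OF 1] ends(4)[OF 2] swap
          by (auto simp: between_mem_segment closed_segment_commute)
        then have "pt y = pt z" by (rule between_antisym)
        then show False using pt_inj ends(5,6)[OF 1] False by blast
      qed
      ultimately show ?thesis using pt_inj ends 1 2 by metis
    qed
    show ?thesis
    proof (cases "\<exists>a b. chord_endpoints \<Omega> y z a b")
      case True
      then obtain a b where ab: "chord_endpoints \<Omega> y z a b" by blast
      have "hilbert_dist \<Omega> y z = ratio a b"
        unfolding hd by (rule the_equality) (use ab unique in blast)+
      moreover have "ratio a b \<ge> 0"
      proof -
        let ?n = "dist (pt b) (pt y) * dist (pt z) (pt a)" and ?d = "dist (pt b) (pt z) * dist (pt y) (pt a)"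
        have "dist (pt b) (pt z) \<le> dist (pt b) (pt y)"
          using dist_in_closed_segment[OF ends(4)[OF ab]]
          by (simp add: dist_commute)
        moreover have "dist (pt y) (pt a) \<le> dist (pt z) (pt a)"
          using dist_in_closed_segment[OF ends(3)[OF ab]] by (simp add: dist_commute)
        ultimately have "?d \<le> ?n" by (intro mult_mono) auto
        then have "?d = 0 \<or> ?n / ?d \<ge> 1" using zero_le_dist[of "pt b" "pt z"] zero_le_dist[of "pt y" "pt a"]
          by (metis mult_nonneg_nonneg le_divide_eq_1_pos order_le_less)
        \<comment> \<open>This includes a zero denominator: the quotient is then 0, and
          \<open>ln 0 = 0\<close>.\<close>
        moreover have "x = 0 \<or> y / x \<ge> 1 \<Longrightarrow> 0 \<le> 1 / 2 * ln (y / x)" for x y :: real by auto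
        ultimately show ?thesis unfolding ratio_def by blast
      qed
      ultimately show ?thesis by simp
    next
      case False
      then have "hilbert_dist \<Omega> y z = T" unfolding hd T_def by simp
      then show ?thesis by simp
    qed
  qed (simp add: hilbert_dist_def)
  have "bdd_below ((\<lambda>x. hilbert_dist \<Omega> x (pgl_act g x)) ` \<Omega>)"
    using bound by (auto simp: bdd_below_def)
  then have "translation_length \<Omega> g \<le> hilbert_dist \<Omega> x (pgl_act g x)"
    unfolding translation_length_def by (rule cINF_lower) (rule x)
  also have "\<dots> = 0" using fix_x by (simp add: hilbert_dist_def)
  finally show False using tl by simp
qed

text \<open>The compact set is turned into an order interval: the lower end comes from an open
  exhaustion of the cone, the upper end from the bounded slice.\<close>

lemma cocompact_group:
  assumes sub: "subgroup \<Gamma> PGL" and aut: "\<Gamma> \<subseteq> Aut \<Omega>" and disc: "discrete \<Gamma>" and coc: "acts_cocompactly \<Gamma> \<Omega>"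
  obtains u e M d where
    "cocompact_cone_group cone normal radius {P. invertible P \<and> abs_pgl P \<in> \<Gamma> \<and> (*v) P ` cone = cone} u e M d"
proof -
  define G where "G = {P. invertible P \<and> abs_pgl P \<in> \<Gamma> \<and> (*v) P ` cone = cone}"
  have one: "pgl_one = abs_pgl (mat 1)" by (simp add: pgl_one_def)
  have inv1: "invertible (mat 1 :: real ^ 'n ^ 'n)" by (auto simp: invertible_def intro!: exI[of _ "mat 1"])
  have one_in: "abs_pgl (mat 1) \<in> \<Gamma>"
    using subgroup.one_closed[OF sub] by (simp add: PGL_def one)
  have mult: "P ** Q \<in> G" if P: "P \<in> G" and Q: "Q \<in> G" for P Q
  proof -
    have "abs_pgl (P ** Q) \<in> \<Gamma>"
      using subgroup.m_closed[OF sub, of "abs_pgl P" "abs_pgl Q"] P Q by (simp add: G_def PGL_def pgl_mult_abs)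
    moreover have "(*v) (P ** Q) ` cone = (*v) P ` ((*v) Q ` cone)"
      by (simp add: image_image matrix_vector_mul_assoc)
    ultimately show ?thesis using P Q by (simp add: G_def invertible_mult)
  qed
  have inverse: "matrix_inv P \<in> G" if P: "P \<in> G" for P
  proof -
    have iP: "invertible P" using P by (simp add: G_def)
    note iI = matrix_inv_matrix_inv(2)[OF iP]
    have "inv\<^bsub>PGL\<^esub> (abs_pgl P) = abs_pgl (matrix_inv P)"
      by (rule group.inv_equality[OF group_PGL])
        (simp_all add: PGL_def pgl_mult_abs iP iI matrix_inv_left one)
    moreover have "inv\<^bsub>PGL\<^esub> (abs_pgl P) \<in> \<Gamma>" using subgroup.m_inv_closed[OF sub] P by (simp add: G_def)
    moreover have "(*v) (matrix_inv P) ` ((*v) P ` cone) = cone"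
      by (simp add: image_image matrix_vector_mul_assoc matrix_inv_left[OF iP])
    then have "(*v) (matrix_inv P) ` cone = cone" using P by (simp add: G_def)
    ultimately show ?thesis using iI by (simp add: G_def)
  qed
  obtain d where d: "d > 0" "\<And>P. P \<in> G \<Longrightarrow> norm (P - mat 1) < d \<Longrightarrow> \<exists>c. P = c *\<^sub>R mat 1"
  proof -
    obtain T where T: "open T" "T \<inter> \<Gamma> = {abs_pgl (mat 1)}"
      using disc one_in unfolding discrete_def isolated_in_def by blast
    then have "openin (top_of_set {A. invertible A}) {A. invertible A \<and> abs_pgl A \<in> T}"
      by (simp add: open_pgl_def)
    then obtain W where W: "open W" "{A. invertible A \<and> abs_pgl A \<in> T} = {A. invertible A} \<inter> W"
      by (auto simp: openin_open)
    then have "mat 1 \<in> W" using inv1 T(2) by blast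
    then obtain d where d: "d > 0" "ball (mat 1) d \<subseteq> W" using W(1) open_contains_ball by blast
    have "\<exists>c. P = c *\<^sub>R mat 1" if P: "P \<in> G" and near: "norm (P - mat 1) < d" for P
    proof -
      have iP: "invertible P" using P by (simp add: G_def)
      have "P \<in> W" using near by (intro subsetD[OF d(2)]) (simp add: dist_norm norm_minus_commute)
      then have "abs_pgl P \<in> T" using W(2) iP by blast
      then have "abs_pgl P \<in> T \<inter> \<Gamma>" using P by (simp add: G_def)
      then have "abs_pgl (mat 1) = abs_pgl P" unfolding T(2) by simp
      then show ?thesis using abs_pgl_eq_iff[OF inv1 iP] by auto
    qed
    then show ?thesis using that d(1) by blast
  qed
  obtain S where S: "S \<subseteq> \<Omega>" "compact S" "(\<Union>g\<in>\<Gamma>. pgl_act g ` S) = \<Omega>"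
    using coc unfolding acts_cocompactly_def by blast
  obtain u where u: "u \<in> cone" using cone_nonempty by blast
  define f where "f n v = v - ((normal \<bullet> v) / real (Suc n)) *\<^sub>R u" for n v
  \<comment> \<open>\<open>U n\<close> holds the vectors that exceed (normal \<bullet> v) / (n + 1)
    times \<open>u\<close>. These sets are open, invariant under positive scaling and increase with
    n to the whole cone, so the compact set lies over one of them.\<close>
  define U where "U n = {v \<in> cone. f n v \<in> cone}" for n
  have mono: "U n \<subseteq> U m" if "n \<le> m" for n m
  proof
    fix v assume v: "v \<in> U n"
    then have wv: "normal \<bullet> v > 0" by (auto simp: U_def cone_def)
    have "f m v = f n v + ((normal \<bullet> v) / real (Suc n) - (normal \<bullet> v) / real (Suc m)) *\<^sub>R u"
      by (simp add: f_def algebra_simps)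
    also have "\<dots> \<in> cone"
      using v wv that by (intro cone_add_K K_scale cone_subset[OF u]) (auto simp: U_def intro!: divide_left_mono)
    finally show "v \<in> U m" using v by (simp add: U_def)
  qed
  have openU: "open (abs_proj ` U n)" for n
  proof (rule open_proj_image)
    have "U n = cone \<inter> f n -` cone" by (auto simp: U_def)
    moreover have "open (f n -` cone)"
      by (rule open_vimage[OF open_cone]) (auto simp: f_def intro!: continuous_intros)
    ultimately show "open (U n)" using open_cone by (simp add: open_Int)
    show "0 \<notin> U n" using zero_notin_cone by (auto simp: U_def)
    fix v c assume v: "v \<in> U n" and c: "(c::real) > 0"
    have "f n (c *\<^sub>R v) = c *\<^sub>R f n v" by (simp add: f_def scaleR_diff_right)
    then show "c *\<^sub>R v \<in> U n" using v c cone_scale by (simp add: U_def)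
  qed
  have "S \<subseteq> (\<Union>n. abs_proj ` U n)"
  proof
    fix x assume "x \<in> S"
    then have x: "x \<in> \<Omega>" "x \<in> closure \<Omega>" using S(1) closure_subset by auto
    have "(\<lambda>n. f n (pt x)) \<longlonglongrightarrow> pt x - (normal \<bullet> pt x * 0) *\<^sub>R u"
      unfolding f_def divide_inverse
      by (intro tendsto_diff tendsto_scaleR tendsto_mult tendsto_const LIMSEQ_inverse_real_of_nat)
    then have "\<forall>\<^sub>F n in sequentially. f n (pt x) \<in> cone"
      using open_cone pt_in_cone_iff[OF x(2)] x(1) by (intro topological_tendstoD) auto
    then obtain n where "f n (pt x) \<in> cone" by (auto simp: eventually_sequentially)
    then have "pt x \<in> U n" using pt_in_cone_iff[OF x(2)] x(1) by (simp add: U_def)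
    then have "x \<in> abs_proj ` U n" using pt_closure(2)[OF x(2)] by (metis imageI)
    then show "x \<in> (\<Union>n. abs_proj ` U n)" by blast
  qed
  then obtain F where F: "finite F" "S \<subseteq> (\<Union>n\<in>F. abs_proj ` U n)"
    using compactE_image[OF S(2), of UNIV "\<lambda>n. abs_proj ` U n"] openU by auto
  define N where "N = Max (insert 0 F)"
  have SU: "S \<subseteq> abs_proj ` U N"
  proof
    fix x assume "x \<in> S"
    then obtain n where n: "n \<in> F" "x \<in> abs_proj ` U n" using F(2) by blast
    then have "n \<le> N" using F(1) by (simp add: N_def)
    then show "x \<in> abs_proj ` U N" using mono n(2) by blast
  qed
  \<comment> \<open>The representatives \<open>k\<close> are normalized by
    \<open>normal \<bullet> k = 1\<close>, so membership in \<open>U N\<close> reads k >= u / (N +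
    1).\<close>
  define e where "e = 1 / real (Suc N)"
  obtain t where t: "t > 0" "\<And>v. (t * norm v) *\<^sub>R u + v \<in> K" using order_unit[OF u] by blast
  have "cocompact_cone_group cone normal radius G u e (t * radius) d"
  proof unfold_locales
    show "invertible P" "(*v) P ` cone = cone" if "P \<in> G" for P using that by (auto simp: G_def)
    show "P ** Q \<in> G" if "P \<in> G" "Q \<in> G" for P Q using mult that by blast
    show "matrix_inv P \<in> G" if "P \<in> G" for P using inverse that by blast
    show "u \<in> cone" "0 < e" "0 < t * radius" "0 < d" using u t radius d by (simp_all add: e_def)
    show "\<exists>c. P = c *\<^sub>R mat 1" if "P \<in> G" "norm (P - mat 1) < d" for P using d(2) that by blast
    fix x assume x: "x \<in> cone"
    then have "abs_proj x \<in> (\<Union>g\<in>\<Gamma>. pgl_act g ` S)" using S(3) by (simp add: cone_def)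
    then obtain g v where g: "g \<in> \<Gamma>" and v: "v \<in> U N" "abs_proj x = pgl_act g (abs_proj v)" using SU by blast
    obtain A where A: "is_lift A g" using pgl_exhaust[of g] by (auto simp: is_lift_def)
    obtain s where s: "s \<noteq> 0" "(*v) (s *\<^sub>R A) ` cone = cone" using lift_sign[OF A] g aut by blast
    define B where "B = s *\<^sub>R A"
    have B: "invertible B" "abs_pgl B = g" "(*v) B ` cone = cone"
      using A s abs_pgl_scale[of A s] by (auto simp: is_lift_def B_def)
    have vC: "v \<in> cone" using v by (simp add: U_def)
    have wv: "normal \<bullet> v > 0" using vC by (simp add: cone_def)
    define k where "k = (1 / (normal \<bullet> v)) *\<^sub>R v"
    have kC: "k \<in> cone" unfolding k_def using vC wv by (intro cone_scale) auto
    have wk: "normal \<bullet> k = 1" using wv by (simp add: k_def)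
    have BkC: "B *v k \<in> cone" using kC B(3) by blast
    have "abs_proj (B *v k) = abs_proj x"
      using v(2) pgl_act_abs[OF B(1) cone_nonzero[OF kC]] B(2) abs_proj_scale[OF cone_nonzero[OF vC], of "1 / (normal \<bullet> v)"] wv
      by (simp add: k_def)
    then obtain c where c: "c \<noteq> 0" "x = c *\<^sub>R (B *v k)"
      using abs_proj_eq_iff[OF cone_nonzero[OF BkC] cone_nonzero[OF x]] by blast
    have c_pos: "c > 0" using x BkC unfolding c(2) by (auto simp: cone_def zero_less_mult_iff)
    \<comment> \<open>The factor \<open>c\<close> turns the projective equality into P k = x; a
      positive multiple of a lift still belongs to G.\<close>
    have "(*v) (c *\<^sub>R B) ` cone = cone"
    proof (intro equalityI subsetI)
      fix y assume "y \<in> (*v) (c *\<^sub>R B) ` cone"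
      then show "y \<in> cone" using B(3) cone_scale c_pos by (auto simp: matrix_scaleR_mult_vector)
    next
      fix y assume "y \<in> cone"
      then have "(1 / c) *\<^sub>R y \<in> (*v) B ` cone" using B(3) cone_scale c_pos by simp
      then obtain y' where y': "y' \<in> cone" "(1 / c) *\<^sub>R y = B *v y'" by blast
      have "y = c *\<^sub>R ((1 / c) *\<^sub>R y)" using c_pos by simp
      then have "y = (c *\<^sub>R B) *v y'" unfolding y'(2) by (simp add: matrix_scaleR_mult_vector)
      then show "y \<in> (*v) (c *\<^sub>R B) ` cone" using y'(1) by blast
    qed
    then have "c *\<^sub>R B \<in> G" using abs_pgl_scale[OF B(1) c(1)] B(2) g by (simp add: G_def)
    moreover have "(c *\<^sub>R B) *v k = x" by (simp add: c(2) matrix_scaleR_mult_vector)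
    moreover have "k - e *\<^sub>R u \<in> K"
    proof -
      have "k - e *\<^sub>R u = (1 / (normal \<bullet> v)) *\<^sub>R f N v"
        using wv by (simp add: k_def f_def e_def scaleR_diff_right)
      then show ?thesis using v(1) wv by (auto simp: U_def intro!: cone_subset cone_scale)
    qed
    \<comment> \<open>The normalized \<open>k\<close> has norm at most \<open>radius\<close>, and
      \<open>t\<close> converts norms into multiples of \<open>u\<close>.\<close>
    moreover have "(t * radius) *\<^sub>R u - k \<in> K"
    proof -
      have "norm k \<le> radius" using cone_bounded[OF kC] wk by simp
      then have "(t * (radius - norm k)) *\<^sub>R u \<in> K"
        using t(1) by (intro K_scale cone_subset[OF u]) simp
      moreover have "(t * norm k) *\<^sub>R u + (- k) \<in> K" using t(2)[of "- k"] by simp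
      ultimately have "((t * norm k) *\<^sub>R u + (- k)) + (t * (radius - norm k)) *\<^sub>R u \<in> K"
        by (rule K_add[rotated])
      also have "((t * norm k) *\<^sub>R u + (- k)) + (t * (radius - norm k)) *\<^sub>R u = (t * radius) *\<^sub>R u - k"
        by (simp add: algebra_simps)
      finally show ?thesis .
    qed
    ultimately show "\<exists>P\<in>G. \<exists>k. P *v k = x \<and> k - e *\<^sub>R u \<in> K \<and> (t * radius) *\<^sub>R u - k \<in> K" by blast
  qed
  then show ?thesis using that unfolding G_def by blast
qed

end


section \<open>Biproximality read on the two quotients\<close>

lemma other_eigenvalue_scaleR:
  assumes c: "c \<noteq> 0"
  shows "other_eigenvalue (c *\<^sub>R A) a x \<longleftrightarrow> other_eigenvalue A a (x / complex_of_real c)"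
proof -
  have mult: "complex_matrix (c *\<^sub>R A) *v v = complex_of_real c *s (complex_matrix A *v v)" for v
    by (simp add: complex_matrix_def matrix_vector_mult_def vec_eq_iff sum_distrib_left mult.assoc)
  show ?thesis
    unfolding quotient_eigenvalue_def
  proof (intro iffI; elim exE conjE)
    fix v r assume v: "\<forall>t. v \<noteq> t *s complex_vector a"
      and eq: "complex_matrix (c *\<^sub>R A) *v v = x *s v + r *s complex_vector a"
    have "complex_matrix A *v v = (x / complex_of_real c) *s v + (r / complex_of_real c) *s complex_vector a"
      using eq c unfolding mult by (simp add: vec_eq_iff field_simps)
    then show "\<exists>v r. (\<forall>t. v \<noteq> t *s complex_vector a) \<and>
        complex_matrix A *v v = (x / complex_of_real c) *s v + r *s complex_vector a"
      using v by blast
  next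
    fix v r assume v: "\<forall>t. v \<noteq> t *s complex_vector a"
      and eq: "complex_matrix A *v v = (x / complex_of_real c) *s v + r *s complex_vector a"
    have "complex_matrix (c *\<^sub>R A) *v v = x *s v + (complex_of_real c * r) *s complex_vector a"
      using c unfolding mult eq by (simp add: vec_eq_iff field_simps)
    then show "\<exists>v r. (\<forall>t. v \<noteq> t *s complex_vector a) \<and>
        complex_matrix (c *\<^sub>R A) *v v = x *s v + r *s complex_vector a"
      using v by blast
  qed
qed

context hyperbolic_cone_map
begin

lemma biproximal_moduli_iff:
  assumes c: "c \<noteq> 0" and card: "CARD('n) \<ge> 2"
  defines "m \<equiv> eigenvalue_moduli (c *\<^sub>R A)"
  shows "m ! 0 > m ! 1 \<and> m ! (CARD('n) - 2) > m ! (CARD('n) - 1) \<longleftrightarrow>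
    (\<forall>x. other_eigenvalue A a x \<longrightarrow> cmod x < p) \<and> (\<forall>x. other_eigenvalue A b x \<longrightarrow> q < cmod x)"
proof -
  have inv: "invertible (c *\<^sub>R A)" using abs_pgl_scale(2)[OF invertible_A c] .
  have a: "(c *\<^sub>R A) *v a = (c * p) *\<^sub>R a" and b: "(c *\<^sub>R A) *v b = (c * q) *\<^sub>R b"
    by (simp_all add: matrix_scaleR_mult_vector A_a A_b)
  have abs: "\<bar>c * p\<bar> = \<bar>c\<bar> * p" "\<bar>c * q\<bar> = \<bar>c\<bar> * q" using p_pos q_pos by (simp_all add: abs_mult)
  have lt: "cmod x < \<bar>c\<bar> * p \<longleftrightarrow> cmod (x / complex_of_real c) < p"
    and le: "cmod x \<le> \<bar>c\<bar> * p \<longleftrightarrow> cmod (x / complex_of_real c) \<le> p"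
    and gt: "\<bar>c\<bar> * q < cmod x \<longleftrightarrow> q < cmod (x / complex_of_real c)"
    and ge: "\<bar>c\<bar> * q \<le> cmod x \<longleftrightarrow> q \<le> cmod (x / complex_of_real c)" for x
    using c by (simp_all add: norm_divide field_simps)
  have all: "(\<forall>x. P (x / complex_of_real c)) \<longleftrightarrow> (\<forall>x. P x)" for P
    using c by (metis nonzero_mult_div_cancel_right of_real_eq_0_iff)
  have "m ! 0 > m ! 1 \<longleftrightarrow> (\<forall>x. other_eigenvalue (c *\<^sub>R A) a x \<longrightarrow> cmod x < \<bar>c * p\<bar>)"
    unfolding m_def
    by (rule eigenvalue_moduli_top[OF inv a a_nonzero card])
      (simp add: other_eigenvalue_scaleR[OF c] abs le other_eigenvalue_le)
  also have "\<dots> \<longleftrightarrow> (\<forall>x. other_eigenvalue A a x \<longrightarrow> cmod x < p)"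
    unfolding other_eigenvalue_scaleR[OF c] abs lt by (rule all)
  finally have top: "m ! 0 > m ! 1 \<longleftrightarrow> (\<forall>x. other_eigenvalue A a x \<longrightarrow> cmod x < p)" .
  have "m ! (CARD('n) - 2) > m ! (CARD('n) - 1) \<longleftrightarrow>
      (\<forall>x. other_eigenvalue (c *\<^sub>R A) b x \<longrightarrow> \<bar>c * q\<bar> < cmod x)"
    unfolding m_def
    by (rule eigenvalue_moduli_bottom[OF inv b b_nonzero card])
      (simp add: other_eigenvalue_scaleR[OF c] abs ge other_eigenvalue_ge)
  also have "\<dots> \<longleftrightarrow> (\<forall>x. other_eigenvalue A b x \<longrightarrow> q < cmod x)"
    unfolding other_eigenvalue_scaleR[OF c] abs gt by (rule all)
  finally show ?thesis using top by blast
qed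

text \<open>\<open>biproximal\<close> asks for some lift. All lifts are nonzero multiples of A, and
  the criterion for c A does not depend on c.\<close>

lemma biproximal_iff:
  assumes A: "is_lift A g" and card: "CARD('n) \<ge> 2"
  shows "biproximal g \<longleftrightarrow> (\<forall>x. other_eigenvalue A a x \<longrightarrow> cmod x < p) \<and>
    (\<forall>x. other_eigenvalue (matrix_inv A) b x \<longrightarrow> cmod x < 1 / q)"
proof -
  define Q where "Q B \<longleftrightarrow> (let m = eigenvalue_moduli B; N = CARD('n)
      in m ! 0 > m ! 1 \<and> m ! (N - 2) > m ! (N - 1))" for B :: "real ^ 'n ^ 'n"
  have lift: "is_lift B g \<longleftrightarrow> (\<exists>c. c \<noteq> 0 \<and> B = c *\<^sub>R A)" for B
    using A abs_pgl_eq_iff[of A B] abs_pgl_scale[OF invertible_A] unfolding is_lift_def by metis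
  have "biproximal g \<longleftrightarrow> (\<exists>B. is_lift B g \<and> Q B)" by (simp add: biproximal_def Q_def)
  also have "\<dots> \<longleftrightarrow> (\<exists>c. c \<noteq> 0 \<and> Q (c *\<^sub>R A))" unfolding lift by blast
  also have "\<dots> \<longleftrightarrow> (\<forall>x. other_eigenvalue A a x \<longrightarrow> cmod x < p) \<and> (\<forall>x. other_eigenvalue A b x \<longrightarrow> q < cmod x)"
    unfolding Q_def Let_def using biproximal_moduli_iff[OF _ card] by (metis zero_neq_one)
  finally show ?thesis unfolding proximal_inverse_iff .
qed

lemma half_triangle_of_not_biproximal:
  assumes A: "is_lift A g" and card: "CARD('n) \<ge> 2" and "\<not> biproximal g"
  obtains z where "z \<in> K" "z \<noteq> 0" "z + a \<notin> C" "z + b \<notin> C"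
proof -
  interpret h': hyperbolic_cone_map C w R "matrix_inv A" b a "1 / q" "1 / p" by (rule hyperbolic_inverse)
  consider x where "other_eigenvalue A a x" "p \<le> cmod x"
    | x where "other_eigenvalue (matrix_inv A) b x" "1 / q \<le> cmod x"
    using assms(3) unfolding biproximal_iff[OF A card] by force
  then show ?thesis
    using nonproximal_half_triangle h'.nonproximal_half_triangle that by cases metis+
qed

end

section \<open>Axes and half triangles in terms of the cone\<close>

context convex_domain
begin

text \<open>K meets the plane V in the quadrant spanned by the endpoints, and a lift permutes its
  two boundary rays. If it exchanged them, or scaled both equally, it would fix a point of the axis,
  against the positive translation length.\<close>

lemma axis_hyperbolic:
  assumes axis: "is_axis \<Omega> g l" and g: "g \<in> Aut \<Omega>" and tl: "translation_length \<Omega> g > 0"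
    and ab: "a \<in> closure \<Omega>" "b \<in> closure \<Omega>" "a \<noteq> b" "l = proj_open_segment \<Omega> a b"
  obtains A p q where "is_lift A g" "CARD('n) \<ge> 2" "a \<in> frontier \<Omega>" "b \<in> frontier \<Omega>" "l \<subseteq> \<Omega>"
    "hyperbolic_cone_map cone normal radius A (pt a) (pt b) p q \<or>
     hyperbolic_cone_map cone normal radius A (pt b) (pt a) p q"
proof -
  obtain V A0 where V: "subspace V" "dim V = 2" "is_lift A0 g" "(*v) A0 ` V = V" "l = proj_space V \<inter> \<Omega>"
    using axis unfolding is_axis_def by blast
  have card: "CARD('n) \<ge> 2" using dim_subset_UNIV_cart[of V] V(2) by simp
  let ?a = "pt a" and ?b = "pt b"
  note ptab = pt_closure[OF ab(1)] pt_closure[OF ab(2)]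
  have ne: "?a \<noteq> ?b" using pt_inj ab by blast
  have in_l: "abs_proj ((1 - t) *\<^sub>R ?a + t *\<^sub>R ?b) \<in> l" if t: "0 < t" "t < 1" for t
  proof -
    let ?v = "(1 - t) *\<^sub>R ?a + t *\<^sub>R ?b"
    have seg: "?v \<in> closed_segment ?a ?b" unfolding in_segment by (intro exI[of _ t]) (use t in auto)
    have w1: "normal \<bullet> ?v = 1" using ptab by (simp add: inner_add_right)
    have "?v \<noteq> ?a" "?v \<noteq> ?b"
    proof -
      have "?v - ?a = t *\<^sub>R (?b - ?a)" "?v - ?b = (1 - t) *\<^sub>R (?a - ?b)" by (simp_all add: algebra_simps)
      then show "?v \<noteq> ?a" "?v \<noteq> ?b" using t ne by auto
    qed
    then have "abs_proj ?v \<noteq> a" "abs_proj ?v \<noteq> b" using pt_abs[OF w1] by auto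
    then show ?thesis
      using seg unfolding ab(4) proj_open_segment_def proj_closed_segment_eq[OF ab(1,2)] by auto
  qed
  have in_V: "v \<in> V" if v: "abs_proj v \<in> l" "v \<noteq> 0" for v
  proof -
    obtain u where u: "u \<in> V" "u \<noteq> 0" "abs_proj u = abs_proj v"
      using v V(5) by (auto simp: proj_space_def)
    then obtain c where "v = c *\<^sub>R u" using abs_proj_eq_iff[of u v] v(2) by auto
    then show ?thesis using subspace_scale[OF V(1) u(1)] by simp
  qed
  have comb: "(1 - t) *\<^sub>R ?a + t *\<^sub>R ?b \<in> V \<inter> cone" if t: "0 < t" "t < 1" for t
  proof -
    have w1: "normal \<bullet> ((1 - t) *\<^sub>R ?a + t *\<^sub>R ?b) = 1" using ptab by (simp add: inner_add_right)
    then have "(1 - t) *\<^sub>R ?a + t *\<^sub>R ?b \<noteq> 0" by (metis inner_zero_right zero_neq_one)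
    from in_V[OF in_l[OF t] this] show ?thesis using in_l[OF t] V(5) w1 by (simp add: cone_def)
  qed
  \<comment> \<open>Only interior points of the segment are known to lie over the axis; the
    endpoints are extrapolated from the points at one and two thirds.\<close>
  have "2 *\<^sub>R ((1 - 1/3) *\<^sub>R ?a + (1/3) *\<^sub>R ?b) - ((1 - 2/3) *\<^sub>R ?a + (2/3) *\<^sub>R ?b) \<in> V"
    using comb[of "1/3"] comb[of "2/3"] by (intro subspace_diff subspace_scale V(1)) auto
  also have "2 *\<^sub>R ((1 - 1/3) *\<^sub>R ?a + (1/3) *\<^sub>R ?b) - ((1 - 2/3) *\<^sub>R ?a + (2/3) *\<^sub>R ?b) = ?a"
    by (simp add: algebra_simps flip: scaleR_add_left scaleR_diff_left)
  finally have aV: "?a \<in> V" .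
  have "2 *\<^sub>R ((1 - 2/3) *\<^sub>R ?a + (2/3) *\<^sub>R ?b) - ((1 - 1/3) *\<^sub>R ?a + (1/3) *\<^sub>R ?b) \<in> V"
    using comb[of "1/3"] comb[of "2/3"] by (intro subspace_diff subspace_scale V(1)) auto
  also have "2 *\<^sub>R ((1 - 2/3) *\<^sub>R ?a + (2/3) *\<^sub>R ?b) - ((1 - 1/3) *\<^sub>R ?a + (1/3) *\<^sub>R ?b) = ?b"
    by (simp add: algebra_simps flip: scaleR_add_left scaleR_diff_left)
  finally have bV: "?b \<in> V" .
  have sum_C: "?a + ?b \<in> cone"
    using comb[of "1/2"] cone_scale[of "(1/2) *\<^sub>R ?a + (1/2) *\<^sub>R ?b" 2] by (simp add: scaleR_add_right)
  \<comment> \<open>An endpoint inside \<Omega> would belong to the intersection of \<Omega> with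
    the line, hence to the open segment, which omits its endpoints.\<close>
  have outside: "c \<notin> \<Omega>" if "c \<in> {a, b}" for c
  proof
    assume c: "c \<in> \<Omega>"
    have "c \<in> proj_space V"
      using that aV bV ptab unfolding proj_space_def by (auto intro: exI[of _ ?a] exI[of _ ?b])
    then have "c \<in> l" using c V(5) by blast
    then show False using that ab(4) by (auto simp: proj_open_segment_def)
  qed
  have a_out: "?a \<notin> cone" and b_out: "?b \<notin> cone" using outside pt_in_cone_iff ab by auto
  have fr: "a \<in> frontier \<Omega>" "b \<in> frontier \<Omega>" using frontier_iff ab outside by auto
  have aK: "?a \<in> K" and bK: "?b \<in> K" using pt_in_K ab by auto
  have indep: "s = 0 \<and> t = 0" if "s *\<^sub>R ?a + t *\<^sub>R ?b = 0" for s t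
  proof -
    have "normal \<bullet> (s *\<^sub>R ?a + t *\<^sub>R ?b) = 0" using that by simp
    then have st: "t = - s" using ptab by (simp add: inner_add_right)
    have "s *\<^sub>R (?a - ?b) = 0" using that by (simp add: st algebra_simps)
    then show ?thesis using ne st by simp
  qed
  have V_eq: "V = span {?a, ?b}"
  proof -
    have "independent {?a, ?b}"
    proof -
      have "\<not> dependent {?b}" using ptab by (simp add: dependent_single)
      moreover have "?a \<notin> span {?b}"
      proof
        assume "?a \<in> span {?b}"
        then obtain k where "?a = k *\<^sub>R ?b" by (auto simp: span_singleton)
        then have "1 *\<^sub>R ?a + (- k) *\<^sub>R ?b = 0" by simp
        from indep[OF this] show False by simp
      qed
      ultimately show ?thesis using ne by (simp add: independent_insert)
    qed
    then have "dim (span {?a, ?b}) = 2" using ne by (simp add: dim_span dim_eq_card_independent)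
    moreover have "span {?a, ?b} \<subseteq> V" using aV bV V(1) by (intro span_minimal) auto
    ultimately show ?thesis using subspace_dim_equal[OF subspace_span V(1)] V(2) by (metis order_refl)
  qed
  have coords: "\<exists>s t. v = s *\<^sub>R ?a + t *\<^sub>R ?b" if vV: "v \<in> V" for v
  proof -
    obtain s where "v - s *\<^sub>R ?a \<in> span {?b}" using vV unfolding V_eq span_insert[of ?a] by blast
    then obtain t where "v - s *\<^sub>R ?a = t *\<^sub>R ?b" by (auto simp: span_singleton)
    then have "v = s *\<^sub>R ?a + t *\<^sub>R ?b" by (simp add: algebra_simps)
    then show ?thesis by blast
  qed
  \<comment> \<open>With s < 0, adding - s times the interior vector x + y cancels x and puts a
    multiple of the boundary vector y into the cone.\<close>
  have nonneg_fst: "s \<ge> 0" if v: "s *\<^sub>R x + t *\<^sub>R y \<in> K" and y: "y \<in> K" "y \<notin> cone" "normal \<bullet> y = 1" and x: "normal \<bullet> x = 1" "x + y \<in> cone" for s t x y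
  proof (rule ccontr)
    assume s: "\<not> s \<ge> 0"
    have "(- s) *\<^sub>R (x + y) + (s *\<^sub>R x + t *\<^sub>R y) \<in> cone"
      by (rule cone_add_K[OF cone_scale[OF x(2)] v]) (use s in simp)
    also have "(- s) *\<^sub>R (x + y) + (s *\<^sub>R x + t *\<^sub>R y) = (t - s) *\<^sub>R y" by (simp add: algebra_simps)
    finally have C: "(t - s) *\<^sub>R y \<in> cone" .
    then have "t - s > 0" using y(3) by (simp add: cone_def)
    then show False using cone_scale[OF C, of "1 / (t - s)"] y(2) by simp
  qed
  have pos_in_C: "s *\<^sub>R ?a + t *\<^sub>R ?b \<in> cone" if st: "s > 0" "t > 0" for s t
  proof -
    define m where "m = min s t"
    have m: "m > 0" "m \<le> s" "m \<le> t" using st by (auto simp: m_def)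
    have "m *\<^sub>R (?a + ?b) + ((s - m) *\<^sub>R ?a + (t - m) *\<^sub>R ?b) \<in> cone"
      by (rule cone_add_K[OF cone_scale[OF sum_C]]) (use m in \<open>auto intro!: K_add K_scale aK bK\<close>)
    then show ?thesis by (simp add: algebra_simps)
  qed
  obtain s0 where s0: "s0 \<noteq> 0" "(*v) (s0 *\<^sub>R A0) ` cone = cone" using lift_sign[OF V(3) g] .
  define A where "A = s0 *\<^sub>R A0"
  have A_inv: "invertible A" and A_lift: "is_lift A g" and A_cone: "(*v) A ` cone = cone"
    using V(3) s0 abs_pgl_scale[of A0 s0] by (auto simp: is_lift_def A_def)
  have A_V: "A *v v \<in> V" if "v \<in> V" for v
    using that V(4) subspace_scale[OF V(1)] unfolding A_def matrix_scaleR_mult_vector by blast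
  have A_K: "A *v v \<in> K" if "v \<in> K" for v
    using matrix_maps_K[of A v] A_cone cone_subset that by blast
  have A_out: "A *v v \<notin> cone" if "v \<notin> cone" for v
  proof
    assume "A *v v \<in> cone"
    then obtain u where "u \<in> cone" "A *v v = A *v u" using A_cone by (metis imageE)
    then show False using that A_inv by (metis inj_matrix_vector_mult injD)
  qed
  have ray: "(\<exists>s>0. A *v v = s *\<^sub>R ?a) \<or> (\<exists>t>0. A *v v = t *\<^sub>R ?b)" if v: "v \<in> V" "v \<in> K" "v \<notin> cone" "v \<noteq> 0" for v
  proof -
    obtain s t where st: "A *v v = s *\<^sub>R ?a + t *\<^sub>R ?b" using coords[OF A_V[OF v(1)]] by blast
    have "s *\<^sub>R ?a + t *\<^sub>R ?b \<in> K" using A_K[OF v(2)] st by simp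
    then have nn: "s \<ge> 0" "t \<ge> 0"
      using nonneg_fst[of s ?a t ?b] nonneg_fst[of t ?b s ?a] aK bK a_out b_out ptab sum_C
      by (auto simp: add.commute)
    have "\<not> (s > 0 \<and> t > 0)" using pos_in_C A_out[OF v(3)] st by metis
    moreover have "s \<noteq> 0 \<or> t \<noteq> 0" using st invertible_mult_nonzero[OF A_inv v(4)] by auto
    ultimately have "s > 0 \<and> t = 0 \<or> s = 0 \<and> t > 0" using nn by linarith
    then show ?thesis using st by auto
  qed
  have no_fix: "\<not> (A *v (s *\<^sub>R ?a + t *\<^sub>R ?b) = r *\<^sub>R (s *\<^sub>R ?a + t *\<^sub>R ?b))" if "s > 0" "t > 0" "r > 0" for s t r
  proof
    assume eq: "A *v (s *\<^sub>R ?a + t *\<^sub>R ?b) = r *\<^sub>R (s *\<^sub>R ?a + t *\<^sub>R ?b)"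
    have C: "s *\<^sub>R ?a + t *\<^sub>R ?b \<in> cone" using pos_in_C that by blast
    have "pgl_act g (abs_proj (s *\<^sub>R ?a + t *\<^sub>R ?b)) = abs_proj (r *\<^sub>R (s *\<^sub>R ?a + t *\<^sub>R ?b))"
      using pgl_act_abs[OF A_inv cone_nonzero[OF C]] A_lift eq by (simp add: is_lift_def)
    also have "\<dots> = abs_proj (s *\<^sub>R ?a + t *\<^sub>R ?b)" using abs_proj_scale[OF cone_nonzero[OF C]] that by simp
    finally show False using no_fixed_point[OF tl] C by (simp add: cone_def)
  qed
  have nz: "?a \<noteq> 0" "?b \<noteq> 0" using ptab by auto
  have inj: "v = u" if "A *v v = A *v u" for v u
    using that A_inv by (metis inj_matrix_vector_mult injD)
  have same_ray: False if "s > 0" "t > 0" "x \<in> {?a, ?b}" "A *v ?a = s *\<^sub>R x" "A *v ?b = t *\<^sub>R x" for s t x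
  proof -
    have "A *v (t *\<^sub>R ?a) = A *v (s *\<^sub>R ?b)"
      using that by (simp add: matrix_vector_mult_scaleR mult.commute)
    then have "t *\<^sub>R ?a + (- s) *\<^sub>R ?b = 0" using inj by fastforce
    from indep[OF this] show False using that by simp
  qed
  consider (diag) s t where "s > 0" "t > 0" "A *v ?a = s *\<^sub>R ?a" "A *v ?b = t *\<^sub>R ?b"
    | (swap) s t where "s > 0" "t > 0" "A *v ?a = s *\<^sub>R ?b" "A *v ?b = t *\<^sub>R ?a"
    using ray[OF aV aK a_out nz(1)] ray[OF bV bK b_out nz(2)] same_ray by blast
  then have "\<exists>p q. hyperbolic_cone_map cone normal radius A ?a ?b p q \<or> hyperbolic_cone_map cone normal radius A ?b ?a p q"
  proof cases
    case diag
    have hyp: "hyperbolic_cone_map cone normal radius A x y p q"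
      if "x \<in> K" "y \<in> K" "x \<noteq> 0" "y \<noteq> 0" "x + y \<in> cone" "A *v x = p *\<^sub>R x" "A *v y = q *\<^sub>R y" "0 < q" "q < p" for x y p q
      by unfold_locales (use that A_inv A_cone in auto)
    have "s \<noteq> t" using no_fix[of 1 1 s] diag by (auto simp: matrix_vector_right_distrib scaleR_add_right)
    then consider "t < s" | "s < t" by linarith
    then show ?thesis
    proof cases
      case 1
      then show ?thesis using hyp[of ?a ?b s t] aK bK nz sum_C diag by blast
    next
      case 2
      then show ?thesis using hyp[of ?b ?a t s] aK bK nz sum_C diag by (metis add.commute)
    qed
  next
    case swap
    \<comment> \<open>An exchange of the rays has the positive eigenvector sqrt t a + sqrt s b, with
      eigenvalue sqrt (s t).\<close>
    define \<sigma> \<tau> where "\<sigma> = sqrt s" and "\<tau> = sqrt t"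
    have pos: "\<sigma> > 0" "\<tau> > 0" using swap by (simp_all add: \<sigma>_def \<tau>_def)
    have st: "A *v ?a = (\<sigma> * \<sigma>) *\<^sub>R ?b" "A *v ?b = (\<tau> * \<tau>) *\<^sub>R ?a"
      using swap by (simp_all add: \<sigma>_def \<tau>_def)
    have "A *v (\<tau> *\<^sub>R ?a + \<sigma> *\<^sub>R ?b) = (\<sigma> * \<tau>) *\<^sub>R (\<tau> *\<^sub>R ?a + \<sigma> *\<^sub>R ?b)"
      by (simp add: matrix_vector_right_distrib matrix_vector_mult_scaleR st scaleR_add_right
          add.commute mult_ac)
    then have False using no_fix[of \<tau> \<sigma> "\<sigma> * \<tau>"] pos by simp
    then show ?thesis ..
  qed
  then show ?thesis using that[OF A_lift card fr] V(5) by blast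
qed

lemma in_half_triangleI:
  assumes ab: "a \<in> frontier \<Omega>" "b \<in> frontier \<Omega>" "l = proj_open_segment \<Omega> a b" "l \<subseteq> \<Omega>"
    and z: "z \<in> K" "z \<noteq> 0" "z + pt a \<notin> cone" "z + pt b \<notin> cone"
  shows "in_half_triangle \<Omega> l"
proof -
  have cl: "a \<in> closure \<Omega>" "b \<in> closure \<Omega>" using ab frontier_iff by auto
  define r where "r = normal \<bullet> z"
  have r: "r > 0" unfolding r_def by (rule K_inner_pos[OF z(1,2)])
  define x where "x = abs_proj z"
  have x: "x \<in> closure \<Omega>" unfolding x_def by (rule abs_in_closure[OF z(1,2)])
  have ptx: "pt x = (1 / r) *\<^sub>R z" unfolding x_def r_def by (rule affine_coord_abs[OF z(2)])
  have out: "s *\<^sub>R pt c + t *\<^sub>R z \<notin> cone" if c: "c \<in> closure \<Omega>" "z + pt c \<notin> cone" and st: "s \<ge> 0" "t \<ge> 0" for s t c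
  proof
    assume C: "s *\<^sub>R pt c + t *\<^sub>R z \<in> cone"
    \<comment> \<open>Completing both coefficients to s + t adds a vector of K and yields m (z + c),
      so one missing sum excludes every nonnegative combination.\<close>
    define m where "m = s + t"
    have "m > 0"
    proof (rule ccontr)
      assume "\<not> m > 0"
      then have "s = 0" "t = 0" using st unfolding m_def by linarith+
      then show False using C zero_notin_cone by simp
    qed
    have "(m - s) *\<^sub>R pt c + (m - t) *\<^sub>R z \<in> K"
      using st c z by (intro K_add K_scale pt_in_K) (auto simp: m_def)
    from cone_add_K[OF C this]
    have "(s *\<^sub>R pt c + t *\<^sub>R z) + ((m - s) *\<^sub>R pt c + (m - t) *\<^sub>R z) \<in> cone" .
    then have C: "m *\<^sub>R (z + pt c) \<in> cone" by (simp add: algebra_simps)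
    show False using cone_scale[OF C, of "1 / m"] \<open>m > 0\<close> c(2) by simp
  qed
  have seg: "proj_closed_segment \<Omega> c x \<subseteq> frontier \<Omega>" if c: "c \<in> closure \<Omega>" "z + pt c \<notin> cone" for c
  proof
    fix y assume "y \<in> proj_closed_segment \<Omega> c x"
    then obtain v where v: "v \<in> closed_segment (pt c) (pt x)" "y = abs_proj v"
      unfolding proj_closed_segment_eq[OF c(1) x] by blast
    then obtain t where t: "0 \<le> t" "t \<le> 1" "v = (1 - t) *\<^sub>R pt c + t *\<^sub>R pt x" by (auto simp: in_segment)
    note s = segment_in_K[OF c(1) x v(1)]
    have "v \<notin> cone" using out[OF c, of "1 - t" "t / r"] t r by (simp add: ptx)
    then show "y \<in> frontier \<Omega>" using s v(2) by (simp add: frontier_iff cone_def)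
  qed
  have sym: "proj_closed_segment \<Omega> x b = proj_closed_segment \<Omega> b x"
    by (simp add: proj_closed_segment_def closed_segment_commute)
  have "x \<in> frontier \<Omega>" using seg[OF cl(1) z(3)] x unfolding proj_closed_segment_def by auto
  then show ?thesis
    unfolding in_half_triangle_def using ab seg[OF cl(1) z(3)] seg[OF cl(2) z(4)] sym by (metis Un_least)
qed

lemma in_half_triangleE:
  assumes "in_half_triangle \<Omega> l"
  obtains a b z where "a \<in> frontier \<Omega>" "b \<in> frontier \<Omega>" "l = proj_open_segment \<Omega> a b"
    "z \<in> K" "z \<noteq> 0" "z + pt a \<notin> cone" "z + pt b \<notin> cone"
proof -
  obtain a b x where x: "a \<in> frontier \<Omega>" "b \<in> frontier \<Omega>" "l = proj_open_segment \<Omega> a b" "x \<in> frontier \<Omega>"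
    "proj_closed_segment \<Omega> a x \<subseteq> frontier \<Omega>" "proj_closed_segment \<Omega> x b \<subseteq> frontier \<Omega>"
    using assms unfolding in_half_triangle_def by blast
  have cl: "a \<in> closure \<Omega>" "b \<in> closure \<Omega>" "x \<in> closure \<Omega>" using x frontier_iff by auto
  have out: "pt y + pt c \<notin> cone" if c: "c \<in> closure \<Omega>" "y \<in> closure \<Omega>" "proj_closed_segment \<Omega> c y \<subseteq> frontier \<Omega>" for c y
  proof
    assume "pt y + pt c \<in> cone"
    from cone_scale[OF this, of "1/2"] have "midpoint (pt c) (pt y) \<in> cone" by (simp add: midpoint_def add.commute)
    moreover have "abs_proj (midpoint (pt c) (pt y)) \<in> frontier \<Omega>"
      using c(3) unfolding proj_closed_segment_eq[OF c(1,2)] by (auto simp: image_subset_iff)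
    ultimately show False by (simp add: frontier_iff cone_def)
  qed
  show ?thesis
  proof (rule that[OF x(1-3)])
    show "pt x \<in> K" "pt x \<noteq> 0" using pt_in_K pt_closure cl by auto
    show "pt x + pt a \<notin> cone" by (rule out[OF cl(1,3) x(5)])
    show "pt x + pt b \<notin> cone" using out[OF cl(3,2) x(6)] by (simp add: add.commute)
  qed
qed

end

theorem proposition6p8:
  fixes \<Omega> :: "'n::finite proj set" and \<Gamma> :: "'n pgl set" and \<gamma> :: "'n pgl"
  assumes "properly_convex_domain \<Omega>"
    and "subgroup \<Gamma> PGL" and "\<Gamma> \<subseteq> Aut \<Omega>"
    and "discrete \<Gamma>"
    and "acts_cocompactly \<Gamma> \<Omega>"
    and "\<gamma> \<in> \<Gamma>" and "translation_length \<Omega> \<gamma> > 0"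
    and "\<exists>l. is_axis \<Omega> \<gamma> l"
  shows "(biproximal \<gamma> \<longleftrightarrow> (\<forall>l. is_axis \<Omega> \<gamma> l \<longrightarrow> \<not> in_half_triangle \<Omega> l)) \<and>
    ((\<forall>l. is_axis \<Omega> \<gamma> l \<longrightarrow> \<not> in_half_triangle \<Omega> l) \<longleftrightarrow> rank_one_isometry \<Omega> \<gamma>)"
proof -
  interpret convex_domain \<Omega> by unfold_locales (rule assms(1))
  have aut: "\<gamma> \<in> Aut \<Omega>" using assms by blast
  have "\<not> in_half_triangle \<Omega> l" if biprox: "biproximal \<gamma>" and axis: "is_axis \<Omega> \<gamma> l" for l
  proof
    assume "in_half_triangle \<Omega> l"
    then obtain a b z where ab: "a \<in> frontier \<Omega>" "b \<in> frontier \<Omega>" "l = proj_open_segment \<Omega> a b"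
      and z: "z \<in> K" "z \<noteq> 0" "z + pt a \<notin> cone" "z + pt b \<notin> cone" by (rule in_half_triangleE)
    have cl: "a \<in> closure \<Omega>" "b \<in> closure \<Omega>" using ab frontier_iff by auto
    obtain a' b' where ab': "a' \<in> closure \<Omega>" "b' \<in> closure \<Omega>" "a' \<noteq> b'" "l = proj_open_segment \<Omega> a' b'"
      using axis unfolding is_axis_def by blast
    \<comment> \<open>\<open>in_half_triangle\<close> brings its own endpoints, which might
      coincide; then the segment would be empty, whereas an axis contains a midpoint.\<close>
    have "a \<noteq> b"
    proof
      assume "a = b"
      then have "l = {}"
        unfolding ab(3) proj_open_segment_def proj_closed_segment_eq[OF cl]
        using pt_closure(2)[OF cl(2)] by auto
      moreover have "abs_proj (midpoint (pt a') (pt b')) \<in> l"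
      proof -
        have seg: "midpoint (pt a') (pt b') \<in> closed_segment (pt a') (pt b')" by simp
        have "midpoint (pt a') (pt b') \<noteq> pt a'" "midpoint (pt a') (pt b') \<noteq> pt b'"
          using pt_inj ab' by (auto simp: midpoint_eq_endpoint)
        then have "abs_proj (midpoint (pt a') (pt b')) \<noteq> a'" "abs_proj (midpoint (pt a') (pt b')) \<noteq> b'"
          using pt_abs[OF segment_in_K(2)[OF ab'(1,2) seg]] by metis+
        then show ?thesis
          using seg unfolding ab'(4) proj_open_segment_def proj_closed_segment_eq[OF ab'(1,2)] by blast
      qed
      ultimately show False by blast
    qed
    then obtain A p q where A: "is_lift A \<gamma>" "CARD('n) \<ge> 2"
      and hyp: "hyperbolic_cone_map cone normal radius A (pt a) (pt b) p q \<or>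
        hyperbolic_cone_map cone normal radius A (pt b) (pt a) p q"
      using axis_hyperbolic[OF axis aut assms(7) cl _ ab(3)] by metis
    obtain u e M d where group:
      "cocompact_cone_group cone normal radius {P. invertible P \<and> abs_pgl P \<in> \<Gamma> \<and> (*v) P ` cone = cone} u e M d"
      using cocompact_group[OF assms(2-5)] by blast
    \<comment> \<open>Stated for x and y because either endpoint may be the attracting one; the
      condition on \<open>z\<close> is symmetric in them.\<close>
    have no: False if h: "hyperbolic_cone_map cone normal radius A x y p q"
      and "z + x \<notin> cone" "z + y \<notin> cone" for x y
    proof -
      interpret h: hyperbolic_cone_map cone normal radius A x y p q by (rule h)
      have "A \<in> {P. invertible P \<and> abs_pgl P \<in> \<Gamma> \<and> (*v) P ` cone = cone}"
        using h.invertible_A h.A_cone A(1) assms(6) by (simp add: is_lift_def)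
      then show False
        using cocompact_cone_group.no_half_triangle[OF group h _ _ _ z(1,2) that(2,3)]
          biprox h.biproximal_iff[OF A] by blast
    qed
    from hyp show False using no z by blast
  qed
  moreover have "biproximal \<gamma>" if none: "\<forall>l. is_axis \<Omega> \<gamma> l \<longrightarrow> \<not> in_half_triangle \<Omega> l"
  proof (rule ccontr)
    assume not: "\<not> biproximal \<gamma>"
    obtain l where axis: "is_axis \<Omega> \<gamma> l" using assms(8) by blast
    then obtain a b where ab: "a \<in> closure \<Omega>" "b \<in> closure \<Omega>" "a \<noteq> b" "l = proj_open_segment \<Omega> a b"
      unfolding is_axis_def by blast
    obtain A p q where A: "is_lift A \<gamma>" "CARD('n) \<ge> 2" "a \<in> frontier \<Omega>" "b \<in> frontier \<Omega>" "l \<subseteq> \<Omega>"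
      and hyp: "hyperbolic_cone_map cone normal radius A (pt a) (pt b) p q \<or>
        hyperbolic_cone_map cone normal radius A (pt b) (pt a) p q"
      using axis_hyperbolic[OF axis aut assms(7) ab] by metis
    from hyp obtain z where "z \<in> K" "z \<noteq> 0" "z + pt a \<notin> cone" "z + pt b \<notin> cone"
      using hyperbolic_cone_map.half_triangle_of_not_biproximal[OF _ A(1,2) not] by metis
    then have "in_half_triangle \<Omega> l" using in_half_triangleI A(3-5) ab(4) by blast
    then show False using none axis by blast
  qed
  ultimately show ?thesis
    using aut assms(7,8) unfolding rank_one_isometry_def by blast
qed

end
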